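(* Let $\mathcal{P}$ be an atomic chiral polyhedron of type $\{p, q\}$ with $q > p$, with rotation group $\Gamma^+(\mathcal P)=\langle\sigma_1,\sigma_2\rangle$, and suppose that the core of $\langle \sigma_2 \rangle$ in $\Gamma^+(\mathcal P)$ is $\langle \sigma_2^{q'} \rangle$. Then $\Gamma^+(\mathcal{P}) = \Gamma^{p, q}(i,\ 1+kq',\ -i,\ -1-akq')$ for some integers $i$, $k$, and $a$, where $a^2 \equiv 1 \pmod{q/q'}$ and $a \neq 1$. Furthermore, $p$ is even.
   Context: For integers $p,q,i_1,j_1,i_2,j_2$, $\Gamma^{p,q}(i_1,j_1,i_2,j_2)$ denotes the group with presentation $\langle \sigma_1,\sigma_2 \mid \sigma_1^p=\sigma_2^q=(\sigma_1\sigma_2)^2=1,\ \sigma_2^{-1}\sigma_1=\sigma_1^{i_1}\sigma_2^{j_1},\ \sigma_2\sigma_1^{-1}=\sigma_1^{i_2}\sigma_2^{j_2}\rangle$; an equality $\Gamma^+(\mathcal P)=\Gamma^{p,q}(\dots)$ means the map sending the generators $\sigma_1,\sigma_2$ of the presented group to the distinguished generators of $\Gamma^+(\mathcal P)$ is an isomorphism. An (abstract) polyhedron is a partially ordered set whose elements have rank $0$, $1$, $2$ (vertices, edges, faces), incidence meaning comparability, such that every edge is incident to exactly two vertices and two faces, whenever a vertex is incident to a face exactly two edges are incident to both, the incidence graph is connected, and for each vertex or face the subgraph of the incidence graph induced on its neighbours is connected. A flag is a mutually incident (vertex, edge, face) triple; $\Phi^i$ is the flag differing from $\Phi$ exactly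 in its rank-$i$ element. Type $\{p,q\}$: faces are incident to $p$ edges and vertices to $q$ edges. A polyhedron is regular if its automorphism group is flag-transitive, and chiral if its flags split into two classes with $\Phi,\Phi^i$ always in different classes and the automorphism group transitive on each class but not on all flags. For a regular or chiral polyhedron with base flag $\Phi$, $\sigma_1:\Phi\mapsto(\Phi^1)^0$ and $\sigma_2:\Phi\mapsto(\Phi^2)^1$ generate the rotation group $\Gamma^+(\mathcal P)$. Tight: exactly $2pq$ flags. $\mathcal P$ covers $\mathcal Q$ if there is a homomorphism $\Gamma^+(\mathcal P)\to\Gamma^+(\mathcal Q)$ sending distinguished generators to distinguished generators. A chiral polyhedron of type $\{p,q\}$ is atomic if it is tight and covers no tight chiral polyhedron of type $\{p',q\}$ with $p'<p$ or $\{p,q'\}$ with $q'<q$. The core of a subgroup $H\le G$ is the largest subgroup of $H$ normal in $G$. *)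

theory Defs
  imports "HOL-Algebra.Algebra" "HOL-Number_Theory.Cong"
begin

section \<open>Groups given by generators and relations\<close>

text \<open>A letter \<open>(b, g)\<close> is the generator \<open>g\<close>, inverted iff \<open>b\<close> holds.  A set of relations is a
  set of pairs of words to be identified.\<close>

type_synonym 'g word = "(bool \<times> 'g) list"

inductive pres_eq :: "('g word \<times> 'g word) set \<Rightarrow> 'g word \<Rightarrow> 'g word \<Rightarrow> bool"
  for R where
    refl: "pres_eq R u u"
  | sym: "pres_eq R u v \<Longrightarrow> pres_eq R v u"
  | trans: "pres_eq R u v \<Longrightarrow> pres_eq R v w \<Longrightarrow> pres_eq R u w"
  | cong: "pres_eq R u v \<Longrightarrow> pres_eq R (x @ u @ y) (x @ v @ y)"
  | cancel: "pres_eq R [(b, g), (\<not> b, g)] []"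
  | rel: "(u, v) \<in> R \<Longrightarrow> pres_eq R u v"

definition word_class :: "('g word \<times> 'g word) set \<Rightarrow> 'g word \<Rightarrow> 'g word set" where
  "word_class R w = {v. pres_eq R w v}"

definition presented_group :: "('g word \<times> 'g word) set \<Rightarrow> 'g word set monoid" where
  "presented_group R =
    \<lparr>carrier = range (word_class R),
     monoid.mult = (\<lambda>A B. \<Union>u\<in>A. \<Union>v\<in>B. word_class R (u @ v)),
     one = word_class R []\<rparr>"

lemma word_class_eq_iff: "word_class R u = word_class R v \<longleftrightarrow> pres_eq R u v"
  unfolding word_class_def set_eq_iff mem_Collect_eq
  by (meson pres_eq.refl pres_eq.sym pres_eq.trans)

lemma pres_eq_append:
  assumes "pres_eq R u u'" "pres_eq R v v'"
  shows "pres_eq R (u @ v) (u' @ v')"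
proof -
  have "pres_eq R (u @ v) (u' @ v)" using pres_eq.cong[OF assms(1), of "[]" v] by simp
  moreover have "pres_eq R (u' @ v) (u' @ v')" using pres_eq.cong[OF assms(2), of u' "[]"] by simp
  ultimately show ?thesis by (rule pres_eq.trans)
qed

lemma presented_group_mult:
  "word_class R u \<otimes>\<^bsub>presented_group R\<^esub> word_class R v = word_class R (u @ v)"
proof -
  have "word_class R (u' @ v') = word_class R (u @ v)"
    if "u' \<in> word_class R u" "v' \<in> word_class R v" for u' v'
  proof -
    have "pres_eq R (u @ v) (u' @ v')"
      using that unfolding word_class_def mem_Collect_eq by (rule pres_eq_append)
    then show ?thesis unfolding word_class_eq_iff by (rule pres_eq.sym)
  qed
  moreover have "u \<in> word_class R u" "v \<in> word_class R v"
    by (auto simp: word_class_def intro: pres_eq.refl)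
  ultimately have "(\<Union>u'\<in>word_class R u. \<Union>v'\<in>word_class R v. word_class R (u' @ v'))
      = word_class R (u @ v)"
    by blast
  then show ?thesis by (simp add: presented_group_def)
qed

definition word_inv :: "'g word \<Rightarrow> 'g word" where
  "word_inv w = rev (map (\<lambda>(b, g). (\<not> b, g)) w)"

lemma pres_eq_word_inv: "pres_eq R (word_inv w @ w) []"
proof (induction w)
  case Nil
  show ?case by (simp add: word_inv_def pres_eq.refl)
next
  case (Cons l w)
  obtain b g where l: "l = (b, g)" by (cases l)
  have "pres_eq R [(\<not> b, g), (b, g)] []" using pres_eq.cancel[of R "\<not> b" g] by simp
  from pres_eq.cong[OF this, of "word_inv w" w]
  have "pres_eq R (word_inv (l # w) @ l # w) (word_inv w @ w)" by (simp add: l word_inv_def)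
  then show ?case using Cons.IH by (rule pres_eq.trans)
qed

lemma group_presented_group: "group (presented_group R)"
proof (rule groupI)
  fix x assume "x \<in> carrier (presented_group R)"
  then obtain w where w: "x = word_class R w" by (auto simp: presented_group_def)
  have "word_class R (word_inv w) \<otimes>\<^bsub>presented_group R\<^esub> x = \<one>\<^bsub>presented_group R\<^esub>"
    unfolding w presented_group_mult
    by (simp add: presented_group_def word_class_eq_iff pres_eq_word_inv)
  then show "\<exists>y\<in>carrier (presented_group R). y \<otimes>\<^bsub>presented_group R\<^esub> x = \<one>\<^bsub>presented_group R\<^esub>"
    by (auto simp: presented_group_def)
next
  fix x assume "x \<in> carrier (presented_group R)"
  then obtain w where w: "x = word_class R w" by (auto simp: presented_group_def)
  have "\<one>\<^bsub>presented_group R\<^esub> = word_class R []" by (simp add: presented_group_def)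
  then show "\<one>\<^bsub>presented_group R\<^esub> \<otimes>\<^bsub>presented_group R\<^esub> x = x"
    by (simp add: w presented_group_mult)
next
  fix x y assume "x \<in> carrier (presented_group R)" "y \<in> carrier (presented_group R)"
  then obtain u v where "x = word_class R u" "y = word_class R v"
    by (auto simp: presented_group_def)
  then have "x \<otimes>\<^bsub>presented_group R\<^esub> y = word_class R (u @ v)" by (simp add: presented_group_mult)
  then show "x \<otimes>\<^bsub>presented_group R\<^esub> y \<in> carrier (presented_group R)"
    by (simp add: presented_group_def)
next
  show "\<one>\<^bsub>presented_group R\<^esub> \<in> carrier (presented_group R)" by (simp add: presented_group_def)
next
  fix x y z
  assume "x \<in> carrier (presented_group R)" "y \<in> carrier (presented_group R)"
    "z \<in> carrier (presented_group R)"
  then obtain u v w where "x = word_class R u" "y = word_class R v" "z = word_class R w"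
    by (auto simp: presented_group_def)
  then show "x \<otimes>\<^bsub>presented_group R\<^esub> y \<otimes>\<^bsub>presented_group R\<^esub> z
      = x \<otimes>\<^bsub>presented_group R\<^esub> (y \<otimes>\<^bsub>presented_group R\<^esub> z)"
    by (simp add: presented_group_mult)
qed

datatype gen = S1 | S2

definition gpow :: "'g \<Rightarrow> int \<Rightarrow> 'g word" where
  "gpow g n = replicate (nat \<bar>n\<bar>) (n < 0, g)"

definition Gamma_rels ::
  "int \<Rightarrow> int \<Rightarrow> int \<Rightarrow> int \<Rightarrow> int \<Rightarrow> int \<Rightarrow> (gen word \<times> gen word) set" where
  "Gamma_rels p q i1 j1 i2 j2 =
    {(gpow S1 p, []),
     (gpow S2 q, []),
     (gpow S1 1 @ gpow S2 1 @ gpow S1 1 @ gpow S2 1, []),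
     (gpow S2 (-1) @ gpow S1 1, gpow S1 i1 @ gpow S2 j1),
     (gpow S2 1 @ gpow S1 (-1), gpow S1 i2 @ gpow S2 j2)}"

definition Gamma_pq ::
  "int \<Rightarrow> int \<Rightarrow> int \<Rightarrow> int \<Rightarrow> int \<Rightarrow> int \<Rightarrow> gen word set monoid" where
  "Gamma_pq p q i1 j1 i2 j2 = presented_group (Gamma_rels p q i1 j1 i2 j2)"

definition Gamma_gen ::
  "int \<Rightarrow> int \<Rightarrow> int \<Rightarrow> int \<Rightarrow> int \<Rightarrow> int \<Rightarrow> gen \<Rightarrow> gen word set" where
  "Gamma_gen p q i1 j1 i2 j2 g = word_class (Gamma_rels p q i1 j1 i2 j2) (gpow g 1)"

section \<open>Abstract polyhedra\<close>

record 'a ranked_poset =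
  elts :: "'a set"
  leq_rel :: "('a \<times> 'a) set"
  rk :: "'a \<Rightarrow> nat"

definition elts_of_rank :: "'a ranked_poset \<Rightarrow> nat \<Rightarrow> 'a set" where
  "elts_of_rank P i = {x \<in> elts P. rk P x = i}"

definition incidence :: "'a ranked_poset \<Rightarrow> ('a \<times> 'a) set" where
  "incidence P = {(x, y). x \<in> elts P \<and> y \<in> elts P \<and> x \<noteq> y \<and> ((x, y) \<in> leq_rel P \<or> (y, x) \<in> leq_rel P)}"

definition connected_on :: "('a \<times> 'a) set \<Rightarrow> 'a set \<Rightarrow> bool" where
  "connected_on E S \<longleftrightarrow> (\<forall>x\<in>S. \<forall>y\<in>S. (x, y) \<in> (E \<inter> S \<times> S)\<^sup>*)"

definition polyhedron :: "'a ranked_poset \<Rightarrow> bool" where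
  "polyhedron P \<longleftrightarrow>
    partial_order_on (elts P) (leq_rel P) \<and>
    rk P ` elts P \<subseteq> {0, 1, 2} \<and>
    (\<forall>(x, y) \<in> leq_rel P. x \<noteq> y \<longrightarrow> rk P x < rk P y) \<and>
    (\<forall>e\<in>elts_of_rank P 1.
       card {v \<in> elts_of_rank P 0. (v, e) \<in> incidence P} = 2 \<and>
       card {f \<in> elts_of_rank P 2. (e, f) \<in> incidence P} = 2) \<and>
    (\<forall>v\<in>elts_of_rank P 0. \<forall>f\<in>elts_of_rank P 2. (v, f) \<in> incidence P \<longrightarrow>
       card {e \<in> elts_of_rank P 1. (v, e) \<in> incidence P \<and> (e, f) \<in> incidence P} = 2) \<and>
    connected_on (incidence P) (elts P) \<and>
    (\<forall>x\<in>elts_of_rank P 0 \<union> elts_of_rank P 2. connected_on (incidence P) (incidence P `` {x}))"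

type_synonym 'a flag = "'a \<times> 'a \<times> 'a"

definition flags :: "'a ranked_poset \<Rightarrow> 'a flag set" where
  "flags P = {(v, e, f). v \<in> elts_of_rank P 0 \<and> e \<in> elts_of_rank P 1 \<and> f \<in> elts_of_rank P 2 \<and>
     (v, e) \<in> incidence P \<and> (e, f) \<in> incidence P \<and> (v, f) \<in> incidence P}"

fun flag_elt :: "'a flag \<Rightarrow> nat \<Rightarrow> 'a" where
  "flag_elt (v, e, f) i = (if i = 0 then v else if i = 1 then e else f)"

definition flag_adj :: "'a ranked_poset \<Rightarrow> nat \<Rightarrow> 'a flag \<Rightarrow> 'a flag" where
  "flag_adj P i \<Phi> = (THE \<Psi>. \<Psi> \<in> flags P \<and>
     (\<forall>j\<in>{0, 1, 2}. flag_elt \<Psi> j = flag_elt \<Phi> j \<longleftrightarrow> j \<noteq> i))"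

text \<open>The finiteness conditions exclude the convention that infinite sets have cardinality \<open>0\<close>.\<close>

definition has_type :: "'a ranked_poset \<Rightarrow> nat \<Rightarrow> nat \<Rightarrow> bool" where
  "has_type P p q \<longleftrightarrow>
    (\<forall>f\<in>elts_of_rank P 2. finite {e \<in> elts_of_rank P 1. (e, f) \<in> incidence P} \<and>
       card {e \<in> elts_of_rank P 1. (e, f) \<in> incidence P} = p) \<and>
    (\<forall>v\<in>elts_of_rank P 0. finite {e \<in> elts_of_rank P 1. (v, e) \<in> incidence P} \<and>
       card {e \<in> elts_of_rank P 1. (v, e) \<in> incidence P} = q)"

definition tight_polyhedron :: "'a ranked_poset \<Rightarrow> nat \<Rightarrow> nat \<Rightarrow> bool" where
  "tight_polyhedron P p q \<longleftrightarrow> has_type P p q \<and> finite (flags P) \<and> card (flags P) = 2 * p * q"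

section \<open>Automorphisms and chirality\<close>

definition auts :: "'a ranked_poset \<Rightarrow> ('a \<Rightarrow> 'a) set" where
  "auts P = {\<gamma> \<in> Bij (elts P). \<forall>x\<in>elts P. \<forall>y\<in>elts P. (\<gamma> x, \<gamma> y) \<in> leq_rel P \<longleftrightarrow> (x, y) \<in> leq_rel P}"

text \<open>Automorphisms act on the right: a product applies its left factor first (the opposite of
  \<^const>\<open>BijGroup\<close>), as in the usual convention that the rotation \<open>\<Phi> \<mapsto> (\<Phi>\<^sup>i)\<^sup>j\<close> of a regular
  polyhedron is the product \<open>\<rho>\<^sub>j \<rho>\<^sub>i\<close> of the reflections \<open>\<rho>\<^sub>i : \<Phi> \<mapsto> \<Phi>\<^sup>i\<close>.\<close>

definition aut_group :: "'a ranked_poset \<Rightarrow> ('a \<Rightarrow> 'a) monoid" where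
  "aut_group P =
    \<lparr>carrier = auts P, monoid.mult = (\<lambda>f g. compose (elts P) g f), one = (\<lambda>x\<in>elts P. x)\<rparr>"

lemma group_aut_group: "group (aut_group P)"
proof (rule groupI)
  fix f assume "f \<in> carrier (aut_group P)"
  then have f: "f \<in> Bij (elts P)"
    and leq: "\<And>x y. x \<in> elts P \<Longrightarrow> y \<in> elts P \<Longrightarrow> (f x, f y) \<in> leq_rel P \<longleftrightarrow> (x, y) \<in> leq_rel P"
    by (auto simp: aut_group_def auts_def)
  let ?g = "restrict (inv_into (elts P) f) (elts P)"
  have im: "f ` elts P = elts P" using f by (auto simp: Bij_def bij_betw_def)
  have "?g \<in> auts P"
    unfolding auts_def
  proof (intro CollectI conjI ballI)
    show "?g \<in> Bij (elts P)" by (rule restrict_inv_into_Bij[OF f])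
    fix x y assume "x \<in> elts P" "y \<in> elts P"
    then show "(?g x, ?g y) \<in> leq_rel P \<longleftrightarrow> (x, y) \<in> leq_rel P"
      using leq[of "?g x" "?g y"] im Bij_inv_into_mem[OF f] by (simp add: f_inv_into_f)
  qed
  moreover have "compose (elts P) f ?g = (\<lambda>x\<in>elts P. x)"
    using im by (auto simp: compose_def f_inv_into_f)
  ultimately show "\<exists>g\<in>carrier (aut_group P). g \<otimes>\<^bsub>aut_group P\<^esub> f = \<one>\<^bsub>aut_group P\<^esub>"
    by (auto simp: aut_group_def)
next
  fix f g assume "f \<in> carrier (aut_group P)" "g \<in> carrier (aut_group P)"
  then show "f \<otimes>\<^bsub>aut_group P\<^esub> g \<in> carrier (aut_group P)"
    by (simp add: aut_group_def auts_def compose_Bij compose_eq funcset_mem[OF Bij_imp_funcset])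
next
  show "\<one>\<^bsub>aut_group P\<^esub> \<in> carrier (aut_group P)"
    by (simp add: aut_group_def auts_def id_Bij)
next
  fix f g h
  assume "f \<in> carrier (aut_group P)" "g \<in> carrier (aut_group P)" "h \<in> carrier (aut_group P)"
  then show "f \<otimes>\<^bsub>aut_group P\<^esub> g \<otimes>\<^bsub>aut_group P\<^esub> h = f \<otimes>\<^bsub>aut_group P\<^esub> (g \<otimes>\<^bsub>aut_group P\<^esub> h)"
    by (simp add: aut_group_def auts_def compose_assoc[OF Bij_imp_funcset])
next
  fix f assume "f \<in> carrier (aut_group P)"
  then have "f \<in> extensional (elts P)"
    by (simp add: aut_group_def auts_def Bij_imp_extensional)
  then show "\<one>\<^bsub>aut_group P\<^esub> \<otimes>\<^bsub>aut_group P\<^esub> f = f"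
    by (auto simp: aut_group_def compose_def extensional_def)
qed

definition flag_map :: "('a \<Rightarrow> 'a) \<Rightarrow> 'a flag \<Rightarrow> 'a flag" where
  "flag_map \<gamma> = map_prod \<gamma> (map_prod \<gamma> \<gamma>)"

definition transitive_on :: "'a ranked_poset \<Rightarrow> 'a flag set \<Rightarrow> bool" where
  "transitive_on P A \<longleftrightarrow> (\<forall>\<Phi>\<in>A. \<forall>\<Psi>\<in>A. \<exists>\<gamma>\<in>auts P. flag_map \<gamma> \<Phi> = \<Psi>)"

definition chiral_polyhedron :: "'a ranked_poset \<Rightarrow> bool" where
  "chiral_polyhedron P \<longleftrightarrow> polyhedron P \<and>
    (\<exists>A B. A \<union> B = flags P \<and> A \<inter> B = {} \<and>
      (\<forall>\<Phi>\<in>flags P. \<forall>i\<in>{0, 1, 2}. \<Phi> \<in> A \<longleftrightarrow> flag_adj P i \<Phi> \<in> B) \<and>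
      transitive_on P A \<and> transitive_on P B) \<and>
    \<not> transitive_on P (flags P)"

section \<open>Rotation groups, coverings and atomic polyhedra\<close>

definition rot1 :: "'a ranked_poset \<Rightarrow> 'a flag \<Rightarrow> 'a \<Rightarrow> 'a" where
  "rot1 P \<Phi> = (THE \<gamma>. \<gamma> \<in> auts P \<and> flag_map \<gamma> \<Phi> = flag_adj P 0 (flag_adj P 1 \<Phi>))"

definition rot2 :: "'a ranked_poset \<Rightarrow> 'a flag \<Rightarrow> 'a \<Rightarrow> 'a" where
  "rot2 P \<Phi> = (THE \<gamma>. \<gamma> \<in> auts P \<and> flag_map \<gamma> \<Phi> = flag_adj P 1 (flag_adj P 2 \<Phi>))"

definition rot_group :: "'a ranked_poset \<Rightarrow> 'a flag \<Rightarrow> ('a \<Rightarrow> 'a) monoid" where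
  "rot_group P \<Phi> =
    (aut_group P)\<lparr>carrier := generate (aut_group P) {rot1 P \<Phi>, rot2 P \<Phi>}\<rparr>"

definition covers :: "'a ranked_poset \<Rightarrow> 'a flag \<Rightarrow> 'b ranked_poset \<Rightarrow> 'b flag \<Rightarrow> bool" where
  "covers P \<Phi> Q \<Psi> \<longleftrightarrow>
    (\<exists>h\<in>hom (rot_group P \<Phi>) (rot_group Q \<Psi>).
       h (rot1 P \<Phi>) = rot1 Q \<Psi> \<and> h (rot2 P \<Phi>) = rot2 Q \<Psi>)"

text \<open>Tight polyhedra are finite, so up to isomorphism each of them has its elements in
  \<^typ>\<open>nat\<close>.  Every base flag of the covered polyhedron is excluded, so that both of its
  enantiomorphic forms are.\<close>

definition atomic_chiral :: "'a ranked_poset \<Rightarrow> 'a flag \<Rightarrow> nat \<Rightarrow> nat \<Rightarrow> bool" where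
  "atomic_chiral P \<Phi> p q \<longleftrightarrow> chiral_polyhedron P \<and> tight_polyhedron P p q \<and>
    (\<nexists>(Q :: nat ranked_poset) \<Psi> p'. p' < p \<and> chiral_polyhedron Q \<and> tight_polyhedron Q p' q \<and>
       \<Psi> \<in> flags Q \<and> covers P \<Phi> Q \<Psi>) \<and>
    (\<nexists>(Q :: nat ranked_poset) \<Psi> q'. q' < q \<and> chiral_polyhedron Q \<and> tight_polyhedron Q p q' \<and>
       \<Psi> \<in> flags Q \<and> covers P \<Phi> Q \<Psi>)"

definition is_core :: "('g, 'm) monoid_scheme \<Rightarrow> 'g set \<Rightarrow> 'g set \<Rightarrow> bool" where
  "is_core G H K \<longleftrightarrow> K \<lhd> G \<and> K \<subseteq> H \<and> (\<forall>N. N \<lhd> G \<and> N \<subseteq> H \<longrightarrow> N \<subseteq> K)"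

definition rot_group_is_Gamma ::
  "'a ranked_poset \<Rightarrow> 'a flag \<Rightarrow> int \<Rightarrow> int \<Rightarrow> int \<Rightarrow> int \<Rightarrow> int \<Rightarrow> int \<Rightarrow> bool" where
  "rot_group_is_Gamma P \<Phi> p q i1 j1 i2 j2 \<longleftrightarrow>
    (\<exists>h\<in>iso (Gamma_pq p q i1 j1 i2 j2) (rot_group P \<Phi>).
       h (Gamma_gen p q i1 j1 i2 j2 S1) = rot1 P \<Phi> \<and>
       h (Gamma_gen p q i1 j1 i2 j2 S2) = rot2 P \<Phi>)"

end

theory Submission
  imports Defs
begin

text \<open>
  Write \<open>x\<close>, \<open>y\<close> for the distinguished generators of \<open>G = \<Gamma>\<^sup>+(P)\<close>, \<open>X\<close>, \<open>Y\<close> for the cyclic groups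
  they generate and \<open>N\<close> for the core of \<open>Y\<close>.  The polyhedron is the coset geometry of \<open>Y\<close>,
  \<open>{1, xy}\<close>, \<open>X\<close> in \<open>G\<close>, it is chiral iff no endomorphism of \<open>G\<close> inverts both \<open>x\<close> and \<open>y\<close>, and
  tightness means that \<open>G = XY\<close> with \<open>X \<inter> Y = 1\<close>.

  If \<open>c\<close> and \<open>x\<^sup>-\<^sup>1 c x\<close> both lie in \<open>Y\<close>, they have the same order and hence generate the same
  subgroup, which is therefore normal.  So a trivial core would make \<open>(a, b) \<mapsto> a x b\<close> injective
  on \<open>Y \<times> Y\<close>, contradicting \<open>q > p\<close>; thus \<open>N \<noteq> 1\<close>.  Unless \<open>N = Y\<close>, the coset geometry of \<open>G/N\<close>
  is then a smaller tight polyhedron covered by \<open>P\<close>, so by atomicity \<open>G/N\<close> has an endomorphism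
  \<open>\<theta>\<close> inverting both generators.  Write \<open>y\<^sup>-\<^sup>1 x y\<^sup>-\<^sup>1 = x\<^sup>i z\<close> with \<open>z \<in> Y\<close>.  Applying \<open>\<theta>\<close> and inverting
  shows that, modulo \<open>N\<close>, \<open>z\<close> commutes with \<open>x\<^sup>i\<close>, hence with \<open>y\<^sup>-\<^sup>1 x y\<^sup>-\<^sup>1\<close>, hence with \<open>x\<close>.  So
  \<open>\<langle>z, N\<rangle>\<close> is normal and \<open>z \<in> N\<close>, which gives the first relation; the second follows by inverting
  it, where \<open>a\<close> describes the action of \<open>x\<close> on \<open>N\<close>.  From \<open>y x y = x\<^sup>-\<^sup>1\<close> one gets \<open>a\<^sup>2 = 1\<close>.  If
  \<open>a = 1\<close>, the relations are invariant under inverting both generators, contradicting chirality,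
  and if \<open>p\<close> were odd, then \<open>a\<^sup>p = a\<^sup>2 = 1\<close> would force \<open>a = 1\<close>.
\<close>

section \<open>Flags and automorphisms of polyhedra\<close>

text \<open>The definitions speak of posets and the argument of groups, so a dictionary between
  polyhedra and coset geometries is needed in both directions: chirality of P has to become a
  property of G, and atomicity, which excludes polyhedra and not groups, can only be used once
  \<open>G/N\<close> has been realised as a poset on natural numbers. One locale serves both,
  instantiated by the given P and by the constructed quotient. As products of automorphisms apply
  the left factor first, the cosets are right cosets and G acts by right multiplication. Relations
  that hold in G do not yet make G the presented group, which might be larger. The relations alone
  are shown to bring every element into the form \<open>x^m y^n\<close>, and
  \<open>X \<inter> Y = 1\<close> then leaves no kernel. The same isomorphism is behind the case
  \<open>a = 1\<close>: invariance of the relations only gives a homomorphism out of the presented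
  group. The 1 in \<open>1 + k q'\<close> arises because the remainder z is split off from
  \<open>y^-1 x y^-1\<close>. Inverting the generators inverts this word, since it reads the same in
  both directions; \<open>y^-1 x\<close> lacks this symmetry.\<close>

lemma card_2_ex1:
  assumes "card S = 2" "a \<in> S"
  shows "\<exists>!b. b \<in> S \<and> b \<noteq> a"
  using assms unfolding card_2_iff by auto

lemma incidence_sym: "(a, b) \<in> incidence P \<Longrightarrow> (b, a) \<in> incidence P"
  by (auto simp: incidence_def)

text \<open>Names the condition inside the definite description of \<open>flag_adj\<close>, so that
  existence and uniqueness can be stated for it.\<close>

definition differ_at :: "nat \<Rightarrow> 'a flag \<Rightarrow> 'a flag \<Rightarrow> bool" where
  "differ_at i \<Psi> \<Psi>' \<longleftrightarrow> (\<forall>j\<in>{0, 1, 2}. flag_elt \<Psi>' j = flag_elt \<Psi> j \<longleftrightarrow> j \<noteq> i)"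

lemma differ_at_sym: "differ_at i \<Psi> \<Psi>' \<Longrightarrow> differ_at i \<Psi>' \<Psi>"
  unfolding differ_at_def by metis

lemma differ_at_simps:
  "differ_at 0 (v, e, f) (v', e', f') \<longleftrightarrow> v' \<noteq> v \<and> e' = e \<and> f' = f"
  "differ_at (Suc 0) (v, e, f) (v', e', f') \<longleftrightarrow> v' = v \<and> e' \<noteq> e \<and> f' = f"
  "differ_at 2 (v, e, f) (v', e', f') \<longleftrightarrow> v' = v \<and> e' = e \<and> f' \<noteq> f"
  by (auto simp: differ_at_def)

lemma flag_map_simp: "flag_map \<gamma> (v, e, f) = (\<gamma> v, \<gamma> e, \<gamma> f)"
  by (simp add: flag_map_def)

text \<open>The base flag excludes degenerate posets: a single vertex satisfies
  \<open>polyhedron\<close> but lies in no flag.\<close>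

locale flagged_polyhedron =
  fixes P :: "'a ranked_poset" and \<Phi> :: "'a flag"
  assumes polyhedron: "polyhedron P"
    and base_flag: "\<Phi> \<in> flags P"
begin

lemma leq_elts: "(a, b) \<in> leq_rel P \<Longrightarrow> a \<in> elts P \<and> b \<in> elts P"
  using polyhedron by (auto simp: polyhedron_def partial_order_on_def preorder_on_def refl_on_def)

lemma leq_refl: "a \<in> elts P \<Longrightarrow> (a, a) \<in> leq_rel P"
  using polyhedron by (auto simp: polyhedron_def partial_order_on_def preorder_on_def refl_on_def)

lemma leq_trans: "(a, b) \<in> leq_rel P \<Longrightarrow> (b, c) \<in> leq_rel P \<Longrightarrow> (a, c) \<in> leq_rel P"
  using polyhedron
  by (auto simp: polyhedron_def partial_order_on_def preorder_on_def elim: transE)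

lemma leq_rank: "(a, b) \<in> leq_rel P \<Longrightarrow> a \<noteq> b \<Longrightarrow> rk P a < rk P b"
  using polyhedron by (auto simp: polyhedron_def)

lemma rank_le: "a \<in> elts P \<Longrightarrow> rk P a \<le> 2"
  using polyhedron by (auto simp: polyhedron_def)

lemma incidence_iff_leq:
  assumes "rk P a < rk P b"
  shows "(a, b) \<in> incidence P \<longleftrightarrow> (a, b) \<in> leq_rel P"
proof -
  have "(b, a) \<notin> leq_rel P" using assms leq_rank[of b a] by force
  then show ?thesis using assms leq_elts by (auto simp: incidence_def)
qed

lemma incidence_rank: "(a, b) \<in> incidence P \<Longrightarrow> rk P a \<noteq> rk P b"
  using leq_rank[of a b] leq_rank[of b a] by (auto simp: incidence_def)

lemma flagI:
  assumes "v \<in> elts_of_rank P 0" "e \<in> elts_of_rank P 1" "f \<in> elts_of_rank P 2"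
    "(v, e) \<in> incidence P" "(e, f) \<in> incidence P"
  shows "(v, e, f) \<in> flags P"
proof -
  have "(v, f) \<in> leq_rel P"
    using assms incidence_iff_leq[of v e] incidence_iff_leq[of e f] leq_trans[of v e f]
    by (auto simp: elts_of_rank_def)
  then have "(v, f) \<in> incidence P"
    using assms incidence_iff_leq[of v f] by (auto simp: elts_of_rank_def)
  then show ?thesis using assms by (simp add: flags_def)
qed

lemma flagD:
  assumes "(v, e, f) \<in> flags P"
  shows "v \<in> elts_of_rank P 0" "e \<in> elts_of_rank P 1" "f \<in> elts_of_rank P 2"
    "v \<in> elts P" "e \<in> elts P" "f \<in> elts P"
    "(v, e) \<in> incidence P" "(e, f) \<in> incidence P" "(v, f) \<in> incidence P"
    "(v, e) \<in> leq_rel P" "(e, f) \<in> leq_rel P" "(v, f) \<in> leq_rel P"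
    "rk P v = 0" "rk P e = 1" "rk P f = 2"
  using assms incidence_iff_leq[of v e] incidence_iff_leq[of e f] incidence_iff_leq[of v f]
  by (auto simp: flags_def elts_of_rank_def)

lemma card_two:
  "e \<in> elts_of_rank P 1 \<Longrightarrow> card {v \<in> elts_of_rank P 0. (v, e) \<in> incidence P} = 2"
  "e \<in> elts_of_rank P 1 \<Longrightarrow> card {f \<in> elts_of_rank P 2. (e, f) \<in> incidence P} = 2"
  "v \<in> elts_of_rank P 0 \<Longrightarrow> f \<in> elts_of_rank P 2 \<Longrightarrow> (v, f) \<in> incidence P \<Longrightarrow>
    card {e \<in> elts_of_rank P 1. (v, e) \<in> incidence P \<and> (e, f) \<in> incidence P} = 2"
  using polyhedron by (auto simp: polyhedron_def)

section \<open>Existence of flags and of adjacent flags\<close>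

lemma flag_of_vertex_edge:
  assumes "v \<in> elts_of_rank P 0" "e \<in> elts_of_rank P 1" "(v, e) \<in> incidence P"
  shows "\<exists>f. (v, e, f) \<in> flags P"
proof -
  have "{f \<in> elts_of_rank P 2. (e, f) \<in> incidence P} \<noteq> {}"
    using card_two(2)[OF assms(2)] by fastforce
  then show ?thesis using flagI assms by blast
qed

lemma flag_of_edge_face:
  assumes "e \<in> elts_of_rank P 1" "f \<in> elts_of_rank P 2" "(e, f) \<in> incidence P"
  shows "\<exists>v. (v, e, f) \<in> flags P"
proof -
  have "{v \<in> elts_of_rank P 0. (v, e) \<in> incidence P} \<noteq> {}"
    using card_two(1)[OF assms(1)] by fastforce
  then show ?thesis using flagI assms by blast
qed

lemma flag_of_vertex_face:
  assumes "v \<in> elts_of_rank P 0" "f \<in> elts_of_rank P 2" "(v, f) \<in> incidence P"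
  shows "\<exists>e. (v, e, f) \<in> flags P"
proof -
  have "{e \<in> elts_of_rank P 1. (v, e) \<in> incidence P \<and> (e, f) \<in> incidence P} \<noteq> {}"
    using card_two(3)[OF assms] by (metis card.empty zero_neq_numeral)
  then show ?thesis using flagI assms by blast
qed

text \<open>An incident pair occupies two of the three ranks. The diamond condition counts two
  candidates for the missing rank, so there is at least one.\<close>

lemma incident_in_flag:
  assumes "(a, b) \<in> incidence P"
  obtains v e f where "(v, e, f) \<in> flags P" "a \<in> {v, e, f}" "b \<in> {v, e, f}"
proof -
  have lt: "\<exists>v e f. (v, e, f) \<in> flags P \<and> a \<in> {v, e, f} \<and> b \<in> {v, e, f}"
    if inc: "(a, b) \<in> incidence P" and rk: "rk P a < rk P b" for a b
  proof -
    have ab: "a \<in> elts P" "b \<in> elts P" using inc by (auto simp: incidence_def)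
    have "rk P b \<le> 2" using ab(2) by (rule rank_le)
    then consider "a \<in> elts_of_rank P 0" "b \<in> elts_of_rank P 1"
      | "a \<in> elts_of_rank P 0" "b \<in> elts_of_rank P 2"
      | "a \<in> elts_of_rank P 1" "b \<in> elts_of_rank P 2"
      using rk ab unfolding elts_of_rank_def by force
    then show ?thesis
      by cases (use flag_of_vertex_edge flag_of_edge_face flag_of_vertex_face inc in blast)+
  qed
  have "rk P a < rk P b \<or> rk P b < rk P a" using incidence_rank[OF assms] by auto
  then show ?thesis using lt[OF assms] lt[OF incidence_sym[OF assms]] that by blast
qed

text \<open>A path in the incidence graph from \<open>a\<close> to some other element begins at a
  neighbour of \<open>a\<close>; the base flag supplies the other element.\<close>

lemma elt_in_flag:
  assumes "a \<in> elts P"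
  obtains v e f where "(v, e, f) \<in> flags P" "a \<in> {v, e, f}"
proof -
  obtain v0 e0 f0 where "\<Phi> = (v0, e0, f0)" by (cases \<Phi>)
  then have fl: "(v0, e0, f0) \<in> flags P" using base_flag by simp
  have "v0 \<noteq> e0" using flagD(13,14)[OF fl] by auto
  then obtain b where b: "b \<in> elts P" "b \<noteq> a" using flagD(4,5)[OF fl] by metis
  have "(a, b) \<in> (incidence P \<inter> elts P \<times> elts P)\<^sup>*"
    using polyhedron assms b by (auto simp: polyhedron_def connected_on_def)
  then obtain c where "(a, c) \<in> incidence P" using b(2) by (auto elim: converse_rtranclE)
  then show ?thesis using that by (auto elim: incident_in_flag)
qed

text \<open>Each count in the diamond condition is 2, so exactly one alternative to the current
  element remains. This gives the definite description in \<open>flag_adj\<close> its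
  meaning.\<close>

lemma flag_adj_ex1:
  assumes "\<Psi> \<in> flags P" "i \<in> {0, 1, 2}"
  shows "\<exists>!\<Psi>'. \<Psi>' \<in> flags P \<and> differ_at i \<Psi> \<Psi>'"
proof -
  obtain v e f where \<Psi>: "\<Psi> = (v, e, f)" by (cases \<Psi>)
  then have fl: "(v, e, f) \<in> flags P" using assms by simp
  note d = flagD[OF fl]
  consider "i = 0" | "i = 1" | "i = 2" using assms by auto
  then show ?thesis
  proof cases
    case 1
    have "\<exists>!w. w \<in> {v \<in> elts_of_rank P 0. (v, e) \<in> incidence P} \<and> w \<noteq> v"
      using card_2_ex1[OF card_two(1)] d by simp
    then obtain w where w: "w \<in> {v \<in> elts_of_rank P 0. (v, e) \<in> incidence P}" "w \<noteq> v"
      and uniq: "\<And>w'. w' \<in> {v \<in> elts_of_rank P 0. (v, e) \<in> incidence P} \<Longrightarrow> w' \<noteq> v \<Longrightarrow> w' = w"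
      by (elim ex1E) blast
    show ?thesis unfolding 1 \<Psi>
    proof (rule ex1I[of _ "(w, e, f)"])
      show "(w, e, f) \<in> flags P \<and> differ_at 0 (v, e, f) (w, e, f)"
        using w d flagI by (simp add: differ_at_simps)
      show "\<Psi>' = (w, e, f)" if "\<Psi>' \<in> flags P \<and> differ_at 0 (v, e, f) \<Psi>'" for \<Psi>'
        using that uniq flagD by (cases \<Psi>') (auto simp: differ_at_simps)
    qed
  next
    case 2
    have "\<exists>!w. w \<in> {w \<in> elts_of_rank P 1. (v, w) \<in> incidence P \<and> (w, f) \<in> incidence P} \<and> w \<noteq> e"
      using card_2_ex1[OF card_two(3)] d by simp
    then obtain w where w: "w \<in> {w \<in> elts_of_rank P 1. (v, w) \<in> incidence P \<and> (w, f) \<in> incidence P}" "w \<noteq> e"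
      and uniq: "\<And>w'. w' \<in> {w \<in> elts_of_rank P 1. (v, w) \<in> incidence P \<and> (w, f) \<in> incidence P} \<Longrightarrow> w' \<noteq> e \<Longrightarrow> w' = w"
      by (elim ex1E) blast
    show ?thesis unfolding 2 \<Psi>
    proof (rule ex1I[of _ "(v, w, f)"])
      show "(v, w, f) \<in> flags P \<and> differ_at 1 (v, e, f) (v, w, f)"
        using w d flagI by (simp add: differ_at_simps)
      show "\<Psi>' = (v, w, f)" if "\<Psi>' \<in> flags P \<and> differ_at 1 (v, e, f) \<Psi>'" for \<Psi>'
        using that uniq flagD by (cases \<Psi>') (auto simp: differ_at_simps)
    qed
  next
    case 3
    have "\<exists>!w. w \<in> {f \<in> elts_of_rank P 2. (e, f) \<in> incidence P} \<and> w \<noteq> f"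
      using card_2_ex1[OF card_two(2)] d by simp
    then obtain w where w: "w \<in> {f \<in> elts_of_rank P 2. (e, f) \<in> incidence P}" "w \<noteq> f"
      and uniq: "\<And>w'. w' \<in> {f \<in> elts_of_rank P 2. (e, f) \<in> incidence P} \<Longrightarrow> w' \<noteq> f \<Longrightarrow> w' = w"
      by (elim ex1E) blast
    show ?thesis unfolding 3 \<Psi>
    proof (rule ex1I[of _ "(v, e, w)"])
      show "(v, e, w) \<in> flags P \<and> differ_at 2 (v, e, f) (v, e, w)"
        using w d flagI by (simp add: differ_at_simps)
      show "\<Psi>' = (v, e, w)" if "\<Psi>' \<in> flags P \<and> differ_at 2 (v, e, f) \<Psi>'" for \<Psi>'
        using that uniq flagD by (cases \<Psi>') (auto simp: differ_at_simps)
    qed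
  qed
qed

lemma flag_adj_eqI:
  assumes "\<Psi> \<in> flags P" "i \<in> {0, 1, 2}" "\<Psi>' \<in> flags P" "differ_at i \<Psi> \<Psi>'"
  shows "flag_adj P i \<Psi> = \<Psi>'"
  unfolding flag_adj_def using the1_equality[OF flag_adj_ex1[OF assms(1,2)]] assms(3,4)
  by (simp add: differ_at_def)

lemma flag_adj:
  assumes "\<Psi> \<in> flags P" "i \<in> {0, 1, 2}"
  shows "flag_adj P i \<Psi> \<in> flags P" "differ_at i \<Psi> (flag_adj P i \<Psi>)"
proof -
  obtain \<Psi>' where "\<Psi>' \<in> flags P \<and> differ_at i \<Psi> \<Psi>'"
    using flag_adj_ex1[OF assms] by blast
  then show "flag_adj P i \<Psi> \<in> flags P" "differ_at i \<Psi> (flag_adj P i \<Psi>)"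
    using flag_adj_eqI[OF assms, of \<Psi>'] by auto
qed

lemma flag_adj_invol:
  assumes "\<Psi> \<in> flags P" "i \<in> {0, 1, 2}"
  shows "flag_adj P i (flag_adj P i \<Psi>) = \<Psi>"
  using flag_adj[OF assms] flag_adj_eqI[of "flag_adj P i \<Psi>"] differ_at_sym assms by metis

lemma flag_adj_forms:
  assumes "(v, e, f) \<in> flags P"
  obtains v' e' f' where
    "flag_adj P 0 (v, e, f) = (v', e, f)" "v' \<noteq> v" "(v', e, f) \<in> flags P"
    "flag_adj P 1 (v, e, f) = (v, e', f)" "e' \<noteq> e" "(v, e', f) \<in> flags P"
    "flag_adj P 2 (v, e, f) = (v, e, f')" "f' \<noteq> f" "(v, e, f') \<in> flags P"
proof -
  have i: "0 \<in> {0, 1, 2 :: nat}" "1 \<in> {0, 1, 2 :: nat}" "2 \<in> {0, 1, 2 :: nat}" by auto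
  obtain v' where "flag_adj P 0 (v, e, f) = (v', e, f)" "v' \<noteq> v" "(v', e, f) \<in> flags P"
    using flag_adj[OF assms i(1)] by (cases "flag_adj P 0 (v, e, f)") (auto simp: differ_at_simps)
  moreover obtain e' where "flag_adj P 1 (v, e, f) = (v, e', f)" "e' \<noteq> e" "(v, e', f) \<in> flags P"
    using flag_adj[OF assms i(2)] by (cases "flag_adj P 1 (v, e, f)") (auto simp: differ_at_simps)
  moreover obtain f' where "flag_adj P 2 (v, e, f) = (v, e, f')" "f' \<noteq> f" "(v, e, f') \<in> flags P"
    using flag_adj[OF assms i(3)] by (cases "flag_adj P 2 (v, e, f)") (auto simp: differ_at_simps)
  ultimately show ?thesis by (rule that)
qed

section \<open>Connectivity of the flag graph\<close>

definition adj_closed :: "nat set \<Rightarrow> 'a flag set \<Rightarrow> bool" where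
  "adj_closed I S \<longleftrightarrow> (\<forall>\<Psi>\<in>S. \<forall>i\<in>I. flag_adj P i \<Psi> \<in> S)"

lemma same_or_adj:
  assumes "(v, e, f) \<in> flags P"
  shows "(v', e, f) \<in> flags P \<Longrightarrow> v' = v \<or> (v', e, f) = flag_adj P 0 (v, e, f)"
    "(v, e', f) \<in> flags P \<Longrightarrow> e' = e \<or> (v, e', f) = flag_adj P 1 (v, e, f)"
    "(v, e, f') \<in> flags P \<Longrightarrow> f' = f \<or> (v, e, f') = flag_adj P 2 (v, e, f)"
  by (auto simp: differ_at_simps intro!: flag_adj_eqI[OF assms, symmetric])

text \<open>A path through the neighbours of \<open>v\<close> alternates between edges and faces.
  Two consecutive members form a flag with \<open>v\<close>, and two flags sharing \<open>v\<close>
  and one path member are equal or adjacent, so a set closed under adjacency absorbs the whole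
  path.\<close>

lemma vertex_star_connected:
  assumes S: "adj_closed {1, 2} S" "(v, e, f) \<in> S" "(v, e, f) \<in> flags P"
    and fl: "(v, e', f') \<in> flags P"
  shows "(v, e', f') \<in> S"
proof -
  note d = flagD[OF S(3)] and d' = flagD[OF fl]
  let ?N = "incidence P `` {v}"
  have swap1: "(v, b, c) \<in> S" if "(v, a, c) \<in> S" "(v, a, c) \<in> flags P" "(v, b, c) \<in> flags P" for a b c
    using same_or_adj(2)[OF that(2,3)] S(1) that unfolding adj_closed_def by auto
  have swap2: "(v, a, b) \<in> S" if "(v, a, c) \<in> S" "(v, a, c) \<in> flags P" "(v, a, b) \<in> flags P" for a b c
    using same_or_adj(3)[OF that(2,3)] S(1) that unfolding adj_closed_def by auto
  have "(e, e') \<in> (incidence P \<inter> ?N \<times> ?N)\<^sup>*"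
    using polyhedron d d' by (auto simp: polyhedron_def connected_on_def)
  \<comment> \<open>A path member lies in several flags with \<open>v\<close>. The induction carries
    all of them, since the next step may leave through any one.\<close>
  then have "\<forall>a b. (v, a, b) \<in> flags P \<and> e' \<in> {a, b} \<longrightarrow> (v, a, b) \<in> S"
  proof (induction rule: rtrancl_induct)
    case base
    have "\<forall>a b. (v, a, b) \<in> flags P \<and> e \<in> {a, b} \<longrightarrow> a = e"
      using d(14) flagD(15) by fastforce
    then show ?case using swap2 S(2,3) by blast
  next
    case (step u w)
    have inc: "(u, w) \<in> incidence P" "(v, u) \<in> incidence P" "(v, w) \<in> incidence P"
      using step by auto
    have el: "u \<in> elts P" "w \<in> elts P" "rk P u \<noteq> 0" "rk P w \<noteq> 0" "rk P u \<noteq> rk P w"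
      using inc incidence_rank[of v u] incidence_rank[of v w] incidence_rank[of u w] d(13)
      by (auto simp: incidence_def)
    show ?case
    proof (cases "rk P u = 1")
      case True
      then have w: "w \<in> elts_of_rank P 2" using el rank_le[of u] rank_le[of w]
        by (auto simp: elts_of_rank_def)
      have fl1: "(v, u, w) \<in> flags P"
        using flagI[OF d(1) _ w inc(2,1)] True el by (simp add: elts_of_rank_def)
      then have "(v, u, w) \<in> S" using step.IH by simp
      have only: "\<forall>a b. (v, a, b) \<in> flags P \<and> w \<in> {a, b} \<longrightarrow> b = w"
        using w flagD(14) unfolding elts_of_rank_def by fastforce
      show ?thesis using only swap1 fl1 \<open>(v, u, w) \<in> S\<close> by blast
    next
      case False
      then have u: "u \<in> elts_of_rank P 2" "w \<in> elts_of_rank P 1"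
        using el rank_le[of u] rank_le[of w] by (auto simp: elts_of_rank_def)
      have fl1: "(v, w, u) \<in> flags P"
        using flagI[OF d(1) u(2,1) inc(3) incidence_sym[OF inc(1)]] .
      then have "(v, w, u) \<in> S" using step.IH by simp
      have only: "\<forall>a b. (v, a, b) \<in> flags P \<and> w \<in> {a, b} \<longrightarrow> a = w"
        using u flagD(15) unfolding elts_of_rank_def by fastforce
      show ?thesis using only swap2 fl1 \<open>(v, w, u) \<in> S\<close> by blast
    qed
  qed
  then show ?thesis using fl by simp
qed

lemma face_star_connected:
  assumes S: "adj_closed {0, 1} S" "(v, e, f) \<in> S" "(v, e, f) \<in> flags P"
    and fl: "(v', e', f) \<in> flags P"
  shows "(v', e', f) \<in> S"
proof -
  note d = flagD[OF S(3)] and d' = flagD[OF fl]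
  let ?N = "incidence P `` {f}"
  have swap1: "(c, b, f) \<in> S" if "(c, a, f) \<in> S" "(c, a, f) \<in> flags P" "(c, b, f) \<in> flags P" for a b c
    using same_or_adj(2)[OF that(2,3)] S(1) that unfolding adj_closed_def by auto
  have swap0: "(b, a, f) \<in> S" if "(c, a, f) \<in> S" "(c, a, f) \<in> flags P" "(b, a, f) \<in> flags P" for a b c
    using same_or_adj(1)[OF that(2,3)] S(1) that unfolding adj_closed_def by auto
  have "(e, e') \<in> (incidence P \<inter> ?N \<times> ?N)\<^sup>*"
    using polyhedron d d' incidence_sym[OF d(8)] incidence_sym[OF d'(8)]
    unfolding polyhedron_def connected_on_def by blast
  then have "\<forall>a b. (b, a, f) \<in> flags P \<and> e' \<in> {a, b} \<longrightarrow> (b, a, f) \<in> S"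
  proof (induction rule: rtrancl_induct)
    case base
    have "\<forall>a b. (b, a, f) \<in> flags P \<and> e \<in> {a, b} \<longrightarrow> a = e"
      using d(14) flagD(13) by fastforce
    then show ?case using swap0 S(2,3) by blast
  next
    case (step u w)
    have inc: "(u, w) \<in> incidence P" "(u, f) \<in> incidence P" "(w, f) \<in> incidence P"
      using step incidence_sym by auto
    have el: "u \<in> elts P" "w \<in> elts P" "rk P u \<noteq> 2" "rk P w \<noteq> 2" "rk P u \<noteq> rk P w"
      using inc incidence_rank[of u f] incidence_rank[of w f] incidence_rank[of u w] d(15)
      by (auto simp: incidence_def)
    show ?case
    proof (cases "rk P u = 1")
      case True
      then have w: "w \<in> elts_of_rank P 0" "u \<in> elts_of_rank P 1"
        using el rank_le[of u] rank_le[of w] by (auto simp: elts_of_rank_def)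
      have fl1: "(w, u, f) \<in> flags P"
        using flagI[OF w d(3) incidence_sym[OF inc(1)] inc(2)] .
      then have "(w, u, f) \<in> S" using step.IH by simp
      have only: "\<forall>a b. (b, a, f) \<in> flags P \<and> w \<in> {a, b} \<longrightarrow> b = w"
        using w flagD(14) unfolding elts_of_rank_def by fastforce
      show ?thesis using only swap1 fl1 \<open>(w, u, f) \<in> S\<close> by blast
    next
      case False
      then have u: "u \<in> elts_of_rank P 0" "w \<in> elts_of_rank P 1"
        using el rank_le[of u] rank_le[of w] by (auto simp: elts_of_rank_def)
      have fl1: "(u, w, f) \<in> flags P"
        using flagI[OF u d(3) inc(1,3)] .
      then have "(u, w, f) \<in> S" using step.IH by simp
      have only: "\<forall>a b. (b, a, f) \<in> flags P \<and> w \<in> {a, b} \<longrightarrow> a = w"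
        using u flagD(13) unfolding elts_of_rank_def by fastforce
      show ?thesis using only swap0 fl1 \<open>(u, w, f) \<in> S\<close> by blast
    qed
  qed
  then show ?thesis using fl by simp
qed

text \<open>The star of an edge has only four flags, so at most one 2-adjacency and one 0-adjacency
  lead from any flag to any other.\<close>

lemma edge_star_connected:
  assumes S: "adj_closed {0, 2} S" "(v, e, f) \<in> S" "(v, e, f) \<in> flags P"
    and fl: "(v', e, f') \<in> flags P"
  shows "(v', e, f') \<in> S"
proof -
  have m: "(v, e, f') \<in> flags P" using flagI flagD[OF S(3)] flagD[OF fl] by blast
  then have "(v, e, f') \<in> S"
    using same_or_adj(3)[OF S(3) m] S unfolding adj_closed_def by auto
  then show ?thesis
    using same_or_adj(1)[OF m fl] S(1) unfolding adj_closed_def by auto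
qed

text \<open>A path in the incidence graph is followed element by element; all flags through one
  element are reached inside its star.\<close>

lemma flags_connected:
  assumes S: "adj_closed {0, 1, 2} S" "\<Psi> \<in> S" "\<Psi> \<in> flags P"
  shows "flags P \<subseteq> S"
proof -
  obtain v e f where \<Psi>: "\<Psi> = (v, e, f)" by (cases \<Psi>)
  have cl: "adj_closed {1, 2} S" "adj_closed {0, 1} S" "adj_closed {0, 2} S"
    using S(1) by (auto simp: adj_closed_def)
  have star: "(v', e', f') \<in> S"
    if "(v', e', f') \<in> flags P" "w \<in> {v', e', f'}"
      "(v'', e'', f'') \<in> flags P" "w \<in> {v'', e'', f''}" "(v'', e'', f'') \<in> S" for v' e' f' v'' e'' f'' w
  proof -
    \<comment> \<open>The rank forces a common element into the same position of both flags.\<close>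
    have "w = v' \<and> w = v'' \<or> w = e' \<and> w = e'' \<or> w = f' \<and> w = f''"
      using flagD(13-15)[OF that(1)] flagD(13-15)[OF that(3)] that(2,4) by auto
    then show ?thesis
      using vertex_star_connected[OF cl(1)] face_star_connected[OF cl(2)] edge_star_connected[OF cl(3)]
        that by metis
  qed
  have fl: "(v, e, f) \<in> flags P" "(v, e, f) \<in> S" using S \<Psi> by auto
  have "\<forall>v' e' f'. (v', e', f') \<in> flags P \<and> w \<in> {v', e', f'} \<longrightarrow> (v', e', f') \<in> S"
    if "(v, w) \<in> (incidence P \<inter> elts P \<times> elts P)\<^sup>*" for w
    using that
  proof (induction rule: rtrancl_induct)
    case base
    then show ?case using star[of _ _ _ v] fl by blast
  next
    case (step u w)
    then obtain v1 e1 f1 where "(v1, e1, f1) \<in> flags P" "u \<in> {v1, e1, f1}" "w \<in> {v1, e1, f1}"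
      by (auto elim: incident_in_flag)
    then show ?case using step.IH star by blast
  qed
  moreover have "(v, w) \<in> (incidence P \<inter> elts P \<times> elts P)\<^sup>*" if "w \<in> elts P" for w
    using polyhedron that flagD[OF fl(1)] by (auto simp: polyhedron_def connected_on_def)
  ultimately have "\<And>v' e' f'. (v', e', f') \<in> flags P \<Longrightarrow> (v', e', f') \<in> S"
    using flagD(4) by blast
  then show ?thesis by auto
qed

section \<open>The action of automorphisms on flags\<close>

lemma aut_closed: "\<gamma> \<in> auts P \<Longrightarrow> a \<in> elts P \<Longrightarrow> \<gamma> a \<in> elts P"
  using Bij_imp_funcset by (fastforce simp: auts_def)

lemma aut_inj: "\<gamma> \<in> auts P \<Longrightarrow> a \<in> elts P \<Longrightarrow> b \<in> elts P \<Longrightarrow> \<gamma> a = \<gamma> b \<longleftrightarrow> a = b"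
  by (auto simp: auts_def Bij_def bij_betw_def inj_on_def)

lemma aut_leq:
  "\<gamma> \<in> auts P \<Longrightarrow> a \<in> elts P \<Longrightarrow> b \<in> elts P \<Longrightarrow> (\<gamma> a, \<gamma> b) \<in> leq_rel P \<longleftrightarrow> (a, b) \<in> leq_rel P"
  by (auto simp: auts_def)

text \<open>Automorphisms are only required to preserve the order; they preserve the rank because every
  element lies on a chain of length three.\<close>

lemma aut_flag:
  assumes "\<gamma> \<in> auts P" "\<Psi> \<in> flags P"
  shows "flag_map \<gamma> \<Psi> \<in> flags P"
proof -
  obtain v e f where \<Psi>: "\<Psi> = (v, e, f)" by (cases \<Psi>)
  then have fl: "(v, e, f) \<in> flags P" using assms by simp
  note d = flagD[OF fl]
  have el: "\<gamma> v \<in> elts P" "\<gamma> e \<in> elts P" "\<gamma> f \<in> elts P" using aut_closed assms d by auto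
  have le: "(\<gamma> v, \<gamma> e) \<in> leq_rel P" "(\<gamma> e, \<gamma> f) \<in> leq_rel P" using aut_leq assms d by auto
  have ne: "\<gamma> v \<noteq> \<gamma> e" "\<gamma> e \<noteq> \<gamma> f" using aut_inj assms d by auto
  have "rk P (\<gamma> v) < rk P (\<gamma> e)" "rk P (\<gamma> e) < rk P (\<gamma> f)" using leq_rank le ne by auto
  moreover have "rk P (\<gamma> f) \<le> 2" using el(3) by (rule rank_le)
  ultimately have "rk P (\<gamma> v) = 0" "rk P (\<gamma> e) = 1" "rk P (\<gamma> f) = 2" by auto
  then show ?thesis unfolding \<Psi> flag_map_simp
    using flagI el le incidence_iff_leq by (auto simp: elts_of_rank_def)
qed

lemma aut_adj:
  assumes "\<gamma> \<in> auts P" "\<Psi> \<in> flags P" "i \<in> {0, 1, 2}"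
  shows "flag_map \<gamma> (flag_adj P i \<Psi>) = flag_adj P i (flag_map \<gamma> \<Psi>)"
proof -
  obtain v e f v' e' f' where \<Psi>: "\<Psi> = (v, e, f)" "flag_adj P i \<Psi> = (v', e', f')"
    by (metis prod.exhaust)
  have fl: "(v, e, f) \<in> flags P" "(v', e', f') \<in> flags P"
    using assms flag_adj(1)[OF assms(2,3)] \<Psi> by auto
  have "differ_at i (v, e, f) (v', e', f')" using flag_adj(2)[OF assms(2,3)] \<Psi> by simp
  then have "differ_at i (flag_map \<gamma> (v, e, f)) (flag_map \<gamma> (v', e', f'))"
    using flagD[OF fl(1)] flagD[OF fl(2)] aut_inj[OF assms(1)]
    unfolding differ_at_def flag_map_simp by simp
  then have "flag_adj P i (flag_map \<gamma> \<Psi>) = flag_map \<gamma> (flag_adj P i \<Psi>)"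
    using flag_adj_eqI aut_flag assms fl \<Psi> by metis
  then show ?thesis by simp
qed

text \<open>Automorphisms act freely on flags: the flags on which both agree are closed under
  adjacency, hence are all flags, and every element lies in some flag.\<close>

lemma aut_eqI:
  assumes "\<gamma> \<in> auts P" "\<delta> \<in> auts P" "\<Psi> \<in> flags P" "flag_map \<gamma> \<Psi> = flag_map \<delta> \<Psi>"
  shows "\<gamma> = \<delta>"
proof -
  let ?S = "{\<Psi> \<in> flags P. flag_map \<gamma> \<Psi> = flag_map \<delta> \<Psi>}"
  have "adj_closed {0, 1, 2} ?S"
    unfolding adj_closed_def using aut_adj assms(1,2) flag_adj(1) by simp
  then have S: "flags P \<subseteq> ?S" using flags_connected assms by blast
  have "\<gamma> a = \<delta> a" if el: "a \<in> elts P" for a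
  proof -
    obtain v e f where "(v, e, f) \<in> flags P" "a \<in> {v, e, f}" using el elt_in_flag by blast
    then show ?thesis using S by (auto simp: flag_map_simp)
  qed
  moreover have "\<gamma> \<in> extensional (elts P)" "\<delta> \<in> extensional (elts P)"
    using assms by (auto simp: auts_def Bij_imp_extensional)
  ultimately show ?thesis by (rule extensionalityI[rotated 2])
qed

end

section \<open>Coset geometries\<close>

context group
begin

lemma inv_cancel_left:
  assumes "a \<in> carrier G" "b \<in> carrier G"
  shows "inv a \<otimes> (a \<otimes> b) = b" "a \<otimes> (inv a \<otimes> b) = b"
  using assms by (simp_all flip: m_assoc)

text \<open>The product case of \<open>generate.induct\<close> has two arbitrary members; here a
  single generator or its inverse is multiplied from the left.\<close>

lemma generate_left_induct [consumes 2, case_names one mult inv_mult]: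
  assumes "g \<in> generate G H" "H \<subseteq> carrier G"
    and one: "Q \<one>"
    and mult: "\<And>h g. h \<in> H \<Longrightarrow> g \<in> generate G H \<Longrightarrow> Q g \<Longrightarrow> Q (h \<otimes> g)"
    and inv_mult: "\<And>h g. h \<in> H \<Longrightarrow> g \<in> generate G H \<Longrightarrow> Q g \<Longrightarrow> Q (inv h \<otimes> g)"
  shows "Q g"
proof -
  \<comment> \<open>Claims about left multiplication compose in the product case;
    \<open>k = \<one>\<close> recovers \<open>Q g\<close>.\<close>
  have "\<forall>k \<in> generate G H. Q k \<longrightarrow> Q (g \<otimes> k)"
    using assms(1)
  proof (induction rule: generate.induct)
    case one
    then show ?case using generate_in_carrier[OF assms(2)] by simp
  next
    case (incl h)
    then show ?case using mult by simp
  next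
    case (inv h)
    then show ?case using inv_mult by simp
  next
    case (eng h1 h2)
    then show ?case
      using generate_in_carrier[OF assms(2)] generate.eng[of _ G H] by (simp add: m_assoc)
  qed
  then show ?thesis
    using one generate.one generate_in_carrier[OF assms(2,1)] by (metis r_one)
qed

end

text \<open>The algebra common to the rotation group, its quotients and the presented group.
  Finiteness is left to the individual lemmas, since the presented group is not known to be finite
  in advance.\<close>

locale rotation_pair = group G for G (structure) +
  fixes x y
  assumes x_closed [simp]: "x \<in> carrier G"
    and y_closed [simp]: "y \<in> carrier G"
    and generate_xy: "generate G {x, y} = carrier G"
    and xyxy: "x \<otimes> y \<otimes> (x \<otimes> y) = \<one>"
begin

text \<open>Conjugation by a reflection that takes the base flag to its 1-adjacent flag inverts both
  rotations, so such a map detects reflections. It is automatically bijective, being an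
  involution.\<close>

definition reflexible :: bool where
  "reflexible \<longleftrightarrow> (\<exists>\<theta>\<in>hom G G. \<theta> x = inv x \<and> \<theta> y = inv y)"

lemma carrier_induct [consumes 1, case_names one x y inv_x inv_y]:
  assumes "g \<in> carrier G" "Q \<one>"
    "\<And>g. g \<in> carrier G \<Longrightarrow> Q g \<Longrightarrow> Q (x \<otimes> g)" "\<And>g. g \<in> carrier G \<Longrightarrow> Q g \<Longrightarrow> Q (y \<otimes> g)"
    "\<And>g. g \<in> carrier G \<Longrightarrow> Q g \<Longrightarrow> Q (inv x \<otimes> g)"
    "\<And>g. g \<in> carrier G \<Longrightarrow> Q g \<Longrightarrow> Q (inv y \<otimes> g)"
  shows "Q g"
proof -
  have "g \<in> generate G {x, y}" "{x, y} \<subseteq> carrier G" using assms(1) by (simp_all add: generate_xy)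
  then show ?thesis
    by (induction rule: generate_left_induct) (use assms in \<open>auto simp: generate_xy\<close>)
qed

lemma y_x: "y \<otimes> x = inv x \<otimes> inv y"
proof -
  have "inv x \<otimes> (x \<otimes> y \<otimes> (x \<otimes> y)) \<otimes> inv y = y \<otimes> x"
    by (simp add: m_assoc inv_cancel_left)
  then show ?thesis by (simp add: xyxy)
qed

lemma y_x': "g \<in> carrier G \<Longrightarrow> y \<otimes> (x \<otimes> g) = inv x \<otimes> (inv y \<otimes> g)"
  using y_x by (simp flip: m_assoc)

lemma inv_y_inv_x: "inv y \<otimes> inv x = x \<otimes> y"
  using inv_equality[OF xyxy] by (simp add: inv_mult_group)

lemma inv_y_inv_x': "g \<in> carrier G \<Longrightarrow> inv y \<otimes> (inv x \<otimes> g) = x \<otimes> (y \<otimes> g)"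
  using inv_y_inv_x by (simp flip: m_assoc)

text \<open>Oriented so that rewriting eliminates the products \<open>y x\<close> and
  \<open>y^-1 x^-1\<close>.\<close>

lemmas rels = inv_mult_group m_assoc y_x y_x' inv_y_inv_x inv_y_inv_x' inv_cancel_left

lemma reflexible_involution:
  assumes "\<theta> \<in> hom G G" "\<theta> x = inv x" "\<theta> y = inv y" "g \<in> carrier G"
  shows "\<theta> (\<theta> g) = g"
proof -
  interpret \<theta>: group_hom G G \<theta> using assms by (simp add: group_hom_def group_hom_axioms_def)
  show ?thesis using assms(4) by (induction rule: carrier_induct) (simp_all add: assms(2,3))
qed

end

text \<open>Vertices, edges and faces stand for the right cosets \<open>Yg\<close>,
  \<open>{1, xy}g\<close> and \<open>Xg\<close>, but only the equality pattern of \<open>V\<close>,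
  \<open>E\<close>, \<open>F\<close> is prescribed. So \<open>V g\<close> may be the image of a base
  vertex under \<open>g\<close> as well as a number coding the coset.\<close>

locale coset_geometry = rotation_pair G x y for G (structure) and x y +
  fixes P :: "'c ranked_poset" and V E F :: "'a \<Rightarrow> 'c"
  assumes x_neq_one: "x \<noteq> \<one>" and y_neq_one: "y \<noteq> \<one>"
    and inter_trivial: "generate G {x} \<inter> generate G {y} = {\<one>}"
    and V_eq: "g \<in> carrier G \<Longrightarrow> h \<in> carrier G \<Longrightarrow> V g = V h \<longleftrightarrow> g \<otimes> inv h \<in> generate G {y}"
    and E_eq: "g \<in> carrier G \<Longrightarrow> h \<in> carrier G \<Longrightarrow> E g = E h \<longleftrightarrow> g = h \<or> g = x \<otimes> (y \<otimes> h)"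
    and F_eq: "g \<in> carrier G \<Longrightarrow> h \<in> carrier G \<Longrightarrow> F g = F h \<longleftrightarrow> g \<otimes> inv h \<in> generate G {x}"
    and elts_eq: "elts P = V ` carrier G \<union> E ` carrier G \<union> F ` carrier G"
    and rk_V: "g \<in> carrier G \<Longrightarrow> rk P (V g) = 0"
    and rk_E: "g \<in> carrier G \<Longrightarrow> rk P (E g) = 1"
    and rk_F: "g \<in> carrier G \<Longrightarrow> rk P (F g) = 2"
    and leq_eq: "leq_rel P = Id_on (elts P) \<union> (\<lambda>g. (V g, E g)) ` carrier G
      \<union> (\<lambda>g. (E g, F g)) ` carrier G \<union> (\<lambda>g. (V g, F g)) ` carrier G"
begin

lemma y_notin: "y \<notin> generate G {x}" and x_notin: "x \<notin> generate G {y}"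
  using inter_trivial x_neq_one y_neq_one generate.incl[of y "{y}" G] generate.incl[of x "{x}" G]
  by auto

lemma V_mult: "g \<in> carrier G \<Longrightarrow> V (y \<otimes> g) = V g" "g \<in> carrier G \<Longrightarrow> V (inv y \<otimes> g) = V g"
  using generate.incl[of y "{y}" G] generate.inv[of y "{y}" G] by (simp_all add: V_eq m_assoc)

lemma F_mult: "g \<in> carrier G \<Longrightarrow> F (x \<otimes> g) = F g" "g \<in> carrier G \<Longrightarrow> F (inv x \<otimes> g) = F g"
  using generate.incl[of x "{x}" G] generate.inv[of x "{x}" G] by (simp_all add: F_eq m_assoc)

lemma E_mult: "g \<in> carrier G \<Longrightarrow> E (x \<otimes> (y \<otimes> g)) = E g"
  "g \<in> carrier G \<Longrightarrow> E (inv y \<otimes> g) = E (x \<otimes> g)"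
  by (auto simp: E_eq rels)

lemma V_xy_neq: "g \<in> carrier G \<Longrightarrow> V (x \<otimes> (y \<otimes> g)) \<noteq> V g"
proof
  assume g: "g \<in> carrier G" "V (x \<otimes> (y \<otimes> g)) = V g"
  then have "x \<otimes> y \<in> generate G {y}" by (simp add: V_eq m_assoc)
  then have "x \<otimes> y \<otimes> inv y \<in> generate G {y}"
    using generate.eng[OF _ generate.inv[of y "{y}" G]] by simp
  then show False using x_notin by (simp add: m_assoc)
qed

lemma F_y_neq: "g \<in> carrier G \<Longrightarrow> F (y \<otimes> g) \<noteq> F g"
  using y_notin by (simp add: F_eq m_assoc)

lemma V_F_inj:
  assumes "g \<in> carrier G" "h \<in> carrier G" "V g = V h" "F g = F h"
  shows "g = h"
proof -
  have "g \<otimes> inv h \<in> generate G {x} \<inter> generate G {y}" using assms by (simp add: V_eq F_eq)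
  then have "g \<otimes> inv h = \<one>" using inter_trivial by blast
  then show ?thesis using assms by (metis inv_closed inv_equality inv_inv)
qed

lemma V_E_inj: "g \<in> carrier G \<Longrightarrow> h \<in> carrier G \<Longrightarrow> V g = V h \<Longrightarrow> E g = E h \<Longrightarrow> g = h"
  using E_eq V_xy_neq by force

lemma neqs: "g \<in> carrier G \<Longrightarrow> h \<in> carrier G \<Longrightarrow> V g \<noteq> E h"
  "g \<in> carrier G \<Longrightarrow> h \<in> carrier G \<Longrightarrow> E g \<noteq> F h" "g \<in> carrier G \<Longrightarrow> h \<in> carrier G \<Longrightarrow> V g \<noteq> F h"
  "g \<in> carrier G \<Longrightarrow> h \<in> carrier G \<Longrightarrow> E h \<noteq> V g"
  "g \<in> carrier G \<Longrightarrow> h \<in> carrier G \<Longrightarrow> F h \<noteq> E g" "g \<in> carrier G \<Longrightarrow> h \<in> carrier G \<Longrightarrow> F h \<noteq> V g"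
  using rk_V rk_E rk_F
  by (metis zero_neq_one one_neq_zero zero_neq_numeral numeral_One numeral_eq_iff semiring_norm(85))+

lemma in_elts: "g \<in> carrier G \<Longrightarrow> V g \<in> elts P" "g \<in> carrier G \<Longrightarrow> E g \<in> elts P"
  "g \<in> carrier G \<Longrightarrow> F g \<in> elts P"
  by (auto simp: elts_eq)

lemma elts_rank:
  "elts_of_rank P 0 = V ` carrier G" "elts_of_rank P (Suc 0) = E ` carrier G" "elts_of_rank P 2 = F ` carrier G"
  by (auto simp: elts_of_rank_def elts_eq rk_V rk_E rk_F)

lemma leq_self: "g \<in> carrier G \<Longrightarrow> (V g, E g) \<in> leq_rel P" "g \<in> carrier G \<Longrightarrow> (E g, F g) \<in> leq_rel P"
  "g \<in> carrier G \<Longrightarrow> (V g, F g) \<in> leq_rel P"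
  by (auto simp: leq_eq)

section \<open>Order and incidence of cosets\<close>

lemma leq_V_E:
  assumes "g \<in> carrier G" "h \<in> carrier G"
  shows "(V g, E h) \<in> leq_rel P \<longleftrightarrow> V g = V h \<or> V g = V (x \<otimes> (y \<otimes> h))"
proof
  assume "(V g, E h) \<in> leq_rel P"
  then obtain k where "k \<in> carrier G" "V g = V k" "E h = E k"
    using assms by (auto simp: leq_eq neqs)
  moreover from this have "k = h \<or> k = x \<otimes> (y \<otimes> h)" using assms E_eq by metis
  ultimately show "V g = V h \<or> V g = V (x \<otimes> (y \<otimes> h))" by auto
next
  assume "V g = V h \<or> V g = V (x \<otimes> (y \<otimes> h))"
  then show "(V g, E h) \<in> leq_rel P"
    using assms leq_self(1)[of h] leq_self(1)[of "x \<otimes> (y \<otimes> h)"] by (auto simp: E_mult)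
qed

lemma leq_E_F:
  assumes "g \<in> carrier G" "h \<in> carrier G"
  shows "(E h, F g) \<in> leq_rel P \<longleftrightarrow> F g = F h \<or> F g = F (y \<otimes> h)"
proof
  assume "(E h, F g) \<in> leq_rel P"
  then obtain k where "k \<in> carrier G" "F g = F k" "E h = E k"
    using assms by (auto simp: leq_eq neqs)
  moreover from this have "k = h \<or> k = x \<otimes> (y \<otimes> h)" using assms E_eq by metis
  ultimately show "F g = F h \<or> F g = F (y \<otimes> h)" using assms by (auto simp: F_mult)
next
  assume "F g = F h \<or> F g = F (y \<otimes> h)"
  then show "(E h, F g) \<in> leq_rel P"
    using assms leq_self(2)[of h] leq_self(2)[of "x \<otimes> (y \<otimes> h)"] by (auto simp: E_mult F_mult)
qed

lemma leq_V_F: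
  assumes "g \<in> carrier G" "h \<in> carrier G"
  shows "(V g, F h) \<in> leq_rel P \<longleftrightarrow> (\<exists>k\<in>carrier G. V g = V k \<and> F h = F k)"
  using assms by (auto simp: leq_eq neqs)

lemma leq_others:
  assumes "g \<in> carrier G" "h \<in> carrier G"
  shows "(V g, V h) \<in> leq_rel P \<longleftrightarrow> V g = V h" "(E g, E h) \<in> leq_rel P \<longleftrightarrow> E g = E h"
    "(F g, F h) \<in> leq_rel P \<longleftrightarrow> F g = F h"
    "(E g, V h) \<notin> leq_rel P" "(F g, V h) \<notin> leq_rel P" "(F g, E h) \<notin> leq_rel P"
  using assms by (auto simp: leq_eq neqs in_elts)

lemma incidence_simps:
  assumes "g \<in> carrier G" "h \<in> carrier G"
  shows "(V g, E h) \<in> incidence P \<longleftrightarrow> V g = V h \<or> V g = V (x \<otimes> (y \<otimes> h))"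
    "(E h, F g) \<in> incidence P \<longleftrightarrow> F g = F h \<or> F g = F (y \<otimes> h)"
    "(V g, F h) \<in> incidence P \<longleftrightarrow> (\<exists>k\<in>carrier G. V g = V k \<and> F h = F k)"
  using assms by (simp_all add: incidence_def in_elts neqs leq_others leq_V_E leq_E_F leq_V_F)

lemma incident_self: "g \<in> carrier G \<Longrightarrow> (V g, E g) \<in> incidence P"
  "g \<in> carrier G \<Longrightarrow> (E g, F g) \<in> incidence P" "g \<in> carrier G \<Longrightarrow> (V g, F g) \<in> incidence P"
  by (auto simp: incidence_simps)

text \<open>The edge of \<open>h\<close> is also the edge of \<open>x y h\<close>. Passing to this
  representative exchanges the two vertices and the two faces of the edge, so the vertex can be made
  to match while the condition on the face keeps its form.\<close>

lemma edge_chain_normal_form: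
  assumes "g \<in> carrier G" "h \<in> carrier G" "k \<in> carrier G"
    "V g = V h \<or> V g = V (x \<otimes> (y \<otimes> h))" "F k = F h \<or> F k = F (y \<otimes> h)"
  obtains b where "b \<in> carrier G" "V g = V b" "E h = E b" "F k = F b \<or> F k = F (y \<otimes> b)"
  using assms(4)
proof
  assume "V g = V h"
  then show ?thesis using that assms by blast
next
  assume v: "V g = V (x \<otimes> (y \<otimes> h))"
  have "F (y \<otimes> (x \<otimes> (y \<otimes> h))) = F h" using assms by (simp add: rels F_mult)
  moreover have "F (x \<otimes> (y \<otimes> h)) = F (y \<otimes> h)" using assms by (simp add: F_mult)
  ultimately show ?thesis
    using that[of "x \<otimes> (y \<otimes> h)"] v assms by (auto simp: E_mult)
qed

lemma leq_cases:
  assumes "(a, b) \<in> leq_rel P" "a \<noteq> b"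
  obtains g where "g \<in> carrier G" "a = V g" "b = E g" | g where "g \<in> carrier G" "a = E g" "b = F g"
  | g where "g \<in> carrier G" "a = V g" "b = F g"
  using assms by (auto simp: leq_eq)

text \<open>The core of transitivity: the second vertex of the edge of \<open>h\<close> is that of
  \<open>x^-1 h\<close>, which lies in the same face coset as \<open>h\<close>.\<close>

lemma chain_V_E_F:
  assumes "g \<in> carrier G" "h \<in> carrier G" "E g = E h"
  shows "(V g, F h) \<in> leq_rel P"
proof -
  have "(V g, E h) \<in> leq_rel P" using leq_self(1)[OF assms(1)] assms by simp
  then have "V g = V h \<or> V g = V (x \<otimes> (y \<otimes> h))" using leq_V_E assms by blast
  moreover have "V (x \<otimes> (y \<otimes> h)) = V (inv x \<otimes> h)"
    using V_mult(2)[of "inv x \<otimes> h"] assms by (simp add: rels)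
  moreover have "F (inv x \<otimes> h) = F h" using assms by (simp add: F_mult)
  ultimately show ?thesis
    using leq_self(3)[of h] leq_self(3)[of "inv x \<otimes> h"] assms by auto
qed

lemma partial_order: "partial_order_on (elts P) (leq_rel P)"
proof -
  have "trans (leq_rel P)"
  proof (rule transI)
    fix a b c assume ab: "(a, b) \<in> leq_rel P" and bc: "(b, c) \<in> leq_rel P"
    show "(a, c) \<in> leq_rel P"
    proof (cases "a = b \<or> b = c")
      case False
      then have "a \<noteq> b" "b \<noteq> c" by auto
      from ab this(1) bc this(2) obtain g h where
        "g \<in> carrier G" "h \<in> carrier G" "a = V g" "b = E g" "b = E h" "c = F h"
        by (elim leq_cases) (auto simp: neqs)
      then show ?thesis using chain_V_E_F by simp
    qed (use ab bc in auto)
  qed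
  moreover have "antisym (leq_rel P)"
    by (auto simp: antisym_def leq_eq neqs)
  moreover have "leq_rel P \<subseteq> elts P \<times> elts P" "refl_on (elts P) (leq_rel P)"
    by (auto simp: leq_eq in_elts refl_on_def)
  ultimately show ?thesis by (simp add: partial_order_on_def preorder_on_def)
qed

end

section \<open>The polyhedron axioms for coset geometries\<close>

lemma connected_onI:
  assumes "\<And>a b. (a, b) \<in> R \<Longrightarrow> (b, a) \<in> R" "\<And>a. a \<in> S \<Longrightarrow> (c, a) \<in> (R \<inter> S \<times> S)\<^sup>*"
  shows "connected_on R S"
proof -
  have "sym ((R \<inter> S \<times> S)\<^sup>*)" using assms(1) by (intro sym_rtrancl symI) blast
  then have "(a, c) \<in> (R \<inter> S \<times> S)\<^sup>*" if "a \<in> S" for a using assms(2)[OF that] by (rule symD)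
  then show ?thesis unfolding connected_on_def using assms(2) by (blast intro: rtrancl_trans)
qed

context coset_geometry
begin

lemma F_E_inj: "g \<in> carrier G \<Longrightarrow> h \<in> carrier G \<Longrightarrow> F g = F h \<Longrightarrow> E g = E h \<Longrightarrow> g = h"
  using E_eq F_y_neq F_mult by force

lemma generate_carrier: "u \<in> generate G {x} \<Longrightarrow> u \<in> carrier G" "u \<in> generate G {y} \<Longrightarrow> u \<in> carrier G"
  using generate_in_carrier[of "{x}" u] generate_in_carrier[of "{y}" u] by simp_all

lemma F_generate: "u \<in> generate G {x} \<Longrightarrow> g \<in> carrier G \<Longrightarrow> F (u \<otimes> g) = F g"
  using generate_carrier(1)[of u] by (simp add: F_eq m_assoc)

lemma V_generate: "u \<in> generate G {y} \<Longrightarrow> g \<in> carrier G \<Longrightarrow> V (u \<otimes> g) = V g"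
  using generate_carrier(2)[of u] by (simp add: V_eq m_assoc)

lemma card_edge_vertices:
  assumes "h \<in> carrier G"
  shows "card {v \<in> elts_of_rank P 0. (v, E h) \<in> incidence P} = 2"
proof -
  have "{v \<in> elts_of_rank P 0. (v, E h) \<in> incidence P} = {V h, V (x \<otimes> (y \<otimes> h))}"
    using assms by (auto simp: elts_rank incidence_simps)
  then show ?thesis using V_xy_neq[OF assms] by simp
qed

lemma card_edge_faces:
  assumes "h \<in> carrier G"
  shows "card {f \<in> elts_of_rank P 2. (E h, f) \<in> incidence P} = 2"
proof -
  have "{f \<in> elts_of_rank P 2. (E h, f) \<in> incidence P} = {F h, F (y \<otimes> h)}"
    using assms by (auto simp: elts_rank incidence_simps)
  then show ?thesis using F_y_neq[OF assms] by simp
qed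

text \<open>By \<open>V_F_inj\<close>, an edge \<open>E b\<close> at the vertex
  \<open>V b = V k\<close> lies in the face of \<open>k\<close> only if \<open>b = k\<close> or
  \<open>y b = k\<close>.\<close>

lemma card_vertex_face_edges:
  assumes "k \<in> carrier G"
  shows "card {e \<in> elts_of_rank P 1. (V k, e) \<in> incidence P \<and> (e, F k) \<in> incidence P} = 2"
proof -
  have "e \<in> {E k, E (inv y \<otimes> k)}"
    if e: "e \<in> elts_of_rank P 1" "(V k, e) \<in> incidence P" "(e, F k) \<in> incidence P" for e
  proof -
    obtain h where h: "h \<in> carrier G" "e = E h" using e by (auto simp: elts_rank)
    then obtain b where b: "b \<in> carrier G" "V k = V b" "E h = E b" "F k = F b \<or> F k = F (y \<otimes> b)"
      using e assms by (auto simp: incidence_simps intro: edge_chain_normal_form[of k h k])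
    have "k = b \<or> k = y \<otimes> b"
      using b assms V_F_inj[of k b] V_F_inj[of k "y \<otimes> b"] by (auto simp: V_mult)
    then show ?thesis using b h by (auto simp: inv_cancel_left)
  qed
  moreover have "(V k, E (inv y \<otimes> k)) \<in> incidence P" "(E (inv y \<otimes> k), F k) \<in> incidence P"
    using assms by (simp_all add: incidence_simps V_mult inv_cancel_left)
  ultimately have "{e \<in> elts_of_rank P 1. (V k, e) \<in> incidence P \<and> (e, F k) \<in> incidence P}
      = {E k, E (inv y \<otimes> k)}"
    using assms incident_self by (auto simp: elts_rank)
  moreover have "E k \<noteq> E (inv y \<otimes> k)"
  proof
    assume "E k = E (inv y \<otimes> k)"
    then have "k = inv y \<otimes> k" using V_E_inj[of k "inv y \<otimes> k"] assms by (simp add: V_mult)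
    then show False using assms y_neq_one
      by (metis inv_closed inv_inv inv_one r_cancel_one y_closed)
  qed
  ultimately show ?thesis by simp
qed

lemma vertex_neighbour:
  assumes "g \<in> carrier G" "(V g, a) \<in> incidence P"
  obtains k where "k \<in> carrier G" "V k = V g" "a = E k \<or> a = F k"
proof -
  have "a \<in> elts P" using assms by (auto simp: incidence_def)
  then consider h where "h \<in> carrier G" "a = V h" | h where "h \<in> carrier G" "a = E h"
    | h where "h \<in> carrier G" "a = F h"
    by (auto simp: elts_eq)
  then show ?thesis
  proof cases
    case 1
    then show ?thesis using assms by (auto simp: incidence_def leq_others)
  next
    case 2
    then show ?thesis
      using assms that[of h] that[of "x \<otimes> (y \<otimes> h)"] by (auto simp: incidence_simps E_mult)
  next
    case 3
    then show ?thesis using assms that by (auto simp: incidence_simps)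
  qed
qed

lemma face_neighbour:
  assumes "g \<in> carrier G" "(F g, a) \<in> incidence P"
  obtains k where "k \<in> carrier G" "F k = F g" "a = E k \<or> a = V k"
proof -
  have inc: "(a, F g) \<in> incidence P" using incidence_sym[OF assms(2)] .
  have "a \<in> elts P" using assms by (auto simp: incidence_def)
  then consider h where "h \<in> carrier G" "a = V h" | h where "h \<in> carrier G" "a = E h"
    | h where "h \<in> carrier G" "a = F h"
    by (auto simp: elts_eq)
  then show ?thesis
  proof cases
    case 1
    then show ?thesis using assms(1) inc that by (auto simp: incidence_simps)
  next
    case 2
    then show ?thesis
      using assms(1) inc that[of h] that[of "x \<otimes> (y \<otimes> h)"]
      by (auto simp: incidence_simps E_mult F_mult)
  next
    case 3
    then show ?thesis using assms by (auto simp: incidence_def leq_others)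
  qed
qed

text \<open>Multiplication by \<open>y\<close> fixes the vertex and multiplication by
  \<open>x\<close> fixes the face, so \<open>V g\<close> and \<open>V (x g)\<close> are joined
  through their common face.\<close>

lemma connected: "connected_on (incidence P) (elts P)"
proof (rule connected_onI[OF incidence_sym])
  let ?R = "(incidence P \<inter> elts P \<times> elts P)\<^sup>*"
  have step: "(a, b) \<in> ?R" if "(a, b) \<in> incidence P" for a b
    using that by (auto simp: incidence_def)
  note step' = step[OF incidence_sym]
  have V: "(V \<one>, V g) \<in> ?R" if "g \<in> carrier G" for g
    using that
  proof (induction rule: carrier_induct)
    case (x g)
    have "(V g, F g) \<in> ?R" "(F (x \<otimes> g), V (x \<otimes> g)) \<in> ?R"
      using incident_self(3) x step step' by auto
    then show ?case using x by (auto simp: F_mult intro: rtrancl_trans)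
  next
    case (inv_x g)
    have "(V g, F g) \<in> ?R" "(F (inv x \<otimes> g), V (inv x \<otimes> g)) \<in> ?R"
      using incident_self(3) inv_x step step' by auto
    then show ?case using inv_x by (auto simp: F_mult intro: rtrancl_trans)
  qed (simp_all add: V_mult)
  fix a assume "a \<in> elts P"
  then obtain g where "g \<in> carrier G" "a \<in> {V g, E g, F g}" by (auto simp: elts_eq)
  then show "(V \<one>, a) \<in> ?R" using V[of g] step incident_self[of g] by (auto intro: rtrancl_trans)
qed

text \<open>Going round a vertex: \<open>E k\<close> and \<open>E (y k)\<close> share the face
  \<open>F (y k)\<close>.\<close>

lemma vertex_connected:
  assumes g: "g \<in> carrier G"
  shows "connected_on (incidence P) (incidence P `` {V g})"
proof (rule connected_onI[OF incidence_sym])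
  let ?N = "incidence P `` {V g}"
  let ?R = "(incidence P \<inter> ?N \<times> ?N)\<^sup>*"
  have inN: "E k \<in> ?N" "F k \<in> ?N" if "k \<in> carrier G" "V k = V g" for k
    using incident_self[of k] that by auto
  have nbr: "(E k, F k) \<in> ?R" "(F k, E k) \<in> ?R" "(E k, F (y \<otimes> k)) \<in> ?R" "(F (y \<otimes> k), E k) \<in> ?R"
    if "k \<in> carrier G" "V k = V g" for k
  proof -
    have "(E k, F k) \<in> incidence P" "(E k, F (y \<otimes> k)) \<in> incidence P"
      using that by (auto simp: incidence_simps)
    then show "(E k, F k) \<in> ?R" "(F k, E k) \<in> ?R" "(E k, F (y \<otimes> k)) \<in> ?R" "(F (y \<otimes> k), E k) \<in> ?R"
      using incidence_sym inN[of k] inN[of "y \<otimes> k"] that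
      by (auto simp: V_mult intro!: r_into_rtrancl)
  qed
  have step: "(E k, E (y \<otimes> k)) \<in> ?R" "(E (y \<otimes> k), E k) \<in> ?R" if "k \<in> carrier G" "V k = V g" for k
    using nbr[of k] nbr[of "y \<otimes> k"] that by (auto simp: V_mult intro: rtrancl_trans)
  have E: "(E g, E (u \<otimes> g)) \<in> ?R" if u: "u \<in> generate G {y}" for u
  proof -
    have "{y} \<subseteq> carrier G" by simp
    with u show ?thesis
    proof (induction rule: generate_left_induct)
      case (mult h u)
      have "u \<otimes> g \<in> carrier G" using mult generate_in_carrier[of "{y}" u] g by simp
      then have "(E (u \<otimes> g), E (y \<otimes> (u \<otimes> g))) \<in> ?R" using step(1)[of "u \<otimes> g"] mult V_generate g
        by simp
      then show ?case
        using mult g generate_in_carrier[of "{y}" u] by (auto simp: m_assoc intro: rtrancl_trans)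
    next
      case (inv_mult h u)
      have u: "u \<in> carrier G" using inv_mult generate_in_carrier[of "{y}" u] g by simp
      then have "(E (u \<otimes> g), E (inv y \<otimes> (u \<otimes> g))) \<in> ?R"
        using step(2)[of "inv y \<otimes> (u \<otimes> g)"] inv_mult V_generate g g
        by (simp add: V_mult inv_cancel_left)
      then show ?case
        using inv_mult g u by (auto simp: m_assoc intro: rtrancl_trans)
    qed (use g in simp_all)
  qed
  fix a assume "a \<in> ?N"
  then obtain k where k: "k \<in> carrier G" "V k = V g" "a = E k \<or> a = F k"
    using vertex_neighbour g by blast
  then have "k \<otimes> inv g \<in> generate G {y}" using V_eq g by simp
  then have "(E g, E k) \<in> ?R" using E[of "k \<otimes> inv g"] k g by (simp add: m_assoc)
  then show "(E g, a) \<in> ?R" using k nbr[of k] by (auto intro: rtrancl_trans)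
qed

text \<open>Going round a face: \<open>E k\<close> and \<open>E (x k)\<close> share the vertex
  \<open>V k\<close>, since \<open>x y x = y^-1\<close>.\<close>

lemma face_connected:
  assumes g: "g \<in> carrier G"
  shows "connected_on (incidence P) (incidence P `` {F g})"
proof (rule connected_onI[OF incidence_sym])
  let ?N = "incidence P `` {F g}"
  let ?R = "(incidence P \<inter> ?N \<times> ?N)\<^sup>*"
  have inN: "E k \<in> ?N" "V k \<in> ?N" if "k \<in> carrier G" "F k = F g" for k
    using incident_self[of k] that incidence_sym by (metis Image_singleton_iff)+
  have nbr: "(E k, V k) \<in> ?R" "(V k, E k) \<in> ?R" "(E (x \<otimes> k), V k) \<in> ?R" "(V k, E (x \<otimes> k)) \<in> ?R"
    if "k \<in> carrier G" "F k = F g" for k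
  proof -
    have "(V k, E k) \<in> incidence P" "(V k, E (x \<otimes> k)) \<in> incidence P"
      using that by (auto simp: incidence_simps rels V_mult)
    then show "(E k, V k) \<in> ?R" "(V k, E k) \<in> ?R" "(E (x \<otimes> k), V k) \<in> ?R" "(V k, E (x \<otimes> k)) \<in> ?R"
      using incidence_sym inN[of k] inN[of "x \<otimes> k"] that
      by (auto simp: F_mult intro!: r_into_rtrancl)
  qed
  have step: "(E k, E (x \<otimes> k)) \<in> ?R" "(E (x \<otimes> k), E k) \<in> ?R" if "k \<in> carrier G" "F k = F g" for k
    using nbr[of k] that by (auto intro: rtrancl_trans)
  have E: "(E g, E (u \<otimes> g)) \<in> ?R" if u: "u \<in> generate G {x}" for u
  proof -
    have "{x} \<subseteq> carrier G" by simp
    with u show ?thesis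
    proof (induction rule: generate_left_induct)
      case (mult h u)
      have "u \<otimes> g \<in> carrier G" using mult generate_in_carrier[of "{x}" u] g by simp
      then have "(E (u \<otimes> g), E (x \<otimes> (u \<otimes> g))) \<in> ?R" using step(1)[of "u \<otimes> g"] mult F_generate g
        by simp
      then show ?case
        using mult g generate_in_carrier[of "{x}" u] by (auto simp: m_assoc intro: rtrancl_trans)
    next
      case (inv_mult h u)
      have u: "u \<in> carrier G" using inv_mult generate_in_carrier[of "{x}" u] g by simp
      then have "(E (u \<otimes> g), E (inv x \<otimes> (u \<otimes> g))) \<in> ?R"
        using step(2)[of "inv x \<otimes> (u \<otimes> g)"] inv_mult F_generate g g
        by (simp add: F_mult inv_cancel_left)
      then show ?case
        using inv_mult g u by (auto simp: m_assoc intro: rtrancl_trans)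
    qed (use g in simp_all)
  qed
  fix a assume "a \<in> ?N"
  then obtain k where k: "k \<in> carrier G" "F k = F g" "a = E k \<or> a = V k"
    using face_neighbour g by blast
  then have "k \<otimes> inv g \<in> generate G {x}" using F_eq g by simp
  then have "(E g, E k) \<in> ?R" using E[of "k \<otimes> inv g"] k g by (simp add: m_assoc)
  then show "(E g, a) \<in> ?R" using k nbr[of k] by (auto intro: rtrancl_trans)
qed

lemma is_polyhedron: "polyhedron P"
  unfolding polyhedron_def
proof (intro conjI ballI impI)
  show "partial_order_on (elts P) (leq_rel P)" by (rule partial_order)
  show "rk P ` elts P \<subseteq> {0, 1, 2}" by (auto simp: elts_eq rk_V rk_E rk_F)
  show "connected_on (incidence P) (elts P)" by (rule connected)
  show "case z of (a, b) \<Rightarrow> a \<noteq> b \<longrightarrow> rk P a < rk P b" if "z \<in> leq_rel P" for z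
    using that by (auto simp: leq_eq rk_V rk_E rk_F)
  show "card {v \<in> elts_of_rank P 0. (v, e) \<in> incidence P} = 2"
    "card {f \<in> elts_of_rank P 2. (e, f) \<in> incidence P} = 2" if "e \<in> elts_of_rank P 1" for e
    using that card_edge_vertices card_edge_faces by (auto simp: elts_rank)
  show "card {e \<in> elts_of_rank P 1. (v, e) \<in> incidence P \<and> (e, f) \<in> incidence P} = 2"
    if vf: "v \<in> elts_of_rank P 0" "f \<in> elts_of_rank P 2" "(v, f) \<in> incidence P" for v f
  proof -
    obtain k where "k \<in> carrier G" "v = V k" "f = F k"
      using vf by (auto simp: elts_rank incidence_simps)
    then show ?thesis using card_vertex_face_edges by simp
  qed
  show "connected_on (incidence P) (incidence P `` {a})"
    if "a \<in> elts_of_rank P 0 \<union> elts_of_rank P 2" for a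
    using that vertex_connected face_connected by (auto simp: elts_rank)
qed

section \<open>Flags of a coset geometry: counting and adjacency\<close>

definition even_flag :: "'a \<Rightarrow> 'c flag" where "even_flag g = (V g, E g, F g)"
definition odd_flag :: "'a \<Rightarrow> 'c flag" where "odd_flag g = (V g, E g, F (y \<otimes> g))"

text \<open>\<open>odd_flag g\<close> is the 2-adjacent flag of \<open>even_flag g\<close>. The two
  families are the two orbits of G under right multiplication, and the action on each is
  free.\<close>

lemma flags_eq: "flags P = even_flag ` carrier G \<union> odd_flag ` carrier G"
proof
  show "even_flag ` carrier G \<union> odd_flag ` carrier G \<subseteq> flags P"
  proof -
    have "(V g, F (y \<otimes> g)) \<in> incidence P" if "g \<in> carrier G" for g
      using incident_self(3)[of "y \<otimes> g"] that by (simp add: V_mult)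
    then show ?thesis
      using incident_self
      by (auto simp: even_flag_def odd_flag_def flags_def elts_rank incidence_simps(2))
  qed
  show "flags P \<subseteq> even_flag ` carrier G \<union> odd_flag ` carrier G"
  proof
    fix \<Psi> assume "\<Psi> \<in> flags P"
    then obtain g h k where \<Psi>: "\<Psi> = (V g, E h, F k)" "g \<in> carrier G" "h \<in> carrier G" "k \<in> carrier G"
      "(V g, E h) \<in> incidence P" "(E h, F k) \<in> incidence P"
      by (auto simp: flags_def elts_rank)
    then obtain b where "b \<in> carrier G" "V g = V b" "E h = E b" "F k = F b \<or> F k = F (y \<otimes> b)"
      by (auto simp: incidence_simps intro: edge_chain_normal_form[of g h k])
    then show "\<Psi> \<in> even_flag ` carrier G \<union> odd_flag ` carrier G"
      unfolding \<Psi>(1) even_flag_def odd_flag_def by auto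
  qed
qed

lemma even_flag_inj: "inj_on even_flag (carrier G)" and odd_flag_inj: "inj_on odd_flag (carrier G)"
  using V_E_inj by (auto simp: inj_on_def even_flag_def odd_flag_def)

lemma even_odd_disjoint: "even_flag ` carrier G \<inter> odd_flag ` carrier G = {}"
proof -
  have "even_flag g \<noteq> odd_flag h" if "g \<in> carrier G" "h \<in> carrier G" for g h
    using V_E_inj[of g h] F_y_neq[of h] that by (auto simp: even_flag_def odd_flag_def)
  then show ?thesis by blast
qed

lemma face_edges:
  assumes "g \<in> carrier G"
  shows "{e \<in> elts_of_rank P 1. (e, F g) \<in> incidence P} = (\<lambda>u. E (u \<otimes> g)) ` generate G {x}"
proof
  show "(\<lambda>u. E (u \<otimes> g)) ` generate G {x} \<subseteq> {e \<in> elts_of_rank P 1. (e, F g) \<in> incidence P}"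
  proof (rule image_subsetI)
    fix u assume u: "u \<in> generate G {x}"
    then have "u \<otimes> g \<in> carrier G" using assms generate_carrier(1) by simp
    then show "E (u \<otimes> g) \<in> {e \<in> elts_of_rank P 1. (e, F g) \<in> incidence P}"
      using incident_self(2)[of "u \<otimes> g"] F_generate[OF u assms] by (simp add: elts_rank)
  qed
  show "{e \<in> elts_of_rank P 1. (e, F g) \<in> incidence P} \<subseteq> (\<lambda>u. E (u \<otimes> g)) ` generate G {x}"
  proof
    fix e assume e: "e \<in> {e \<in> elts_of_rank P 1. (e, F g) \<in> incidence P}"
    then have "(F g, e) \<in> incidence P" "e \<in> E ` carrier G"
      by (auto simp: elts_rank intro: incidence_sym)
    then obtain k where k: "k \<in> carrier G" "F k = F g" "e = E k"
      using face_neighbour[OF assms] neqs(1) by (metis imageE)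
    then show "e \<in> (\<lambda>u. E (u \<otimes> g)) ` generate G {x}"
      using assms by (intro image_eqI[of _ _ "k \<otimes> inv g"]) (simp_all add: F_eq m_assoc)
  qed
qed

lemma vertex_edges:
  assumes "g \<in> carrier G"
  shows "{e \<in> elts_of_rank P 1. (V g, e) \<in> incidence P} = (\<lambda>u. E (u \<otimes> g)) ` generate G {y}"
proof
  show "(\<lambda>u. E (u \<otimes> g)) ` generate G {y} \<subseteq> {e \<in> elts_of_rank P 1. (V g, e) \<in> incidence P}"
  proof (rule image_subsetI)
    fix u assume u: "u \<in> generate G {y}"
    then have "u \<otimes> g \<in> carrier G" using assms generate_carrier(2) by simp
    then show "E (u \<otimes> g) \<in> {e \<in> elts_of_rank P 1. (V g, e) \<in> incidence P}"
      using incident_self(1)[of "u \<otimes> g"] V_generate[OF u assms] by (simp add: elts_rank)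
  qed
  show "{e \<in> elts_of_rank P 1. (V g, e) \<in> incidence P} \<subseteq> (\<lambda>u. E (u \<otimes> g)) ` generate G {y}"
  proof
    fix e assume e: "e \<in> {e \<in> elts_of_rank P 1. (V g, e) \<in> incidence P}"
    then have "(V g, e) \<in> incidence P" "e \<in> E ` carrier G" by (auto simp: elts_rank)
    then obtain k where k: "k \<in> carrier G" "V k = V g" "e = E k"
      using vertex_neighbour[OF assms] neqs(2) by (metis imageE)
    then show "e \<in> (\<lambda>u. E (u \<otimes> g)) ` generate G {y}"
      using assms by (intro image_eqI[of _ _ "k \<otimes> inv g"]) (simp_all add: V_eq m_assoc)
  qed
qed

lemma card_face_edges:
  assumes "g \<in> carrier G"
  shows "card {e \<in> elts_of_rank P 1. (e, F g) \<in> incidence P} = ord x"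
proof -
  have "inj_on (\<lambda>u. E (u \<otimes> g)) (generate G {x})"
  proof (rule inj_onI)
    fix u w assume u: "u \<in> generate G {x}" "w \<in> generate G {x}" "E (u \<otimes> g) = E (w \<otimes> g)"
    have "F (u \<otimes> g) = F (w \<otimes> g)" using u assms by (simp add: F_generate)
    then show "u = w"
      using F_E_inj[of "u \<otimes> g" "w \<otimes> g"] u generate_carrier(1)[of u] generate_carrier(1)[of w] assms
      by simp
  qed
  then show ?thesis unfolding face_edges[OF assms] by (simp add: card_image generate_pow_card)
qed

lemma card_vertex_edges:
  assumes "g \<in> carrier G"
  shows "card {e \<in> elts_of_rank P 1. (V g, e) \<in> incidence P} = ord y"
proof -
  have "inj_on (\<lambda>u. E (u \<otimes> g)) (generate G {y})"
  proof (rule inj_onI)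
    fix u w assume u: "u \<in> generate G {y}" "w \<in> generate G {y}" "E (u \<otimes> g) = E (w \<otimes> g)"
    have "V (u \<otimes> g) = V (w \<otimes> g)" using u assms by (simp add: V_generate)
    then show "u = w"
      using V_E_inj[of "u \<otimes> g" "w \<otimes> g"] u generate_carrier(2)[of u] generate_carrier(2)[of w] assms
      by simp
  qed
  then show ?thesis unfolding vertex_edges[OF assms] by (simp add: card_image generate_pow_card)
qed

lemma card_flags: "finite (carrier G) \<Longrightarrow> card (flags P) = 2 * card (carrier G)"
  unfolding flags_eq using even_odd_disjoint
  by (simp add: card_Un_disjoint card_image[OF even_flag_inj] card_image[OF odd_flag_inj])

lemma is_tight:
  assumes fin: "finite (carrier G)" and "card (carrier G) = ord x * ord y"
  shows "tight_polyhedron P (ord x) (ord y)"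
proof -
  have "finite (generate G {x})" "finite (generate G {y})"
    using fin generate_carrier by (auto intro: finite_subset)
  then have "finite {e \<in> elts_of_rank P 1. (e, F g) \<in> incidence P}"
    "finite {e \<in> elts_of_rank P 1. (V g, e) \<in> incidence P}" if "g \<in> carrier G" for g
    unfolding face_edges[OF that] vertex_edges[OF that] by simp_all
  then have "has_type P (ord x) (ord y)"
    unfolding has_type_def elts_rank(1,3) using card_face_edges card_vertex_edges by blast
  moreover have "finite (flags P)" unfolding flags_eq using fin by simp
  ultimately show ?thesis using card_flags[OF fin] assms(2) by (simp add: tight_polyhedron_def)
qed

sublocale geom: flagged_polyhedron P "even_flag \<one>"
  by unfold_locales (auto simp: is_polyhedron flags_eq)

lemma flag_in: "g \<in> carrier G \<Longrightarrow> even_flag g \<in> flags P" "g \<in> carrier G \<Longrightarrow> odd_flag g \<in> flags P"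
  by (auto simp: flags_eq)

lemma adj_odd:
  assumes g: "g \<in> carrier G"
  shows "flag_adj P 0 (odd_flag g) = even_flag (x \<otimes> (y \<otimes> g))"
    "flag_adj P 1 (odd_flag g) = even_flag (y \<otimes> g)"
    "flag_adj P 2 (odd_flag g) = even_flag g"
proof -
  have ne: "E (y \<otimes> g) \<noteq> E g" using V_E_inj[of "y \<otimes> g" g] F_y_neq[of g] g by (auto simp: V_mult)
  have "differ_at 0 (odd_flag g) (even_flag (x \<otimes> (y \<otimes> g)))"
    "differ_at 1 (odd_flag g) (even_flag (y \<otimes> g))" "differ_at 2 (odd_flag g) (even_flag g)"
    using g V_xy_neq[of g] F_y_neq[of g] ne
    by (auto simp: even_flag_def odd_flag_def differ_at_simps E_mult F_mult V_mult)
  then show "flag_adj P 0 (odd_flag g) = even_flag (x \<otimes> (y \<otimes> g))"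
    "flag_adj P 1 (odd_flag g) = even_flag (y \<otimes> g)"
    "flag_adj P 2 (odd_flag g) = even_flag g"
    using g flag_in by (auto intro!: geom.flag_adj_eqI)
qed

lemma adj_even:
  assumes g: "g \<in> carrier G"
  shows "flag_adj P 0 (even_flag g) = odd_flag (x \<otimes> (y \<otimes> g))"
    "flag_adj P 1 (even_flag g) = odd_flag (inv y \<otimes> g)"
    "flag_adj P 2 (even_flag g) = odd_flag g"
proof -
  have "x \<otimes> (y \<otimes> (x \<otimes> (y \<otimes> g))) = g" using g by (simp add: rels)
  then show "flag_adj P 0 (even_flag g) = odd_flag (x \<otimes> (y \<otimes> g))"
    using adj_odd(1)[of "x \<otimes> (y \<otimes> g)"] geom.flag_adj_invol[of "odd_flag (x \<otimes> (y \<otimes> g))" 0] g flag_in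
    by simp
  show "flag_adj P 1 (even_flag g) = odd_flag (inv y \<otimes> g)"
    using adj_odd(2)[of "inv y \<otimes> g"] geom.flag_adj_invol[of "odd_flag (inv y \<otimes> g)" 1] g flag_in
    by (simp add: inv_cancel_left)
  show "flag_adj P 2 (even_flag g) = odd_flag g"
    using adj_odd(3)[of g] geom.flag_adj_invol[of "odd_flag g" 2] g flag_in by simp
qed

lemmas adj_simps = adj_even[unfolded One_nat_def] adj_odd[unfolded One_nat_def]

text \<open>Each rank has its own map of representatives, because a reflection needs another formula
  on edges than on vertices and faces. \<open>compatible\<close> makes the result independent of the
  chosen representatives and order preserving.\<close>

definition induced :: "('a \<Rightarrow> 'a) \<Rightarrow> ('a \<Rightarrow> 'a) \<Rightarrow> ('a \<Rightarrow> 'a) \<Rightarrow> 'c \<Rightarrow> 'c" where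
  "induced \<alpha> \<beta> \<delta> = (\<lambda>a\<in>elts P.
    if rk P a = 0 then V (\<alpha> (inv_into (carrier G) V a))
    else if rk P a = 1 then E (\<beta> (inv_into (carrier G) E a))
    else F (\<delta> (inv_into (carrier G) F a)))"

definition compatible :: "('a \<Rightarrow> 'a) \<Rightarrow> ('a \<Rightarrow> 'a) \<Rightarrow> ('a \<Rightarrow> 'a) \<Rightarrow> bool" where
  "compatible \<alpha> \<beta> \<delta> \<longleftrightarrow>
    \<alpha> \<in> carrier G \<rightarrow> carrier G \<and> \<beta> \<in> carrier G \<rightarrow> carrier G \<and> \<delta> \<in> carrier G \<rightarrow> carrier G \<and>
    (\<forall>g\<in>carrier G. \<forall>h\<in>carrier G. (V g = V h \<longrightarrow> V (\<alpha> g) = V (\<alpha> h)) \<and>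
      (E g = E h \<longrightarrow> E (\<beta> g) = E (\<beta> h)) \<and> (F g = F h \<longrightarrow> F (\<delta> g) = F (\<delta> h))) \<and>
    (\<forall>g\<in>carrier G. (V (\<alpha> g), E (\<beta> g)) \<in> leq_rel P \<and> (E (\<beta> g), F (\<delta> g)) \<in> leq_rel P \<and>
      (V (\<alpha> g), F (\<delta> g)) \<in> leq_rel P)"

lemma compatible_closed:
  assumes "compatible \<alpha> \<beta> \<delta>" "g \<in> carrier G"
  shows "\<alpha> g \<in> carrier G" "\<beta> g \<in> carrier G" "\<delta> g \<in> carrier G"
  using assms unfolding compatible_def Pi_iff by blast+

lemma compatible_leq:
  assumes "compatible \<alpha> \<beta> \<delta>" "g \<in> carrier G"
  shows "(V (\<alpha> g), E (\<beta> g)) \<in> leq_rel P" "(E (\<beta> g), F (\<delta> g)) \<in> leq_rel P"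
    "(V (\<alpha> g), F (\<delta> g)) \<in> leq_rel P"
  using assms unfolding compatible_def by blast+

lemma induced_simps:
  assumes "compatible \<alpha> \<beta> \<delta>" "g \<in> carrier G"
  shows "induced \<alpha> \<beta> \<delta> (V g) = V (\<alpha> g)" "induced \<alpha> \<beta> \<delta> (E g) = E (\<beta> g)"
    "induced \<alpha> \<beta> \<delta> (F g) = F (\<delta> g)"
proof -
  have "inv_into (carrier G) V (V g) \<in> carrier G" "V (inv_into (carrier G) V (V g)) = V g"
    "inv_into (carrier G) E (E g) \<in> carrier G" "E (inv_into (carrier G) E (E g)) = E g"
    "inv_into (carrier G) F (F g) \<in> carrier G" "F (inv_into (carrier G) F (F g)) = F g"
    using assms(2) by (auto simp: inv_into_into f_inv_into_f)
  then have "V (\<alpha> (inv_into (carrier G) V (V g))) = V (\<alpha> g)"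
    "E (\<beta> (inv_into (carrier G) E (E g))) = E (\<beta> g)"
    "F (\<delta> (inv_into (carrier G) F (F g))) = F (\<delta> g)"
    using assms unfolding compatible_def by blast+
  then show "induced \<alpha> \<beta> \<delta> (V g) = V (\<alpha> g)" "induced \<alpha> \<beta> \<delta> (E g) = E (\<beta> g)"
    "induced \<alpha> \<beta> \<delta> (F g) = F (\<delta> g)"
    using assms(2) by (simp_all add: induced_def in_elts rk_V rk_E rk_F)
qed

lemma elts_cases:
  assumes "a \<in> elts P"
  obtains g where "g \<in> carrier G" "a = V g" | g where "g \<in> carrier G" "a = E g"
    | g where "g \<in> carrier G" "a = F g"
  using assms by (auto simp: elts_eq)

lemma induced_leq:
  assumes "compatible \<alpha> \<beta> \<delta>" "(a, b) \<in> leq_rel P"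
  shows "(induced \<alpha> \<beta> \<delta> a, induced \<alpha> \<beta> \<delta> b) \<in> leq_rel P"
proof (cases "a = b")
  case True
  have a: "a \<in> elts P" using geom.leq_elts[OF assms(2)] by simp
  from a show ?thesis unfolding True[symmetric]
    by (rule elts_cases) (simp_all add: induced_simps[OF assms(1)] leq_others compatible_closed[OF assms(1)])
next
  case False
  with assms(2) show ?thesis
    by (rule leq_cases) (simp_all add: induced_simps[OF assms(1)] compatible_leq[OF assms(1)])
qed

text \<open>The inverse is induced as well; preservation of the order by both maps gives the
  equivalence that automorphisms must satisfy.\<close>

lemma induced_aut:
  assumes c: "compatible \<alpha> \<beta> \<delta>" and c': "compatible \<alpha>' \<beta>' \<delta>'"
    and inv: "\<And>g. g \<in> carrier G \<Longrightarrow> \<alpha>' (\<alpha> g) = g \<and> \<beta>' (\<beta> g) = g \<and> \<delta>' (\<delta> g) = g"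
    and inv': "\<And>g. g \<in> carrier G \<Longrightarrow> \<alpha> (\<alpha>' g) = g \<and> \<beta> (\<beta>' g) = g \<and> \<delta> (\<delta>' g) = g"
  shows "induced \<alpha> \<beta> \<delta> \<in> auts P"
proof -
  let ?i = "induced \<alpha> \<beta> \<delta>" and ?i' = "induced \<alpha>' \<beta>' \<delta>'"
  note cl = compatible_closed[OF c] compatible_closed[OF c']
  note s = induced_simps[OF c] induced_simps[OF c']
  have i: "?i a \<in> elts P" "?i' a \<in> elts P" "?i' (?i a) = a" "?i (?i' a) = a" if "a \<in> elts P" for a
    using that by (rule_tac elts_cases[OF that]; simp add: s cl in_elts inv inv')+
  have "bij_betw ?i (elts P) (elts P)"
    by (rule bij_betw_byWitness[of _ ?i']) (auto simp: i)
  moreover have "?i \<in> extensional (elts P)" by (simp add: induced_def)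
  moreover have "(?i a, ?i b) \<in> leq_rel P \<longleftrightarrow> (a, b) \<in> leq_rel P" if "a \<in> elts P" "b \<in> elts P" for a b
    using induced_leq[OF c, of a b] induced_leq[OF c', of "?i a" "?i b"] i that by auto
  ultimately show ?thesis by (simp add: auts_def Bij_def)
qed

section \<open>Right translations and reflections\<close>

definition translation :: "'a \<Rightarrow> 'c \<Rightarrow> 'c" where
  "translation h = induced (\<lambda>g. g \<otimes> h) (\<lambda>g. g \<otimes> h) (\<lambda>g. g \<otimes> h)"

lemma translation_compatible:
  assumes "h \<in> carrier G"
  shows "compatible (\<lambda>g. g \<otimes> h) (\<lambda>g. g \<otimes> h) (\<lambda>g. g \<otimes> h)"
proof -
  have "g \<otimes> h \<otimes> inv (k \<otimes> h) = g \<otimes> inv k" if "g \<in> carrier G" "k \<in> carrier G" for g k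
    using that assms by (simp add: rels)
  then have "V (g \<otimes> h) = V (k \<otimes> h) \<longleftrightarrow> V g = V k" "F (g \<otimes> h) = F (k \<otimes> h) \<longleftrightarrow> F g = F k"
    if "g \<in> carrier G" "k \<in> carrier G" for g k
    using that assms by (simp_all add: V_eq F_eq)
  moreover have "E (g \<otimes> h) = E (k \<otimes> h) \<longleftrightarrow> E g = E k" if "g \<in> carrier G" "k \<in> carrier G" for g k
    using that assms by (simp add: E_eq flip: m_assoc)
  ultimately show ?thesis using assms by (auto simp: compatible_def leq_self)
qed

lemma translation_aut:
  assumes "h \<in> carrier G"
  shows "translation h \<in> auts P"
  unfolding translation_def
  by (rule induced_aut[OF translation_compatible translation_compatible[of "inv h"]])
    (use assms in \<open>simp_all add: m_assoc\<close>)

lemma translation_flag: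
  assumes "h \<in> carrier G" "g \<in> carrier G"
  shows "flag_map (translation h) (even_flag g) = even_flag (g \<otimes> h)"
    "flag_map (translation h) (odd_flag g) = odd_flag (g \<otimes> h)"
  using assms induced_simps[OF translation_compatible[of h]]
  by (simp_all add: translation_def even_flag_def odd_flag_def flag_map_simp m_assoc)

text \<open>Right multiplication is a homomorphism and not an antihomomorphism, because products in
  \<open>aut_group\<close> apply the left factor first. By freeness it is enough to compare images
  of the base flag.\<close>

lemma translation_hom: "translation \<in> hom G (aut_group P)"
proof (rule homI)
  show "translation g \<in> carrier (aut_group P)" if "g \<in> carrier G" for g
    using that translation_aut by (simp add: aut_group_def)
  fix g h assume gh: "g \<in> carrier G" "h \<in> carrier G"
  interpret A: group "aut_group P" by (rule group_aut_group)
  have m: "translation g \<otimes>\<^bsub>aut_group P\<^esub> translation h = compose (elts P) (translation h) (translation g)"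
    by (simp add: aut_group_def)
  have "translation g \<otimes>\<^bsub>aut_group P\<^esub> translation h \<in> auts P"
    using A.m_closed gh translation_aut by (simp add: aut_group_def)
  moreover have "flag_map (translation g \<otimes>\<^bsub>aut_group P\<^esub> translation h) (even_flag \<one>) = even_flag (g \<otimes> h)"
    unfolding m even_flag_def flag_map_simp
    using gh translation_flag[of h g] translation_flag[of g \<one>]
    by (simp add: compose_eq in_elts even_flag_def flag_map_simp)
  ultimately show "translation (g \<otimes> h) = translation g \<otimes>\<^bsub>aut_group P\<^esub> translation h"
    using gh translation_flag[of "g \<otimes> h" \<one>] translation_aut[of "g \<otimes> h"] flag_in(1)[of \<one>]
    by (intro geom.aut_eqI[of _ _ "even_flag \<one>"]) simp_all
qed

lemma rot_translation:
  "rot1 P (even_flag \<one>) = translation x" "rot2 P (even_flag \<one>) = translation y"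
proof -
  have "flag_adj P 0 (flag_adj P 1 (even_flag \<one>)) = even_flag x"
    "flag_adj P 1 (flag_adj P 2 (even_flag \<one>)) = even_flag y"
    by (simp_all add: adj_simps inv_cancel_left)
  moreover have "flag_map (translation x) (even_flag \<one>) = even_flag x"
    "flag_map (translation y) (even_flag \<one>) = even_flag y"
    using translation_flag(1)[of _ \<one>] by simp_all
  ultimately show "rot1 P (even_flag \<one>) = translation x" "rot2 P (even_flag \<one>) = translation y"
    unfolding rot1_def rot2_def
    using translation_aut flag_in(1)[of \<one>] by (auto intro!: the_equality intro: geom.aut_eqI)
qed

lemma translation_hom_rot_group: "translation \<in> hom G (rot_group P (even_flag \<one>))"
proof -
  interpret T: group_hom G "aut_group P" translation
    using translation_hom group_aut_group is_group by (simp add: group_hom_def group_hom_axioms_def)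
  have "translation g \<in> generate (aut_group P) {translation x, translation y}" if "g \<in> carrier G" for g
    using that
    by (induction rule: carrier_induct)
      (auto intro: generate.intros)
  then show ?thesis
    using translation_hom by (auto simp: hom_def rot_group_def rot_translation)
qed

text \<open>An inverting endomorphism \<theta> permutes the cosets of X and those of Y, but need not
  respect the edge cosets. Since the 1-adjacent flag of the base flag has the edge
  \<open>E (y^-1)\<close>, the map on edges is \<theta> followed by left multiplication with
  \<open>y^-1\<close>, which does respect them.\<close>

lemma reflexible_imp_reflection:
  assumes reflexible
  obtains \<gamma> where "\<gamma> \<in> auts P" "flag_map \<gamma> (even_flag \<one>) = flag_adj P 1 (even_flag \<one>)"
proof -
  obtain \<theta> where \<theta>: "\<theta> \<in> hom G G" "\<theta> x = inv x" "\<theta> y = inv y"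
    using assms by (auto simp: reflexible_def)
  interpret \<theta>: group_hom G G \<theta> using \<theta> is_group by (simp add: group_hom_def group_hom_axioms_def)
  note inv = reflexible_involution[OF \<theta>]
  let ?\<beta> = "\<lambda>g. inv y \<otimes> \<theta> g"
  have gen: "\<theta> u \<in> generate G {a}" if "u \<in> generate G {a}" "a = x \<or> a = y" for u a
  proof -
    have "u \<in> generate G {a}" "{a} \<subseteq> carrier G" using that by auto
    then show ?thesis
    proof (induction rule: generate_left_induct)
      case one
      then show ?case by (simp add: generate.one)
    next
      case (mult h g)
      then have "g \<in> carrier G" "\<theta> h = inv h" "h \<in> carrier G"
        using that generate_in_carrier[of "{a}" g] \<theta> by auto
      then show ?case using mult by (auto intro: generate.intros)
    next
      case (inv_mult h g)
      then have "g \<in> carrier G" "\<theta> h = inv h" "h \<in> carrier G"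
        using that generate_in_carrier[of "{a}" g] \<theta> by auto
      then show ?case using inv_mult by (auto intro: generate.intros)
    qed
  qed
  have c: "compatible \<theta> ?\<beta> \<theta>"
    unfolding compatible_def
  proof (intro conjI ballI impI)
    fix g h assume gh: "g \<in> carrier G" "h \<in> carrier G"
    show "V (\<theta> g) = V (\<theta> h)" if "V g = V h"
      using gen[of "g \<otimes> inv h" y] that gh by (simp add: V_eq)
    show "F (\<theta> g) = F (\<theta> h)" if "F g = F h"
      using gen[of "g \<otimes> inv h" x] that gh by (simp add: F_eq)
    show "E (?\<beta> g) = E (?\<beta> h)" if "E g = E h"
      using that gh by (auto simp: E_eq \<theta> rels)
  next
    fix g assume g: "g \<in> carrier G"
    show "(V (\<theta> g), E (?\<beta> g)) \<in> leq_rel P" using g by (simp add: leq_V_E V_mult)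
    show "(E (?\<beta> g), F (\<theta> g)) \<in> leq_rel P" using g by (simp add: leq_E_F inv_cancel_left)
    show "(V (\<theta> g), F (\<theta> g)) \<in> leq_rel P" using g by (simp add: leq_self)
  qed auto
  have "\<theta> (\<theta> g) = g \<and> ?\<beta> (?\<beta> g) = g \<and> \<theta> (\<theta> g) = g" if "g \<in> carrier G" for g
    using that inv \<theta> by (simp add: inv_cancel_left)
  then have "induced \<theta> ?\<beta> \<theta> \<in> auts P" by (intro induced_aut[OF c c]) blast+
  moreover have "flag_map (induced \<theta> ?\<beta> \<theta>) (even_flag \<one>) = odd_flag (inv y)"
    using induced_simps[OF c, of \<one>] V_mult(2)[of \<one>]
    by (simp add: even_flag_def odd_flag_def flag_map_simp)
  ultimately show ?thesis using that by (simp add: adj_simps)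
qed

text \<open>Multiplication by a generator is a pair of adjacencies on even flags, and \<gamma>
  commutes with adjacency. On odd flags the same pair multiplies by the inverse generator, so
  \<gamma> itself carries the required map.\<close>

lemma reflection_imp_reflexible:
  assumes \<gamma>: "\<gamma> \<in> auts P" "flag_map \<gamma> (even_flag \<one>) = flag_adj P 1 (even_flag \<one>)"
  shows reflexible
proof -
  \<comment> \<open>The shift by \<open>y^-1\<close> makes \<open>\<one>\<close> correspond to
    \<open>\<one>\<close>, because the 1-adjacent flag of \<open>even_flag \<one>\<close> is
    \<open>odd_flag (y^-1)\<close>.\<close>
  let ?Q = "\<lambda>g c. c \<in> carrier G \<and> flag_map \<gamma> (even_flag g) = odd_flag (inv y \<otimes> c)"
  have x_eq: "even_flag (x \<otimes> g) = flag_adj P 0 (flag_adj P 1 (even_flag g))"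
    and y_eq: "even_flag (y \<otimes> g) = flag_adj P 1 (flag_adj P 2 (even_flag g))"
    and ix_eq: "even_flag (inv x \<otimes> g) = flag_adj P 1 (flag_adj P 0 (even_flag g))"
    and iy_eq: "even_flag (inv y \<otimes> g) = flag_adj P 2 (flag_adj P 1 (even_flag g))"
    if "g \<in> carrier G" for g
    using that by (simp_all add: adj_simps rels)
  have map_adj: "flag_map \<gamma> (flag_adj P i (flag_adj P j (even_flag g)))
      = flag_adj P i (flag_adj P j (flag_map \<gamma> (even_flag g)))"
    if "g \<in> carrier G" "i \<in> {0, 1, 2}" "j \<in> {0, 1, 2}" for g i j
    using geom.aut_adj[OF \<gamma>(1)] geom.flag_adj(1) flag_in(1) that by metis
  have step: "?Q (x \<otimes> g) (inv x \<otimes> c)" "?Q (y \<otimes> g) (inv y \<otimes> c)"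
      "?Q (inv x \<otimes> g) (x \<otimes> c)" "?Q (inv y \<otimes> g) (y \<otimes> c)"
    if "g \<in> carrier G" "?Q g c" for g c
  proof -
    let ?o = "odd_flag (inv y \<otimes> c)"
    have i: "0 \<in> {0, 1, 2 :: nat}" "1 \<in> {0, 1, 2 :: nat}" "2 \<in> {0, 1, 2 :: nat}" by auto
    have "flag_map \<gamma> (even_flag (x \<otimes> g)) = flag_adj P 0 (flag_adj P 1 ?o)"
      "flag_map \<gamma> (even_flag (y \<otimes> g)) = flag_adj P 1 (flag_adj P 2 ?o)"
      "flag_map \<gamma> (even_flag (inv x \<otimes> g)) = flag_adj P 1 (flag_adj P 0 ?o)"
      "flag_map \<gamma> (even_flag (inv y \<otimes> g)) = flag_adj P 2 (flag_adj P 1 ?o)"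
      unfolding x_eq[OF that(1)] y_eq[OF that(1)] ix_eq[OF that(1)] iy_eq[OF that(1)]
      using that(2) by (simp_all only: map_adj[OF that(1)] i)
    then show "?Q (x \<otimes> g) (inv x \<otimes> c)" "?Q (y \<otimes> g) (inv y \<otimes> c)"
      "?Q (inv x \<otimes> g) (x \<otimes> c)" "?Q (inv y \<otimes> g) (y \<otimes> c)"
      using that(2) by (simp_all add: adj_simps rels)
  qed
  have Q_one: "?Q \<one> \<one>" using \<gamma>(2) by (simp add: adj_simps)
  have ex: "\<exists>c. ?Q g c" if "g \<in> carrier G" for g
    using that
  proof (induction rule: carrier_induct)
    case one
    show ?case using Q_one by (rule exI)
  next
    case (x g)
    then obtain c where "?Q g c" by (elim exE)
    from step(1)[OF x(1) this] show ?case by (rule exI)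
  next
    case (y g)
    then obtain c where "?Q g c" by (elim exE)
    from step(2)[OF y(1) this] show ?case by (rule exI)
  next
    case (inv_x g)
    then obtain c where "?Q g c" by (elim exE)
    from step(3)[OF inv_x(1) this] show ?case by (rule exI)
  next
    case (inv_y g)
    then obtain c where "?Q g c" by (elim exE)
    from step(4)[OF inv_y(1) this] show ?case by (rule exI)
  qed
  \<comment> \<open>The image flag determines \<open>c\<close>, whichever word led to
    \<open>g\<close>; hence no relation of G has to be checked for \<theta> to be well
    defined.\<close>
  have uniq: "c = d" if "?Q g c" "?Q g d" for g c d
  proof -
    have "inv y \<otimes> c = inv y \<otimes> d"
      using that inj_onD[OF odd_flag_inj, of "inv y \<otimes> c" "inv y \<otimes> d"] by simp
    then show ?thesis using that by simp
  qed
  define \<theta> where "\<theta> g = (THE c. ?Q g c)" for g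
  have \<theta>: "?Q g (\<theta> g)" if "g \<in> carrier G" for g
    unfolding \<theta>_def by (rule theI') (use ex[OF that] uniq in \<open>blast intro: ex_ex1I\<close>)
  have \<theta>_eq: "\<theta> g = c" if "?Q g c" "g \<in> carrier G" for g c
    using uniq[OF \<theta>[OF that(2)] that(1)] .
  have \<theta>_one: "\<theta> \<one> = \<one>" using \<theta>_eq[OF Q_one] by simp
  have \<theta>_step: "\<theta> (x \<otimes> g) = inv x \<otimes> \<theta> g" "\<theta> (y \<otimes> g) = inv y \<otimes> \<theta> g"
    "\<theta> (inv x \<otimes> g) = x \<otimes> \<theta> g" "\<theta> (inv y \<otimes> g) = y \<otimes> \<theta> g" if "g \<in> carrier G" for g
    using step[OF that \<theta>[OF that], THEN \<theta>_eq] that by simp_all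
  have cl: "\<theta> g \<in> carrier G" if "g \<in> carrier G" for g using \<theta>[OF that] by blast
  have "\<theta> (g \<otimes> h) = \<theta> g \<otimes> \<theta> h" if "g \<in> carrier G" "h \<in> carrier G" for g h
    using that by (induction rule: carrier_induct) (simp_all add: \<theta>_one \<theta>_step cl m_assoc)
  then have "\<theta> \<in> hom G G" using cl by (auto simp: hom_def)
  moreover have "\<theta> x = inv x" "\<theta> y = inv y" using \<theta>_step(1,2)[of \<one>] \<theta>_one by simp_all
  ultimately show ?thesis unfolding reflexible_def by blast
qed

text \<open>Adjacency switches the parity of a flag and translations are transitive on each parity.
  Transitivity on all flags would provide a reflection at the base flag.\<close>

lemma is_chiral:
  assumes "\<not> reflexible"
  shows "chiral_polyhedron P"
proof -
  let ?A = "even_flag ` carrier G" and ?B = "odd_flag ` carrier G"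
  have alt: "\<Psi> \<in> ?A \<longleftrightarrow> flag_adj P i \<Psi> \<in> ?B" if \<Psi>: "\<Psi> \<in> flags P" and i: "i \<in> {0, 1, 2}" for \<Psi> i
  proof -
    have i: "i = 0 \<or> i = 1 \<or> i = 2" using i by simp
    consider g where "g \<in> carrier G" "\<Psi> = even_flag g" | g where "g \<in> carrier G" "\<Psi> = odd_flag g"
      using \<Psi> by (auto simp: flags_eq)
    then show ?thesis
    proof cases
      case 1
      then have "flag_adj P i \<Psi> \<in> ?B" using i adj_even[of g] by auto
      then show ?thesis using 1 by blast
    next
      case 2
      then have "flag_adj P i \<Psi> \<in> ?A" using i adj_odd[of g] by auto
      then show ?thesis using 2 even_odd_disjoint by blast
    qed
  qed
  have trans: "transitive_on P ?A" "transitive_on P ?B"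
  proof -
    have "\<exists>\<gamma>\<in>auts P. flag_map \<gamma> (even_flag g) = even_flag h"
      "\<exists>\<gamma>\<in>auts P. flag_map \<gamma> (odd_flag g) = odd_flag h" if "g \<in> carrier G" "h \<in> carrier G" for g h
      using that translation_flag[of "inv g \<otimes> h" g] translation_aut[of "inv g \<otimes> h"]
      by (auto simp: inv_cancel_left)
    then show "transitive_on P ?A" "transitive_on P ?B" by (auto simp: transitive_on_def)
  qed
  have "\<not> transitive_on P (flags P)"
  proof
    assume "transitive_on P (flags P)"
    then obtain \<gamma> where "\<gamma> \<in> auts P" "flag_map \<gamma> (even_flag \<one>) = flag_adj P 1 (even_flag \<one>)"
      unfolding transitive_on_def using flag_in(1)[of \<one>] geom.flag_adj(1)[of "even_flag \<one>" 1]
      by auto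
    then show False using reflection_imp_reflexible assms by blast
  qed
  then show ?thesis
    unfolding chiral_polyhedron_def
    by (intro conjI exI[of _ ?A] exI[of _ ?B] is_polyhedron flags_eq[symmetric] even_odd_disjoint trans ballI alt)
qed

end

section \<open>Chiral polyhedra as coset geometries\<close>

context flagged_polyhedron
begin

lemma adj_0_2_commute:
  assumes "\<Psi> \<in> flags P"
  shows "flag_adj P 0 (flag_adj P 2 \<Psi>) = flag_adj P 2 (flag_adj P 0 \<Psi>)"
proof -
  obtain v e f where \<Psi>: "\<Psi> = (v, e, f)" by (cases \<Psi>)
  then have fl: "(v, e, f) \<in> flags P" using assms by simp
  obtain v' e' f' where adj: "flag_adj P 0 (v, e, f) = (v', e, f)" "v' \<noteq> v" "(v', e, f) \<in> flags P"
    "flag_adj P 2 (v, e, f) = (v, e, f')" "f' \<noteq> f" "(v, e, f') \<in> flags P"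
    using flag_adj_forms[OF fl] by metis
  have m: "(v', e, f') \<in> flags P"
    using flagI[OF flagD(1)[OF adj(3)] flagD(2)[OF fl] flagD(3)[OF adj(6)]
        flagD(7)[OF adj(3)] flagD(8)[OF adj(6)]] .
  have "flag_adj P 0 (v, e, f') = (v', e, f')" "flag_adj P 2 (v', e, f) = (v', e, f')"
    using adj m by (auto intro!: flag_adj_eqI simp: differ_at_simps)
  then show ?thesis by (simp add: \<Psi> adj)
qed

lemma aut_mult_apply:
  "\<gamma> \<in> auts P \<Longrightarrow> a \<in> elts P \<Longrightarrow> (\<gamma> \<otimes>\<^bsub>aut_group P\<^esub> \<delta>) a = \<delta> (\<gamma> a)"
  by (simp add: aut_group_def compose_eq)

lemma flag_map_mult:
  "\<gamma> \<in> auts P \<Longrightarrow> \<Psi> \<in> flags P \<Longrightarrow> flag_map (\<gamma> \<otimes>\<^bsub>aut_group P\<^esub> \<delta>) \<Psi> = flag_map \<delta> (flag_map \<gamma> \<Psi>)"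
  by (cases \<Psi>) (auto simp: flag_map_simp aut_mult_apply dest: flagD(4-6))

lemma flag_map_one: "\<Psi> \<in> flags P \<Longrightarrow> flag_map \<one>\<^bsub>aut_group P\<^esub> \<Psi> = \<Psi>"
  by (cases \<Psi>) (auto simp: flag_map_simp aut_group_def dest: flagD(4-6))

end

section \<open>The rotation group of a chiral polyhedron\<close>

locale chiral_flagged_polyhedron = flagged_polyhedron +
  assumes chiral: "chiral_polyhedron P"
begin

abbreviation "\<A> \<equiv> aut_group P"

sublocale A: group \<A> by (rule group_aut_group)

lemma carrier_aut: "carrier \<A> = auts P" by (simp add: aut_group_def)

lemma flag_map_inv:
  assumes "\<gamma> \<in> auts P" "\<Psi> \<in> flags P" "flag_map \<gamma> \<Psi> = \<Psi>'"
  shows "flag_map (inv\<^bsub>\<A>\<^esub> \<gamma>) \<Psi>' = \<Psi>"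
  using flag_map_mult[OF assms(1,2), of "inv\<^bsub>\<A>\<^esub> \<gamma>"] assms flag_map_one[OF assms(2)]
  by (simp add: carrier_aut A.r_inv)

lemma inv_aut: "\<gamma> \<in> auts P \<Longrightarrow> inv\<^bsub>\<A>\<^esub> \<gamma> \<in> auts P"
  using A.inv_closed by (simp add: carrier_aut)

lemma mult_aut: "\<gamma> \<in> auts P \<Longrightarrow> \<delta> \<in> auts P \<Longrightarrow> \<gamma> \<otimes>\<^bsub>\<A>\<^esub> \<delta> \<in> auts P"
  using A.m_closed by (simp add: carrier_aut)

lemma classes:
  obtains S T where "\<Phi> \<in> S" "S \<union> T = flags P" "transitive_on P S" "transitive_on P T"
    "\<And>\<Psi> i. \<Psi> \<in> flags P \<Longrightarrow> i \<in> {0, 1, 2} \<Longrightarrow> \<Psi> \<in> S \<Longrightarrow> flag_adj P i \<Psi> \<in> T"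
    "\<And>\<Psi> i. \<Psi> \<in> flags P \<Longrightarrow> i \<in> {0, 1, 2} \<Longrightarrow> \<Psi> \<in> T \<Longrightarrow> flag_adj P i \<Psi> \<in> S"
proof -
  obtain A B where AB: "A \<union> B = flags P" "A \<inter> B = {}" "transitive_on P A" "transitive_on P B"
    and adj: "\<And>\<Psi> i. \<Psi> \<in> flags P \<Longrightarrow> i \<in> {0, 1, 2} \<Longrightarrow> \<Psi> \<in> A \<longleftrightarrow> flag_adj P i \<Psi> \<in> B"
    using chiral unfolding chiral_polyhedron_def by blast
  have adj': "flag_adj P i \<Psi> \<in> A" if "\<Psi> \<in> flags P" "i \<in> {0, 1, 2}" "\<Psi> \<in> B" for \<Psi> i
    using adj[OF that(1,2)] that AB flag_adj(1)[OF that(1,2)] by blast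
  show ?thesis
  proof (cases "\<Phi> \<in> A")
    case True
    then show ?thesis using that[of A B] AB adj adj' by blast
  next
    case False
    then have "\<Phi> \<in> B" using AB base_flag by blast
    then show ?thesis using that[of B A] AB adj adj' by blast
  qed
qed

text \<open>One automorphism that joins the base flag to a flag of the other class would fuse the
  two classes into a single orbit.\<close>

lemma no_reflection:
  assumes "\<gamma> \<in> auts P" "flag_map \<gamma> \<Phi> = flag_adj P i \<Phi>" "i \<in> {0, 1, 2}"
  shows False
proof -
  obtain S T where ST: "\<Phi> \<in> S" "S \<union> T = flags P" "transitive_on P S" "transitive_on P T"
    and adj: "\<And>\<Psi> i. \<Psi> \<in> flags P \<Longrightarrow> i \<in> {0, 1, 2} \<Longrightarrow> \<Psi> \<in> S \<Longrightarrow> flag_adj P i \<Psi> \<in> T"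
    using classes by metis
  have reach: "\<exists>\<delta>\<in>auts P. flag_map \<delta> \<Phi> = \<Psi>" if "\<Psi> \<in> flags P" for \<Psi>
  proof (cases "\<Psi> \<in> S")
    case True
    then show ?thesis using ST unfolding transitive_on_def by blast
  next
    case False
    then have "\<Psi> \<in> T" using that ST by blast
    then obtain \<delta> where "\<delta> \<in> auts P" "flag_map \<delta> (flag_adj P i \<Phi>) = \<Psi>"
      using adj[OF base_flag assms(3) ST(1)] ST(4) unfolding transitive_on_def by blast
    then have "flag_map (\<gamma> \<otimes>\<^bsub>\<A>\<^esub> \<delta>) \<Phi> = \<Psi>" "\<gamma> \<otimes>\<^bsub>\<A>\<^esub> \<delta> \<in> auts P"
      using flag_map_mult[OF assms(1) base_flag] assms mult_aut by simp_all
    then show ?thesis by blast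
  qed
  have "transitive_on P (flags P)"
    unfolding transitive_on_def
  proof (intro ballI)
    fix \<Psi> \<Psi>' assume fl: "\<Psi> \<in> flags P" "\<Psi>' \<in> flags P"
    then obtain \<delta> \<delta>' where d: "\<delta> \<in> auts P" "flag_map \<delta> \<Phi> = \<Psi>" "\<delta>' \<in> auts P" "flag_map \<delta>' \<Phi> = \<Psi>'"
      using reach by metis
    then have "flag_map (inv\<^bsub>\<A>\<^esub> \<delta> \<otimes>\<^bsub>\<A>\<^esub> \<delta>') \<Psi> = \<Psi>'"
      using flag_map_mult[OF inv_aut fl(1)] flag_map_inv[OF _ base_flag] by simp
    then show "\<exists>\<gamma>\<in>auts P. flag_map \<gamma> \<Psi> = \<Psi>'" using d inv_aut mult_aut by blast
  qed
  then show False using chiral by (simp add: chiral_polyhedron_def)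
qed

text \<open>Two adjacencies lead back into the class of the base flag, on which automorphisms are
  transitive; uniqueness is freeness. So the definite descriptions of \<open>rot1\<close> and
  \<open>rot2\<close> denote.\<close>

lemma rot_ex1:
  assumes "i \<in> {0, 1, 2}" "j \<in> {0, 1, 2}"
  shows "\<exists>!\<gamma>. \<gamma> \<in> auts P \<and> flag_map \<gamma> \<Phi> = flag_adj P i (flag_adj P j \<Phi>)"
proof -
  obtain S T where ST: "\<Phi> \<in> S" "transitive_on P S"
    and adj: "\<And>\<Psi> i. \<Psi> \<in> flags P \<Longrightarrow> i \<in> {0, 1, 2} \<Longrightarrow> \<Psi> \<in> S \<Longrightarrow> flag_adj P i \<Psi> \<in> T"
    "\<And>\<Psi> i. \<Psi> \<in> flags P \<Longrightarrow> i \<in> {0, 1, 2} \<Longrightarrow> \<Psi> \<in> T \<Longrightarrow> flag_adj P i \<Psi> \<in> S"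
    using classes by metis
  have "flag_adj P i (flag_adj P j \<Phi>) \<in> S"
    using adj assms flag_adj(1) base_flag ST by metis
  then obtain \<gamma> where "\<gamma> \<in> auts P" "flag_map \<gamma> \<Phi> = flag_adj P i (flag_adj P j \<Phi>)"
    using ST unfolding transitive_on_def by blast
  then show ?thesis using aut_eqI[OF _ _ base_flag] by (metis (no_types, lifting))
qed

abbreviation "x \<equiv> rot1 P \<Phi>"
abbreviation "y \<equiv> rot2 P \<Phi>"
abbreviation "G \<equiv> rot_group P \<Phi>"

lemma rot_aut: "x \<in> auts P" "y \<in> auts P"
  and rot_flag: "flag_map x \<Phi> = flag_adj P 0 (flag_adj P 1 \<Phi>)" "flag_map y \<Phi> = flag_adj P 1 (flag_adj P 2 \<Phi>)"
proof -
  have i: "0 \<in> {0, 1, 2 :: nat}" "1 \<in> {0, 1, 2 :: nat}" "2 \<in> {0, 1, 2 :: nat}" by auto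
  show "x \<in> auts P" "flag_map x \<Phi> = flag_adj P 0 (flag_adj P 1 \<Phi>)"
    "y \<in> auts P" "flag_map y \<Phi> = flag_adj P 1 (flag_adj P 2 \<Phi>)"
    using theI'[OF rot_ex1[OF i(1,2)]] theI'[OF rot_ex1[OF i(2,3)]]
    by (auto simp: rot1_def rot2_def)
qed

lemma rot_subgroup: "subgroup (carrier G) \<A>"
  using A.generate_is_subgroup[of "{x, y}"] rot_aut by (simp add: rot_group_def carrier_aut)

sublocale G: group G
  using A.subgroup_imp_group[OF rot_subgroup] by (simp add: rot_group_def)

lemma rot_group_mult [simp]: "g \<otimes>\<^bsub>G\<^esub> h = g \<otimes>\<^bsub>\<A>\<^esub> h" and rot_group_one [simp]: "\<one>\<^bsub>G\<^esub> = \<one>\<^bsub>\<A>\<^esub>"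
  by (simp_all add: rot_group_def)

lemma rot_group_inv [simp]: "g \<in> carrier G \<Longrightarrow> inv\<^bsub>G\<^esub> g = inv\<^bsub>\<A>\<^esub> g"
  using A.m_inv_consistent[OF rot_subgroup, of g] by (simp add: rot_group_def)

lemma rot_group_aut: "g \<in> carrier G \<Longrightarrow> g \<in> auts P"
  using subgroup.subset[OF rot_subgroup] carrier_aut by blast

lemma rot_in: "x \<in> carrier G" "y \<in> carrier G"
  by (auto simp: rot_group_def intro: generate.incl)

lemma rot_generate: "generate G {x, y} = carrier G"
  using A.generate_consistent[OF _ rot_subgroup, of "{x, y}"] rot_in by (simp add: rot_group_def)

lemma flag_map_G:
  "g \<in> carrier G \<Longrightarrow> \<Psi> \<in> flags P \<Longrightarrow> flag_map (g \<otimes>\<^bsub>G\<^esub> h) \<Psi> = flag_map h (flag_map g \<Psi>)"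
  using flag_map_mult rot_group_aut by simp

lemma i012: "0 \<in> {0, 1, 2 :: nat}" "1 \<in> {0, 1, 2 :: nat}" "2 \<in> {0, 1, 2 :: nat}" by auto

lemmas adj_flag = flag_adj(1)[OF _ i012(1)] flag_adj(1)[OF _ i012(2)] flag_adj(1)[OF _ i012(3)]
lemmas adj_invol = flag_adj_invol[OF _ i012(1)] flag_adj_invol[OF _ i012(2)] flag_adj_invol[OF _ i012(3)]
lemmas adj_aut = aut_adj[OF _ _ i012(1)] aut_adj[OF _ _ i012(2)] aut_adj[OF _ _ i012(3)]

text \<open>Adjacencies at the base flag rewritten as rotations, which is the form that
  \<open>orbit_closed\<close> asks for.\<close>

lemma base_adj:
  "flag_adj P 1 \<Phi> = flag_map (inv\<^bsub>G\<^esub> y) (flag_adj P 2 \<Phi>)"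
  "flag_adj P 0 \<Phi> = flag_map (inv\<^bsub>G\<^esub> x) (flag_adj P 1 \<Phi>)"
  "flag_adj P 0 (flag_adj P 2 \<Phi>) = flag_map (x \<otimes>\<^bsub>G\<^esub> y) \<Phi>"
proof -
  note b = base_flag
  have "flag_map y (flag_adj P 1 \<Phi>) = flag_adj P 2 \<Phi>"
    unfolding adj_aut(2)[OF rot_aut(2) b] rot_flag(2) by (rule adj_invol(2)[OF adj_flag(3)[OF b]])
  note 1 = flag_map_inv[OF rot_aut(2) adj_flag(2)[OF b] this]
  then show "flag_adj P 1 \<Phi> = flag_map (inv\<^bsub>G\<^esub> y) (flag_adj P 2 \<Phi>)" using rot_in by simp
  have "flag_map x (flag_adj P 0 \<Phi>) = flag_adj P 1 \<Phi>"
    unfolding adj_aut(1)[OF rot_aut(1) b] rot_flag(1) by (rule adj_invol(1)[OF adj_flag(2)[OF b]])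
  from flag_map_inv[OF rot_aut(1) adj_flag(1)[OF b] this]
  show "flag_adj P 0 \<Phi> = flag_map (inv\<^bsub>G\<^esub> x) (flag_adj P 1 \<Phi>)" using rot_in by simp
  have "flag_map (x \<otimes>\<^bsub>G\<^esub> y) \<Phi> = flag_map y (flag_adj P 0 (flag_adj P 1 \<Phi>))"
    unfolding flag_map_G[OF rot_in(1) b] rot_flag(1) ..
  also have "\<dots> = flag_adj P 0 (flag_adj P 2 \<Phi>)"
    unfolding adj_aut(1)[OF rot_aut(2) adj_flag(2)[OF b]] \<open>flag_map y (flag_adj P 1 \<Phi>) = flag_adj P 2 \<Phi>\<close> ..
  finally show "flag_adj P 0 (flag_adj P 2 \<Phi>) = flag_map (x \<otimes>\<^bsub>G\<^esub> y) \<Phi>" ..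
qed

text \<open>On the base flag \<open>x y\<close> performs the adjacencies 2 and 0, which are
  commuting involutions; freeness does the rest.\<close>

lemma rot_xyxy: "x \<otimes>\<^bsub>G\<^esub> y \<otimes>\<^bsub>G\<^esub> (x \<otimes>\<^bsub>G\<^esub> y) = \<one>\<^bsub>G\<^esub>"
proof (rule aut_eqI[OF _ _ base_flag])
  have xy: "x \<otimes>\<^bsub>G\<^esub> y \<in> carrier G" using rot_in G.m_closed by blast
  note b = base_flag and a = rot_group_aut[OF xy]
  show "x \<otimes>\<^bsub>G\<^esub> y \<otimes>\<^bsub>G\<^esub> (x \<otimes>\<^bsub>G\<^esub> y) \<in> auts P" "\<one>\<^bsub>G\<^esub> \<in> auts P"
    using xy rot_group_aut G.m_closed G.one_closed by blast+
  have "flag_map (x \<otimes>\<^bsub>G\<^esub> y \<otimes>\<^bsub>G\<^esub> (x \<otimes>\<^bsub>G\<^esub> y)) \<Phi> = flag_map (x \<otimes>\<^bsub>G\<^esub> y) (flag_adj P 0 (flag_adj P 2 \<Phi>))"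
    unfolding flag_map_G[OF xy b] base_adj(3) ..
  also have "\<dots> = flag_adj P 0 (flag_adj P 2 (flag_adj P 0 (flag_adj P 2 \<Phi>)))"
    unfolding adj_aut(1)[OF a adj_flag(3)[OF b]] adj_aut(3)[OF a b] base_adj(3)[symmetric] ..
  also have "\<dots> = \<Phi>"
    unfolding adj_0_2_commute[OF b] adj_invol(3)[OF adj_flag(1)[OF b]] by (rule adj_invol(1)[OF b])
  finally show "flag_map (x \<otimes>\<^bsub>G\<^esub> y \<otimes>\<^bsub>G\<^esub> (x \<otimes>\<^bsub>G\<^esub> y)) \<Phi> = flag_map \<one>\<^bsub>G\<^esub> \<Phi>"
    using flag_map_one[OF b] by simp
qed

sublocale G: rotation_pair G x y
  using rot_in rot_generate rot_xyxy by unfold_locales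

lemma adj_translate:
  assumes "g \<in> carrier G" "\<Psi> \<in> flags P" "i \<in> {0, 1, 2}"
  shows "flag_adj P i (flag_map g \<Psi>) = flag_map g (flag_adj P i \<Psi>)"
  using aut_adj[OF rot_group_aut[OF assms(1)] assms(2,3)] by simp

text \<open>Automorphisms commute with adjacency, so closure of two orbits of H is decided at their
  representatives. With H generated by \<open>y\<close>, by \<open>x\<close>, or equal to G, this
  lists the flags at the base vertex, the flags at the base face, and all flags.\<close>

lemma orbit_closed:
  assumes H: "subgroup H G" and I: "I \<subseteq> {0, 1, 2}" and \<Psi>: "\<Psi> \<in> flags P"
    and adj: "\<And>i. i \<in> I \<Longrightarrow> \<exists>u\<in>H. flag_adj P i \<Phi> = flag_map u \<Psi>"
      "\<And>i. i \<in> I \<Longrightarrow> \<exists>u\<in>H. flag_adj P i \<Psi> = flag_map u \<Phi>"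
  shows "adj_closed I ((\<lambda>u. flag_map u \<Phi>) ` H \<union> (\<lambda>u. flag_map u \<Psi>) ` H)"
  unfolding adj_closed_def
proof (intro ballI)
  fix \<Omega> i assume \<Omega>: "\<Omega> \<in> (\<lambda>u. flag_map u \<Phi>) ` H \<union> (\<lambda>u. flag_map u \<Psi>) ` H" and i: "i \<in> I"
  then obtain u where u: "u \<in> H" "\<Omega> = flag_map u \<Phi> \<or> \<Omega> = flag_map u \<Psi>" by blast
  obtain w w' where w: "w \<in> H" "flag_adj P i \<Phi> = flag_map w \<Psi>"
    "w' \<in> H" "flag_adj P i \<Psi> = flag_map w' \<Phi>" using adj i by meson
  have c: "u \<in> carrier G" "w \<in> carrier G" "w' \<in> carrier G"
    using u w subgroup.subset[OF H] by blast+
  have i': "i \<in> {0, 1, 2}" using i I by blast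
  have "flag_adj P i (flag_map u \<Phi>) = flag_map (w \<otimes>\<^bsub>G\<^esub> u) \<Psi>"
    unfolding adj_translate[OF c(1) base_flag i'] w(2) flag_map_G[OF c(2) \<Psi>] ..
  moreover have "flag_adj P i (flag_map u \<Psi>) = flag_map (w' \<otimes>\<^bsub>G\<^esub> u) \<Phi>"
    unfolding adj_translate[OF c(1) \<Psi> i'] w(4) flag_map_G[OF c(3) base_flag] ..
  moreover have "w \<otimes>\<^bsub>G\<^esub> u \<in> H" "w' \<otimes>\<^bsub>G\<^esub> u \<in> H" using subgroup.m_closed[OF H] u w by blast+
  ultimately show "flag_adj P i \<Omega> \<in> (\<lambda>u. flag_map u \<Phi>) ` H \<union> (\<lambda>u. flag_map u \<Psi>) ` H"
    using u(2) by blast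
qed

end

section \<open>Stabilisers of the base elements\<close>

context chiral_flagged_polyhedron
begin

definition base_vertex :: 'a where "base_vertex = fst \<Phi>"
definition base_edge :: 'a where "base_edge = fst (snd \<Phi>)"
definition base_face :: 'a where "base_face = snd (snd \<Phi>)"

lemma base_eq: "\<Phi> = (base_vertex, base_edge, base_face)"
  by (simp add: base_vertex_def base_edge_def base_face_def)

lemma base_flag': "(base_vertex, base_edge, base_face) \<in> flags P"
  using base_flag base_eq by simp

lemmas base_elts = flagD(4-6)[OF base_flag']

lemma flag_map_base: "flag_map g \<Phi> = (g base_vertex, g base_edge, g base_face)"
  by (subst base_eq) (simp add: flag_map_simp)

lemma base_forms:
  obtains v' e' f' where
    "flag_adj P 0 \<Phi> = (v', base_edge, base_face)" "v' \<noteq> base_vertex"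
    "flag_adj P 1 \<Phi> = (base_vertex, e', base_face)" "e' \<noteq> base_edge"
    "flag_adj P 2 \<Phi> = (base_vertex, base_edge, f')" "f' \<noteq> base_face"
  using flag_adj_forms[OF base_flag'] base_eq by metis

lemma apply_mult: "g \<in> carrier G \<Longrightarrow> a \<in> elts P \<Longrightarrow> (g \<otimes>\<^bsub>G\<^esub> h) a = h (g a)"
  using aut_mult_apply rot_group_aut by simp

lemma apply_one: "a \<in> elts P \<Longrightarrow> \<one>\<^bsub>G\<^esub> a = a"
  by (simp add: aut_group_def)

lemma apply_eq_iff:
  assumes "g \<in> carrier G" "h \<in> carrier G" "a \<in> elts P"
  shows "g a = h a \<longleftrightarrow> (g \<otimes>\<^bsub>G\<^esub> inv\<^bsub>G\<^esub> h) a = a"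
proof
  have c: "inv\<^bsub>G\<^esub> h \<in> carrier G" using assms by (rule_tac G.inv_closed)
  assume "g a = h a"
  then have "(g \<otimes>\<^bsub>G\<^esub> inv\<^bsub>G\<^esub> h) a = (h \<otimes>\<^bsub>G\<^esub> inv\<^bsub>G\<^esub> h) a"
    by (simp only: apply_mult[OF assms(1,3)] apply_mult[OF assms(2,3)])
  then show "(g \<otimes>\<^bsub>G\<^esub> inv\<^bsub>G\<^esub> h) a = a"
    using apply_one[OF assms(3)] G.r_inv[OF assms(2)] by metis
next
  assume eq: "(g \<otimes>\<^bsub>G\<^esub> inv\<^bsub>G\<^esub> h) a = a"
  have c: "g \<otimes>\<^bsub>G\<^esub> inv\<^bsub>G\<^esub> h \<in> carrier G" using assms G.inv_closed G.m_closed by blast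
  have "g = g \<otimes>\<^bsub>G\<^esub> inv\<^bsub>G\<^esub> h \<otimes>\<^bsub>G\<^esub> h"
    using assms G.m_assoc G.l_inv G.r_one G.inv_closed by metis
  then show "g a = h a" using apply_mult[OF c assms(3), of h] eq by metis
qed

lemma flag_map_unique:
  assumes "g \<in> carrier G" "h \<in> carrier G" "flag_map g \<Phi> = flag_map h \<Phi>"
  shows "g = h"
  using aut_eqI[OF _ _ base_flag] assms rot_group_aut by blast

lemma not_translate_adj:
  assumes "g \<in> carrier G" "h \<in> carrier G" "i \<in> {0, 1, 2}"
  shows "flag_map g \<Phi> \<noteq> flag_map h (flag_adj P i \<Phi>)"
proof
  assume "flag_map g \<Phi> = flag_map h (flag_adj P i \<Phi>)"
  then have "flag_map (inv\<^bsub>\<A>\<^esub> h) (flag_map g \<Phi>) = flag_adj P i \<Phi>"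
    using flag_map_inv[OF rot_group_aut[OF assms(2)] flag_adj(1)[OF base_flag assms(3)]] by simp
  then have "flag_map (g \<otimes>\<^bsub>\<A>\<^esub> inv\<^bsub>\<A>\<^esub> h) \<Phi> = flag_adj P i \<Phi>"
    using flag_map_mult[OF rot_group_aut[OF assms(1)] base_flag] by simp
  from no_reflection[OF mult_aut[OF rot_group_aut[OF assms(1)] inv_aut[OF rot_group_aut[OF assms(2)]]]
      this assms(3)]
  show False .
qed

lemma generate_fixes:
  assumes "a \<in> elts P" "s \<in> carrier G" "s a = a" "u \<in> generate G {s}"
  shows "u a = a"
proof -
  have s: "{s} \<subseteq> carrier G" using assms by simp
  have inv: "(inv\<^bsub>G\<^esub> s) a = a"
    using apply_mult[OF assms(2,1), of "inv\<^bsub>G\<^esub> s"] G.r_inv[OF assms(2)] apply_one[OF assms(1)] assms(3)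
    by metis
  from assms(4) s show ?thesis
  proof (induction rule: G.generate_left_induct)
    case one
    then show ?case using apply_one assms by blast
  next
    case (mult h g)
    then show ?case using apply_mult[OF assms(2,1)] assms by (metis singletonD)
  next
    case (inv_mult h g)
    then show ?case using apply_mult[OF G.inv_closed[OF assms(2)] assms(1)] inv
      by (metis singletonD)
  qed
qed

lemma x_face: "x base_face = base_face" and y_vertex: "y base_vertex = base_vertex"
  and xy_edge: "(x \<otimes>\<^bsub>G\<^esub> y) base_edge = base_edge"
  and adj2_form: "flag_adj P 2 \<Phi> = (base_vertex, base_edge, y base_face)"
proof -
  obtain v' e' f' where b: "flag_adj P 0 \<Phi> = (v', base_edge, base_face)"
    "flag_adj P 1 \<Phi> = (base_vertex, e', base_face)" "flag_adj P 2 \<Phi> = (base_vertex, base_edge, f')"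
    using base_forms by metis
  have fl: "(base_vertex, e', base_face) \<in> flags P" "(base_vertex, base_edge, f') \<in> flags P"
    using adj_flag[OF base_flag] b by auto
  obtain v1 e1 f1 where a1: "flag_adj P 0 (base_vertex, e', base_face) = (v1, e', base_face)"
    using flag_adj_forms[OF fl(1)] by metis
  obtain v2 e2 f2 where a2: "flag_adj P 1 (base_vertex, base_edge, f') = (base_vertex, e2, f')"
    "flag_adj P 0 (base_vertex, base_edge, f') = (v2, base_edge, f')"
    using flag_adj_forms[OF fl(2)] by metis
  have "flag_map x \<Phi> = (v1, e', base_face)" unfolding rot_flag b(2) a1 ..
  then show "x base_face = base_face" by (subst (asm) base_eq) (simp add: flag_map_simp)
  have y: "flag_map y \<Phi> = (base_vertex, e2, f')" unfolding rot_flag b(3) a2 ..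
  then show "y base_vertex = base_vertex" by (subst (asm) base_eq) (simp add: flag_map_simp)
  have "y base_face = f'" using y by (subst (asm) base_eq) (simp add: flag_map_simp)
  then show "flag_adj P 2 \<Phi> = (base_vertex, base_edge, y base_face)" using b by simp
  have "flag_map (x \<otimes>\<^bsub>G\<^esub> y) \<Phi> = (v2, base_edge, f')" using base_adj(3) b a2 by simp
  then show "(x \<otimes>\<^bsub>G\<^esub> y) base_edge = base_edge" by (subst (asm) base_eq) (simp add: flag_map_simp)
qed

lemma generate_subgroup: "subgroup (generate G {x}) G" "subgroup (generate G {y}) G"
  using G.generate_is_subgroup[of "{x}"] G.generate_is_subgroup[of "{y}"] rot_in by auto

text \<open>The flags at the base vertex form two orbits of the group generated by \<open>y\<close>.
  An element fixing the vertex therefore acts on the base flag like a power of \<open>y\<close>,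
  unless it takes it into the orbit of the 2-adjacent flag, which chirality forbids.\<close>

lemma stab_vertex:
  assumes "g \<in> carrier G"
  shows "g base_vertex = base_vertex \<longleftrightarrow> g \<in> generate G {y}"
proof
  assume "g \<in> generate G {y}"
  then show "g base_vertex = base_vertex"
    using generate_fixes[OF base_elts(1) rot_in(2) y_vertex] by blast
next
  assume g: "g base_vertex = base_vertex"
  let ?H = "generate G {y}" and ?\<Psi> = "flag_adj P 2 \<Phi>"
  let ?S = "(\<lambda>u. flag_map u \<Phi>) ` ?H \<union> (\<lambda>u. flag_map u ?\<Psi>) ` ?H"
  have H: "\<one>\<^bsub>G\<^esub> \<in> ?H" "y \<in> ?H" "inv\<^bsub>G\<^esub> y \<in> ?H" by (blast intro: generate.intros)+
  have one: "flag_map \<one>\<^bsub>G\<^esub> \<Phi> = \<Phi>" "flag_map \<one>\<^bsub>G\<^esub> ?\<Psi> = ?\<Psi>"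
    using flag_map_one base_flag adj_flag by simp_all
  have cl: "adj_closed {1, 2} ?S"
  proof (rule orbit_closed[OF generate_subgroup(2) _ adj_flag(3)[OF base_flag]])
    fix i :: nat assume "i \<in> {1, 2}"
    then consider "i = 1" | "i = 2" by blast
    then show "\<exists>u\<in>?H. flag_adj P i \<Phi> = flag_map u ?\<Psi>" "\<exists>u\<in>?H. flag_adj P i ?\<Psi> = flag_map u \<Phi>"
      using base_adj(1) rot_flag(2) one adj_invol(3)[OF base_flag] H by metis+
  qed simp
  have mem: "(base_vertex, base_edge, base_face) \<in> ?S" using H(1) one(1) base_eq
    by (metis UnI1 imageI)
  have fl: "(base_vertex, g base_edge, g base_face) \<in> flags P"
    using aut_flag[OF rot_group_aut[OF assms] base_flag'] by (simp add: flag_map_simp g)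
  have "flag_map g \<Phi> \<in> ?S"
    using vertex_star_connected[OF cl mem base_flag' fl] by (simp only: flag_map_base g)
  then obtain u where u: "u \<in> ?H" "flag_map g \<Phi> = flag_map u \<Phi> \<or> flag_map g \<Phi> = flag_map u ?\<Psi>"
    by blast
  then have "u \<in> carrier G" using subgroup.subset[OF generate_subgroup(2)] by blast
  then show "g \<in> ?H" using u flag_map_unique[OF assms] not_translate_adj[OF assms _ i012(3)]
    by metis
qed

lemma stab_face:
  assumes "g \<in> carrier G"
  shows "g base_face = base_face \<longleftrightarrow> g \<in> generate G {x}"
proof
  assume "g \<in> generate G {x}"
  then show "g base_face = base_face"
    using generate_fixes[OF base_elts(3) rot_in(1) x_face] by blast
next
  assume g: "g base_face = base_face"
  let ?H = "generate G {x}" and ?\<Psi> = "flag_adj P 1 \<Phi>"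
  let ?S = "(\<lambda>u. flag_map u \<Phi>) ` ?H \<union> (\<lambda>u. flag_map u ?\<Psi>) ` ?H"
  have H: "\<one>\<^bsub>G\<^esub> \<in> ?H" "x \<in> ?H" "inv\<^bsub>G\<^esub> x \<in> ?H" by (blast intro: generate.intros)+
  have one: "flag_map \<one>\<^bsub>G\<^esub> \<Phi> = \<Phi>" "flag_map \<one>\<^bsub>G\<^esub> ?\<Psi> = ?\<Psi>"
    using flag_map_one base_flag adj_flag by simp_all
  have cl: "adj_closed {0, 1} ?S"
  proof (rule orbit_closed[OF generate_subgroup(1) _ adj_flag(2)[OF base_flag]])
    fix i :: nat assume "i \<in> {0, 1}"
    then consider "i = 0" | "i = 1" by blast
    then show "\<exists>u\<in>?H. flag_adj P i \<Phi> = flag_map u ?\<Psi>" "\<exists>u\<in>?H. flag_adj P i ?\<Psi> = flag_map u \<Phi>"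
      using base_adj(2) rot_flag(1) one adj_invol(2)[OF base_flag] H by metis+
  qed simp
  have mem: "(base_vertex, base_edge, base_face) \<in> ?S" using H(1) one(1) base_eq
    by (metis UnI1 imageI)
  have fl: "(g base_vertex, g base_edge, base_face) \<in> flags P"
    using aut_flag[OF rot_group_aut[OF assms] base_flag'] by (simp add: flag_map_simp g)
  have "flag_map g \<Phi> \<in> ?S"
    using face_star_connected[OF cl mem base_flag' fl] by (simp only: flag_map_base g)
  then obtain u where u: "u \<in> ?H" "flag_map g \<Phi> = flag_map u \<Phi> \<or> flag_map g \<Phi> = flag_map u ?\<Psi>"
    by blast
  then have "u \<in> carrier G" using subgroup.subset[OF generate_subgroup(1)] by blast
  then show "g \<in> ?H" using u flag_map_unique[OF assms] not_translate_adj[OF assms _ i012(2)]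
    by metis
qed

lemma stab_edge:
  assumes "g \<in> carrier G"
  shows "g base_edge = base_edge \<longleftrightarrow> g = \<one>\<^bsub>G\<^esub> \<or> g = x \<otimes>\<^bsub>G\<^esub> y"
proof
  assume "g = \<one>\<^bsub>G\<^esub> \<or> g = x \<otimes>\<^bsub>G\<^esub> y"
  then show "g base_edge = base_edge" using apply_one[OF base_elts(2)] xy_edge by metis
next
  assume g: "g base_edge = base_edge"
  \<comment> \<open>The four flags at the base edge. The first and the last are the images of \<Phi>
    under \<open>\<one>\<close> and \<open>x y\<close>; reaching either of the others would take a
    reflection.\<close>
  let ?S = "{\<Phi>, flag_adj P 0 \<Phi>, flag_adj P 2 \<Phi>, flag_adj P 0 (flag_adj P 2 \<Phi>)}"
  have cl: "adj_closed {0, 2} ?S"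
    unfolding adj_closed_def
    using adj_0_2_commute[OF base_flag] adj_invol[OF base_flag] adj_invol[OF adj_flag(1)[OF base_flag]]
      adj_invol[OF adj_flag(3)[OF base_flag]] by auto
  have mem: "(base_vertex, base_edge, base_face) \<in> ?S" using base_eq by simp
  have fl: "(g base_vertex, base_edge, g base_face) \<in> flags P"
    using aut_flag[OF rot_group_aut[OF assms] base_flag'] by (simp add: flag_map_simp g)
  have S: "flag_map g \<Phi> \<in> ?S"
    using edge_star_connected[OF cl mem base_flag' fl] by (simp only: flag_map_base g)
  have "flag_map g \<Phi> \<noteq> flag_adj P 0 \<Phi>" "flag_map g \<Phi> \<noteq> flag_adj P 2 \<Phi>"
    using no_reflection[OF rot_group_aut[OF assms]] i012 by blast+
  then have "flag_map g \<Phi> = \<Phi> \<or> flag_map g \<Phi> = flag_map (x \<otimes>\<^bsub>G\<^esub> y) \<Phi>"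
    using S base_adj(3) by auto
  moreover have "flag_map \<one>\<^bsub>G\<^esub> \<Phi> = \<Phi>" using flag_map_one base_flag by simp
  ultimately show "g = \<one>\<^bsub>G\<^esub> \<or> g = x \<otimes>\<^bsub>G\<^esub> y"
    using flag_map_unique[OF assms] G.one_closed G.m_closed rot_in by metis
qed

lemma flag_cases:
  assumes "\<Psi> \<in> flags P"
  obtains g where "g \<in> carrier G" "\<Psi> = flag_map g \<Phi>"
  | g where "g \<in> carrier G" "\<Psi> = flag_map g (flag_adj P 2 \<Phi>)"
proof -
  let ?H = "carrier G" and ?\<Psi> = "flag_adj P 2 \<Phi>"
  let ?S = "(\<lambda>u. flag_map u \<Phi>) ` ?H \<union> (\<lambda>u. flag_map u ?\<Psi>) ` ?H"
  have H: "\<one>\<^bsub>G\<^esub> \<in> ?H" "y \<in> ?H" "inv\<^bsub>G\<^esub> y \<in> ?H" "inv\<^bsub>G\<^esub> x \<in> ?H" "x \<otimes>\<^bsub>G\<^esub> y \<in> ?H"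
    "inv\<^bsub>G\<^esub> y \<otimes>\<^bsub>G\<^esub> inv\<^bsub>G\<^esub> x \<in> ?H"
    using G.one_closed G.m_closed G.inv_closed rot_in by blast+
  have one: "flag_map \<one>\<^bsub>G\<^esub> \<Phi> = \<Phi>" "flag_map \<one>\<^bsub>G\<^esub> ?\<Psi> = ?\<Psi>"
    using flag_map_one base_flag adj_flag by simp_all
  have adj0: "flag_adj P 0 \<Phi> = flag_map (inv\<^bsub>G\<^esub> y \<otimes>\<^bsub>G\<^esub> inv\<^bsub>G\<^esub> x) ?\<Psi>"
    unfolding flag_map_G[OF H(3) adj_flag(3)[OF base_flag]] base_adj(1)[symmetric]
    by (rule base_adj(2))
  have "adj_closed {0, 1, 2} ?S"
  proof (rule orbit_closed[OF G.subgroup_self _ adj_flag(3)[OF base_flag]])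
    fix i :: nat assume "i \<in> {0, 1, 2}"
    then consider "i = 0" | "i = 1" | "i = 2" by blast
    then show "\<exists>u\<in>?H. flag_adj P i \<Phi> = flag_map u ?\<Psi>" "\<exists>u\<in>?H. flag_adj P i ?\<Psi> = flag_map u \<Phi>"
      using base_adj(1,3) adj0 rot_flag(2) one adj_invol(3)[OF base_flag] H by metis+
  qed simp
  moreover have "\<Phi> \<in> ?S" using H(1) one(1) by (metis UnI1 imageI)
  ultimately have "\<Psi> \<in> ?S" using flags_connected base_flag assms by blast
  then show ?thesis using that by blast
qed

section \<open>The given polyhedron as a coset geometry\<close>

abbreviation "vert g \<equiv> g base_vertex"
abbreviation "edge g \<equiv> g base_edge"
abbreviation "face g \<equiv> g base_face"

lemma flag_normal_form:
  assumes "(v, e, f) \<in> flags P"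
  obtains g where "g \<in> carrier G" "v = vert g" "e = edge g" "f = face g \<or> f = face (y \<otimes>\<^bsub>G\<^esub> g)"
  using assms
proof (cases rule: flag_cases)
  case (1 g)
  then show ?thesis using that[of g] by (subst (asm) base_eq) (simp add: flag_map_simp)
next
  case (2 g)
  then have "(v, e, f) = (vert g, edge g, g (y base_face))"
    unfolding adj2_form by (simp add: flag_map_simp)
  then show ?thesis using that[of g] 2 apply_mult[OF rot_in(2) base_elts(3)] by simp
qed

lemma translate_flag: "g \<in> carrier G \<Longrightarrow> (vert g, edge g, face g) \<in> flags P"
  using aut_flag[OF rot_group_aut base_flag'] by (simp add: flag_map_simp)

lemma vert_y: "g \<in> carrier G \<Longrightarrow> vert (y \<otimes>\<^bsub>G\<^esub> g) = vert g"
  using apply_mult[OF rot_in(2) base_elts(1)] y_vertex by simp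

lemma face_x: "g \<in> carrier G \<Longrightarrow> face (x \<otimes>\<^bsub>G\<^esub> g) = face g"
  using apply_mult[OF rot_in(1) base_elts(3)] x_face by simp

lemma edge_xy: "g \<in> carrier G \<Longrightarrow> edge (x \<otimes>\<^bsub>G\<^esub> (y \<otimes>\<^bsub>G\<^esub> g)) = edge g"
  using apply_mult[OF G.m_closed[OF rot_in] base_elts(2)] xy_edge G.m_assoc[OF rot_in] by metis

lemma leq_rel_eq: "leq_rel P = Id_on (elts P) \<union> (\<lambda>g. (vert g, edge g)) ` carrier G
      \<union> (\<lambda>g. (edge g, face g)) ` carrier G \<union> (\<lambda>g. (vert g, face g)) ` carrier G" (is "_ = ?R")
proof
  show "?R \<subseteq> leq_rel P" using flagD(10-12)[OF translate_flag] leq_refl by auto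
  show "leq_rel P \<subseteq> ?R"
  proof (rule subrelI)
    fix a b assume ab: "(a, b) \<in> leq_rel P"
    show "(a, b) \<in> ?R"
    proof (cases "a = b")
      case True
      then show ?thesis using leq_elts[OF ab] by auto
    next
      case False
      have rk: "rk P a < rk P b" using leq_rank[OF ab False] .
      then have "(a, b) \<in> incidence P" using incidence_iff_leq ab by blast
      then obtain v e f where fl: "(v, e, f) \<in> flags P" "a \<in> {v, e, f}" "b \<in> {v, e, f}"
        by (rule incident_in_flag)
      then obtain g where g: "g \<in> carrier G" "v = vert g" "e = edge g" "f = face g \<or> f = face (y \<otimes>\<^bsub>G\<^esub> g)"
        by (auto elim: flag_normal_form)
      have "(a, b) = (v, e) \<or> (a, b) = (e, f) \<or> (a, b) = (v, f)"
        using fl rk flagD(13-15)[OF fl(1)] by auto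
      then consider "(a, b) = (vert g, edge g)" | "(a, b) = (edge g, face g)" | "(a, b) = (vert g, face g)"
        | "(a, b) = (edge g, face (y \<otimes>\<^bsub>G\<^esub> g))" | "(a, b) = (vert g, face (y \<otimes>\<^bsub>G\<^esub> g))"
        using g(2-4) by blast
      moreover have "(vert g, face (y \<otimes>\<^bsub>G\<^esub> g)) \<in> ?R"
        using vert_y[OF g(1)] G.m_closed[OF rot_in(2) g(1)]
        by (metis (no_types, lifting) UnI2 image_eqI)
      moreover have "(edge g, face (y \<otimes>\<^bsub>G\<^esub> g)) \<in> ?R"
      proof -
        \<comment> \<open>\<open>x y g\<close> has the edge of \<open>g\<close> and the face of
          \<open>y g\<close>, so this single group element represents the pair.\<close>
        let ?k = "x \<otimes>\<^bsub>G\<^esub> (y \<otimes>\<^bsub>G\<^esub> g)"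
        have "?k \<in> carrier G" "edge ?k = edge g" "face ?k = face (y \<otimes>\<^bsub>G\<^esub> g)"
          using edge_xy face_x g(1) G.m_closed rot_in by blast+
        then show ?thesis by (metis (no_types, lifting) UnI1 UnI2 image_eqI)
      qed
      moreover have "(vert g, edge g) \<in> ?R" "(edge g, face g) \<in> ?R" "(vert g, face g) \<in> ?R"
        using g(1) by blast+
      ultimately show ?thesis by cases (simp_all only:)
    qed
  qed
qed

lemma elts_eq_orbits: "elts P = vert ` carrier G \<union> edge ` carrier G \<union> face ` carrier G"
proof
  show "vert ` carrier G \<union> edge ` carrier G \<union> face ` carrier G \<subseteq> elts P"
    using flagD(4-6)[OF translate_flag] by blast
  show "elts P \<subseteq> vert ` carrier G \<union> edge ` carrier G \<union> face ` carrier G"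
  proof
    fix a assume "a \<in> elts P"
    then obtain v e f where "(v, e, f) \<in> flags P" "a \<in> {v, e, f}" by (rule elt_in_flag)
    then obtain g where "g \<in> carrier G" "a \<in> {vert g, edge g, face g, face (y \<otimes>\<^bsub>G\<^esub> g)}"
      by (metis flag_normal_form insert_iff)
    moreover from this have "y \<otimes>\<^bsub>G\<^esub> g \<in> carrier G" using rot_in G.m_closed by blast
    ultimately show "a \<in> vert ` carrier G \<union> edge ` carrier G \<union> face ` carrier G" by blast
  qed
qed

text \<open>Orbits replace elements and stabilisers replace cosets: the three stabiliser lemmas turn
  equality of images of a base element into equality of right cosets.\<close>

sublocale geometry: coset_geometry G x y P vert edge face
proof
  obtain v' e' f' where b: "flag_adj P 0 \<Phi> = (v', base_edge, base_face)" "v' \<noteq> base_vertex"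
    "flag_adj P 1 \<Phi> = (base_vertex, e', base_face)" "e' \<noteq> base_edge"
    "flag_adj P 2 \<Phi> = (base_vertex, base_edge, f')" "f' \<noteq> base_face"
    by (rule base_forms)
  have one: "flag_map \<one>\<^bsub>G\<^esub> \<Phi> = \<Phi>" using flag_map_one base_flag by simp
  show "x \<noteq> \<one>\<^bsub>G\<^esub>"
  proof
    assume "x = \<one>\<^bsub>G\<^esub>"
    then have "flag_adj P 0 \<Phi> = flag_adj P 1 \<Phi>"
      using rot_flag(1) one adj_invol(1)[OF adj_flag(2)[OF base_flag]] by metis
    then show False using b by simp
  qed
  show "y \<noteq> \<one>\<^bsub>G\<^esub>"
  proof
    assume "y = \<one>\<^bsub>G\<^esub>"
    then have "flag_adj P 1 \<Phi> = flag_adj P 2 \<Phi>"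
      using rot_flag(2) one adj_invol(2)[OF adj_flag(3)[OF base_flag]] by metis
    then show False using b by simp
  qed
  \<comment> \<open>An element of both stabilisers can change only the edge of the base flag. It
    takes that flag to itself or to the 1-adjacent flag, and the second would be a
    reflection.\<close>
  show "generate G {x} \<inter> generate G {y} = {\<one>\<^bsub>G\<^esub>}"
  proof
    show "{\<one>\<^bsub>G\<^esub>} \<subseteq> generate G {x} \<inter> generate G {y}" using generate.one by blast
    show "generate G {x} \<inter> generate G {y} \<subseteq> {\<one>\<^bsub>G\<^esub>}"
    proof
      fix g assume g: "g \<in> generate G {x} \<inter> generate G {y}"
      then have c: "g \<in> carrier G" using subgroup.subset[OF generate_subgroup(1)] by blast
      have fixed: "vert g = base_vertex" "face g = base_face" using stab_vertex stab_face c g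
        by blast+
      have "flag_map g \<Phi> = (base_vertex, edge g, base_face)"
        by (subst base_eq) (simp add: flag_map_simp fixed)
      then have "flag_map g \<Phi> = \<Phi> \<or> flag_map g \<Phi> = flag_adj P 1 \<Phi>"
        using same_or_adj(2)[OF base_flag', of "edge g"] translate_flag[OF c] fixed base_eq by metis
      then have "flag_map g \<Phi> = flag_map \<one>\<^bsub>G\<^esub> \<Phi>"
        using no_reflection[OF rot_group_aut[OF c] _ i012(2)] one by metis
      then show "g \<in> {\<one>\<^bsub>G\<^esub>}" using flag_map_unique c G.one_closed by blast
    qed
  qed
  fix g assume g: "g \<in> carrier G"
  show "rk P (vert g) = 0" "rk P (edge g) = 1" "rk P (face g) = 2"
    using flagD(13-15)[OF translate_flag[OF g]] by auto
  fix h assume h: "h \<in> carrier G"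
  have gh: "g \<otimes>\<^bsub>G\<^esub> inv\<^bsub>G\<^esub> h \<in> carrier G" using g h G.m_closed G.inv_closed by blast
  show "vert g = vert h \<longleftrightarrow> g \<otimes>\<^bsub>G\<^esub> inv\<^bsub>G\<^esub> h \<in> generate G {y}"
    using apply_eq_iff[OF g h base_elts(1)] stab_vertex[OF gh] by blast
  show "face g = face h \<longleftrightarrow> g \<otimes>\<^bsub>G\<^esub> inv\<^bsub>G\<^esub> h \<in> generate G {x}"
    using apply_eq_iff[OF g h base_elts(3)] stab_face[OF gh] by blast
  have "g = h \<longleftrightarrow> g \<otimes>\<^bsub>G\<^esub> inv\<^bsub>G\<^esub> h = \<one>\<^bsub>G\<^esub>"
    "g = x \<otimes>\<^bsub>G\<^esub> (y \<otimes>\<^bsub>G\<^esub> h) \<longleftrightarrow> g \<otimes>\<^bsub>G\<^esub> inv\<^bsub>G\<^esub> h = x \<otimes>\<^bsub>G\<^esub> y"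
    using g h rot_in G.m_assoc[OF rot_in h] G.inv_solve_right'[of "x \<otimes>\<^bsub>G\<^esub> y" g h]
      G.inv_solve_right'[of "\<one>\<^bsub>G\<^esub>" g h] G.m_closed G.one_closed G.l_one[OF h] by metis+
  then show "edge g = edge h \<longleftrightarrow> g = h \<or> g = x \<otimes>\<^bsub>G\<^esub> (y \<otimes>\<^bsub>G\<^esub> h)"
    using apply_eq_iff[OF g h base_elts(2)] stab_edge[OF gh] by blast
qed (fact elts_eq_orbits leq_rel_eq)+

lemma base_flag_eq: "geometry.even_flag \<one>\<^bsub>G\<^esub> = \<Phi>"
  using base_elts base_eq apply_one by (simp add: geometry.even_flag_def)

lemma not_reflexible: "\<not> G.reflexible"
proof
  assume "G.reflexible"
  then obtain \<gamma> where "\<gamma> \<in> auts P" "flag_map \<gamma> \<Phi> = flag_adj P 1 \<Phi>"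
    using geometry.reflexible_imp_reflection base_flag_eq by metis
  then show False using no_reflection i012 by blast
qed

text \<open>There are twice as many flags as group elements, so tightness fixes the order of G; the
  counts of edges at a face and at a vertex are the orders of \<open>x\<close> and
  \<open>y\<close>.\<close>

lemma tight_orders:
  assumes "tight_polyhedron P p q"
  shows "finite (carrier G)" "card (carrier G) = p * q" "G.ord x = p" "G.ord y = q"
proof -
  have fin: "finite (flags P)" and card: "card (flags P) = 2 * p * q"
    using assms by (auto simp: tight_polyhedron_def)
  have "finite (geometry.even_flag ` carrier G)"
    using fin geometry.flags_eq by (metis finite_Un)
  then show f: "finite (carrier G)" using finite_imageD geometry.even_flag_inj by blast
  show "card (carrier G) = p * q" using geometry.card_flags[OF f] card by simp
  have "has_type P p q" using assms by (simp add: tight_polyhedron_def)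
  then show "G.ord x = p" "G.ord y = q"
    using geometry.card_face_edges[OF G.one_closed] geometry.card_vertex_edges[OF G.one_closed]
      flagD(1-3)[OF translate_flag[OF G.one_closed]]
    unfolding has_type_def by (simp_all del: rot_group_one)
qed

end

section \<open>Homomorphisms from presented groups\<close>

definition eval_word :: "('h, 'm) monoid_scheme \<Rightarrow> ('g \<Rightarrow> 'h) \<Rightarrow> 'g word \<Rightarrow> 'h" where
  "eval_word H f w = foldr (\<lambda>(b, g) a. (if b then inv\<^bsub>H\<^esub> (f g) else f g) \<otimes>\<^bsub>H\<^esub> a) w \<one>\<^bsub>H\<^esub>"

context group
begin

context
  fixes f :: "'g \<Rightarrow> 'a"
  assumes f_closed: "range f \<subseteq> carrier G"
begin

lemma f_closed' [simp]: "f g \<in> carrier G" using f_closed by auto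

lemma eval_word_closed [simp]: "eval_word G f w \<in> carrier G"
  by (induction w) (auto simp: eval_word_def)

lemma eval_word_Cons:
  "eval_word G f ((b, g) # w) = (if b then inv (f g) else f g) \<otimes> eval_word G f w"
  by (simp add: eval_word_def)

lemma eval_word_append: "eval_word G f (u @ v) = eval_word G f u \<otimes> eval_word G f v"
proof (induction u)
  case Nil
  then show ?case using eval_word_closed[of v] by (simp add: eval_word_def)
next
  case (Cons l u)
  then show ?case
    using eval_word_closed[of u] eval_word_closed[of v] f_closed
    by (cases l) (simp add: eval_word_Cons m_assoc)
qed

lemma eval_word_gpow: "eval_word G f (gpow g n) = f g [^] n"
proof -
  have rep: "eval_word G f (replicate k (b, g)) = (if b then inv (f g) else f g) [^] k" for k b
  proof (induction k)
    case (Suc k)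
    let ?c = "if b then inv (f g) else f g"
    have "eval_word G f (replicate (Suc k) (b, g)) = ?c \<otimes> ?c [^] k" using Suc
      by (simp add: eval_word_Cons)
    also have "\<dots> = ?c [^] Suc k" by (rule nat_pow_Suc2[symmetric]) simp
    finally show ?case .
  qed (simp add: eval_word_def)
  show ?thesis
  proof (cases "n < 0")
    case True
    then have "gpow g n = replicate (nat (- n)) (True, g)" by (simp add: gpow_def)
    moreover have "f g [^] n = inv (f g [^] nat (- n))" using True
      by (simp only: int_pow_def2 if_True)
    ultimately show ?thesis using rep[of "nat (- n)" True]
      by (simp only: if_True nat_pow_inv[OF f_closed'])
  next
    case False
    then have "gpow g n = replicate (nat n) (False, g)" by (simp add: gpow_def)
    moreover have "f g [^] n = f g [^] nat n" using False by (simp only: int_pow_def2 if_False)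
    ultimately show ?thesis using rep[of "nat n" False] by (simp only: if_False)
  qed
qed

lemma eval_word_pres_eq:
  assumes "pres_eq R u v" "\<And>u v. (u, v) \<in> R \<Longrightarrow> eval_word G f u = eval_word G f v"
  shows "eval_word G f u = eval_word G f v"
  using assms(1)
proof (induction rule: pres_eq.induct)
  case (cancel b g)
  then show ?case by (simp add: eval_word_def)
qed (auto simp: eval_word_append assms(2))

text \<open>Von Dyck's theorem. A class is evaluated at a chosen member, which is harmless because
  \<open>pres_eq\<close> preserves the value once the relations do.\<close>

lemma presented_group_hom:
  assumes "\<And>u v. (u, v) \<in> R \<Longrightarrow> eval_word G f u = eval_word G f v"
  obtains h where "h \<in> hom (presented_group R) G" "\<And>w. h (word_class R w) = eval_word G f w"
proof -
  let ?h = "\<lambda>C. eval_word G f (SOME w. w \<in> C)"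
  have h: "?h (word_class R w) = eval_word G f w" for w
  proof -
    have "w \<in> word_class R w" by (simp add: word_class_def pres_eq.refl)
    then have "(SOME v. v \<in> word_class R w) \<in> word_class R w" by (rule someI)
    then have "pres_eq R w (SOME v. v \<in> word_class R w)" by (simp add: word_class_def)
    from eval_word_pres_eq[OF this assms] show ?thesis by simp
  qed
  have "?h \<in> hom (presented_group R) G"
  proof (rule homI)
    fix C D assume "C \<in> carrier (presented_group R)" "D \<in> carrier (presented_group R)"
    then obtain u v where "C = word_class R u" "D = word_class R v"
      by (auto simp: presented_group_def)
    then show "?h (C \<otimes>\<^bsub>presented_group R\<^esub> D) = ?h C \<otimes> ?h D"
      by (simp add: presented_group_mult h eval_word_append)
  qed simp
  then show ?thesis using that h by blast
qed

end

end

text \<open>With this, statements about words, such as the defining relations, become statements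
  about products of the generators of the presented group.\<close>

lemma word_class_eval:
  "word_class R w = eval_word (presented_group R) (\<lambda>g. word_class R (gpow g 1)) w"
proof (induction w)
  case Nil
  then show ?case by (simp add: eval_word_def presented_group_def)
next
  case (Cons l w)
  interpret K: group "presented_group R" by (rule group_presented_group)
  obtain b g where l: "l = (b, g)" by (cases l)
  have c: "word_class R u \<in> carrier (presented_group R)" for u by (simp add: presented_group_def)
  have "word_class R [(True, g)] \<otimes>\<^bsub>presented_group R\<^esub> word_class R [(False, g)] = \<one>\<^bsub>presented_group R\<^esub>"
    using pres_eq.cancel[of R True g]
    by (simp add: presented_group_mult) (simp add: presented_group_def word_class_eq_iff)
  then have "inv\<^bsub>presented_group R\<^esub> word_class R [(False, g)] = word_class R [(True, g)]"
    using K.inv_equality c by blast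
  then have "eval_word (presented_group R) (\<lambda>g. word_class R (gpow g 1)) (l # w)
      = word_class R [l] \<otimes>\<^bsub>presented_group R\<^esub> word_class R w"
    using Cons by (simp add: l eval_word_def gpow_def)
  then show ?case by (simp add: presented_group_mult)
qed

lemma presented_group_generate:
  "carrier (presented_group R) = generate (presented_group R) (range (\<lambda>g. word_class R (gpow g 1)))"
proof
  interpret K: group "presented_group R" by (rule group_presented_group)
  let ?f = "\<lambda>g. word_class R (gpow g 1)"
  show "generate (presented_group R) (range ?f) \<subseteq> carrier (presented_group R)"
    by (rule K.generate_incl) (auto simp: presented_group_def)
  have "eval_word (presented_group R) ?f w \<in> generate (presented_group R) (range ?f)" for w
  proof (induction w)
    case (Cons l w)
    obtain b g where l: "l = (b, g)" by (cases l)
    have "(if b then inv\<^bsub>presented_group R\<^esub> ?f g else ?f g) \<in> generate (presented_group R) (range ?f)"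
      by (auto intro: generate.incl generate.inv)
    from generate.eng[OF this Cons.IH] show ?case by (simp add: eval_word_def l)
  qed (auto simp: eval_word_def intro: generate.one)
  then have gen: "word_class R w \<in> generate (presented_group R) (range ?f)" for w
    by (simp only: word_class_eval[symmetric])
  have "carrier (presented_group R) = range (word_class R)" by (simp add: presented_group_def)
  then show "carrier (presented_group R) \<subseteq> generate (presented_group R) (range ?f)"
    using image_subsetI[OF gen] by (simp only:)
qed

section \<open>Factorisation into two cyclic subgroups\<close>

context group
begin

lemma conj_generate:
  assumes S: "S \<subseteq> carrier G" and H: "subgroup H G" and g: "g \<in> carrier G"
    and conj: "\<And>s. s \<in> S \<Longrightarrow> g \<otimes> s \<otimes> inv g \<in> H" and u: "u \<in> generate G S"
  shows "g \<otimes> u \<otimes> inv g \<in> H"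
proof -
  have conj_mult: "g \<otimes> (s \<otimes> t) \<otimes> inv g = g \<otimes> s \<otimes> inv g \<otimes> (g \<otimes> t \<otimes> inv g)"
    if "s \<in> carrier G" "t \<in> carrier G" for s t
    using that g by (simp add: m_assoc inv_cancel_left)
  have inv: "g \<otimes> inv s \<otimes> inv g = inv (g \<otimes> s \<otimes> inv g)" if "s \<in> carrier G" for s
    using that g by (simp add: inv_mult_group m_assoc)
  from u S show ?thesis
  proof (induction rule: generate_left_induct)
    case one
    then show ?case using g subgroup.one_closed[OF H] by simp
  next
    case (mult h t)
    then have "h \<in> carrier G" "t \<in> carrier G" using S generate_in_carrier[OF S] by auto
    then show ?case using mult conj subgroup.m_closed[OF H] conj_mult by simp
  next
    case (inv_mult h t)
    then have "h \<in> carrier G" "t \<in> carrier G" using S generate_in_carrier[OF S] by auto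
    then show ?case
      using inv_mult conj subgroup.m_closed[OF H] subgroup.m_inv_closed[OF H] conj_mult inv by simp
  qed
qed

end

context rotation_pair
begin

text \<open>The inverse generators are included because in an infinite group conjugation can map a
  subgroup properly into itself.\<close>

lemma normal_generateI_gens:
  assumes S: "S \<subseteq> carrier G"
    and conj: "\<And>a s. a \<in> {x, y, inv x, inv y} \<Longrightarrow> s \<in> S \<Longrightarrow> a \<otimes> s \<otimes> inv a \<in> generate G S"
  shows "generate G S \<lhd> G"
proof -
  note H = generate_is_subgroup[OF S]
  have step: "a \<otimes> h \<otimes> inv a \<in> generate G S"
    if "a \<in> {x, y, inv x, inv y}" "h \<in> generate G S" for a h
    using conj_generate[OF S H _ _ that(2), of a] conj[OF that(1)] that(1) by auto
  have step_mult: "\<forall>h \<in> generate G S. a \<otimes> g \<otimes> h \<otimes> inv (a \<otimes> g) \<in> generate G S"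
    if "a \<in> {x, y, inv x, inv y}" "g \<in> carrier G" "\<forall>h \<in> generate G S. g \<otimes> h \<otimes> inv g \<in> generate G S" for a g
  proof
    fix h assume h: "h \<in> generate G S"
    have "a \<otimes> g \<otimes> h \<otimes> inv (a \<otimes> g) = a \<otimes> (g \<otimes> h \<otimes> inv g) \<otimes> inv a"
      using that(1,2) generate_in_carrier[OF S h] by (auto simp: inv_mult_group m_assoc)
    then show "a \<otimes> g \<otimes> h \<otimes> inv (a \<otimes> g) \<in> generate G S" using step that h by simp
  qed
  have "\<forall>h \<in> generate G S. g \<otimes> h \<otimes> inv g \<in> generate G S" if "g \<in> carrier G" for g
    using that
  proof (induction rule: carrier_induct)
    case one
    then show ?case using generate_in_carrier[OF S] by simp
  qed (rule step_mult; simp)+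
  then show ?thesis using normal_invI[OF H] by blast
qed

text \<open>Modulo \<open>\<langle>y\<^sup>l\<rangle>\<close>, which is normal, conjugation by \<open>y\<close> swaps \<open>x\<^sup>2\<close> and \<open>x\<^sup>i\<^sup>-\<^sup>1\<close>.  Hence \<open>y\<close>
  normalises \<open>U = \<langle>x\<^sup>2, x\<^sup>i\<^sup>-\<^sup>1, y\<^sup>l\<rangle>\<close>, and \<open>U\<langle>y\<rangle> \<union> x U\<langle>y\<rangle>\<close> is closed under left multiplication
    by \<open>x\<close> and \<open>y\<close>.\<close>

lemma cyclic_factorisation:
  fixes i l a :: int
  assumes rel1: "inv y \<otimes> x = x [^] i \<otimes> y [^] (1 + l)"
    and rel2: "y \<otimes> inv x = x [^] (- i) \<otimes> y [^] (- 1 - a * l)"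
    and g: "g \<in> carrier G"
  shows "\<exists>(m :: int) (n :: int). g = x [^] m \<otimes> y [^] n"
proof -
  define w where "w = y [^] l"
  define A where "A = x [^] i"
  define B where "B = w [^] a"
  have cl [simp]: "w \<in> carrier G" "A \<in> carrier G" "B \<in> carrier G"
    by (simp_all add: w_def A_def B_def)
  have comm_w: "y \<otimes> w = w \<otimes> y" "y \<otimes> B = B \<otimes> y"
    using int_pow_mult[OF y_closed, of 1] int_pow_mult[OF y_closed, of _ 1]
    by (simp_all add: w_def B_def int_pow_pow add.commute)
  have comm_A: "x \<otimes> A = A \<otimes> x"
    using int_pow_mult[OF x_closed, of 1 i] int_pow_mult[OF x_closed, of i 1]
    by (simp add: A_def add.commute)
  have comm_w': "g \<in> carrier G \<Longrightarrow> y \<otimes> (w \<otimes> g) = w \<otimes> (y \<otimes> g)"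
    "g \<in> carrier G \<Longrightarrow> y \<otimes> (B \<otimes> g) = B \<otimes> (y \<otimes> g)" for g
    using comm_w by (simp_all flip: m_assoc)
  have comm_i: "inv y \<otimes> w = w \<otimes> inv y" "inv y \<otimes> B = B \<otimes> inv y" "inv x \<otimes> A = A \<otimes> inv x"
    using comm_w comm_A
    by (metis cl inv_closed inv_solve_left inv_solve_right m_assoc m_closed x_closed y_closed)+
  have comm_i': "g \<in> carrier G \<Longrightarrow> inv y \<otimes> (w \<otimes> g) = w \<otimes> (inv y \<otimes> g)"
    "g \<in> carrier G \<Longrightarrow> inv y \<otimes> (B \<otimes> g) = B \<otimes> (inv y \<otimes> g)"
    "g \<in> carrier G \<Longrightarrow> inv x \<otimes> (A \<otimes> g) = A \<otimes> (inv x \<otimes> g)" for g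
    using comm_i by (simp_all flip: m_assoc)
  note comm = comm_w comm_w' comm_i comm_i'
  have r1: "inv y \<otimes> x = A \<otimes> (w \<otimes> y)"
    using rel1 by (simp add: A_def w_def int_pow_mult comm_w(1)[unfolded w_def])
  have "y [^] (- 1 - a * l) = inv y \<otimes> inv B"
    by (simp add: int_pow_diff int_pow_neg B_def w_def int_pow_pow mult.commute)
  then have r2: "y \<otimes> inv x = inv A \<otimes> (inv y \<otimes> inv B)" using rel2 by (simp add: A_def int_pow_neg)
  \<comment> \<open>The inverse of \<open>rel1\<close> and \<open>rel2\<close> give two expressions
    for \<open>A^-1\<close>. Comparing them yields the action of \<open>x\<close> on
    \<open>w\<close>.\<close>
  have "inv x = inv (inv y \<otimes> x) \<otimes> inv y" by (simp add: inv_mult_group m_assoc)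
  also have "\<dots> = inv y \<otimes> (inv w \<otimes> (inv A \<otimes> inv y))" unfolding r1
    by (simp add: inv_mult_group m_assoc)
  finally have "w \<otimes> (y \<otimes> (inv x \<otimes> y)) = inv A" by (simp add: m_assoc inv_cancel_left)
  moreover have "y \<otimes> inv x \<otimes> (B \<otimes> y) = inv A" unfolding r2 by (simp add: m_assoc inv_cancel_left)
  ultimately have "y \<otimes> (w \<otimes> inv x \<otimes> y) = y \<otimes> (inv x \<otimes> B \<otimes> y)" by (simp add: m_assoc comm)
  then have w_ix: "w \<otimes> inv x = inv x \<otimes> B" by simp
  then have x_w: "x \<otimes> w = B \<otimes> x"
    by (metis cl(1,3) inv_closed inv_solve_left inv_solve_right m_assoc m_closed x_closed)
  have yxy: "inv x = y \<otimes> (x \<otimes> y)" by (simp add: rels)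
  \<comment> \<open>Since \<open>x^-1 = y x y\<close> and \<open>y\<close> commutes with
    \<open>w\<close> and \<open>B\<close>, conjugation by \<open>x^-1\<close> also sends
    \<open>w\<close> to \<open>B\<close>.\<close>
  have ix_w: "inv x \<otimes> w = B \<otimes> inv x"
  proof -
    have "inv x \<otimes> w = y \<otimes> (x \<otimes> w) \<otimes> y" by (subst yxy) (simp add: m_assoc comm)
    also have "\<dots> = B \<otimes> (y \<otimes> (x \<otimes> y))" unfolding x_w by (simp add: m_assoc comm)
    finally show ?thesis unfolding yxy[symmetric] .
  qed
  have B_gen: "B \<in> generate G {w}" unfolding B_def generate_pow[OF cl(1)] by blast
  have W_normal: "generate G {w} \<lhd> G"
  proof (rule normal_generateI_gens)
    fix b s assume "b \<in> {x, y, inv x, inv y}" "s \<in> {w}"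
    then show "b \<otimes> s \<otimes> inv b \<in> generate G {w}"
      using B_gen generate.incl[of w "{w}" G] by (auto simp: x_w ix_w comm m_assoc)
  qed simp
  define C where "C = A \<otimes> inv x"
  have C [simp]: "C \<in> carrier G" by (simp add: C_def)
  have e1: "y \<otimes> (x \<otimes> x) \<otimes> inv y = C \<otimes> w"
  proof -
    have "y \<otimes> (x \<otimes> x) \<otimes> inv y = inv x \<otimes> (inv y \<otimes> x) \<otimes> inv y" by (simp add: rels)
    then show ?thesis unfolding r1 by (simp add: C_def m_assoc comm)
  qed
  have e2: "inv y \<otimes> (x \<otimes> x) \<otimes> y = C \<otimes> B"
  proof -
    have "inv y \<otimes> (x \<otimes> x) \<otimes> y = inv y \<otimes> x \<otimes> (x \<otimes> y)" by (simp add: m_assoc)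
    also have "\<dots> = A \<otimes> (w \<otimes> (y \<otimes> (x \<otimes> y)))" unfolding r1 by (simp add: m_assoc)
    finally show ?thesis unfolding yxy[symmetric] w_ix by (simp add: C_def m_assoc)
  qed
  have e3: "y \<otimes> C \<otimes> inv y = x \<otimes> x \<otimes> inv B"
  proof -
    have "C = inv y \<otimes> (x \<otimes> x) \<otimes> y \<otimes> inv B" unfolding e2 by (simp add: m_assoc)
    then have "y \<otimes> C \<otimes> inv y = x \<otimes> (x \<otimes> (y \<otimes> (inv B \<otimes> inv y)))"
      by (simp add: m_assoc inv_cancel_left)
    moreover have "inv B \<otimes> inv y = inv y \<otimes> inv B" using comm(2)
      by (metis cl(3) inv_mult_group y_closed)
    ultimately show ?thesis by (simp add: m_assoc inv_cancel_left)
  qed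
  have e4: "inv y \<otimes> C \<otimes> y = x \<otimes> x \<otimes> inv w"
  proof -
    have "C = y \<otimes> (x \<otimes> x) \<otimes> inv y \<otimes> inv w" unfolding e1 by (simp add: m_assoc)
    then have "inv y \<otimes> C \<otimes> y = x \<otimes> (x \<otimes> (inv (w \<otimes> y) \<otimes> y))"
      by (simp add: m_assoc inv_cancel_left inv_mult_group)
    then show ?thesis unfolding comm_w(1)[symmetric] by (simp add: m_assoc inv_mult_group)
  qed
  let ?S = "{x \<otimes> x, C, w}"
  define U where "U = generate G ?S"
  have S: "?S \<subseteq> carrier G" by simp
  have U_sub: "subgroup U G" unfolding U_def by (rule generate_is_subgroup[OF S])
  have gens: "x \<otimes> x \<in> U" "C \<in> U" "w \<in> U" unfolding U_def by (auto intro: generate.incl)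
  have B_U: "B \<in> U" using B_gen mono_generate[of "{w}" ?S] unfolding U_def by blast
  note U_closed = subgroup.m_closed[OF U_sub] subgroup.m_inv_closed[OF U_sub]
  have U_car: "u \<in> carrier G" if "u \<in> U" for u using subgroup.subset[OF U_sub] that by blast
  have conj_y: "y \<otimes> u \<otimes> inv y \<in> U" if "u \<in> U" for u
  proof (rule conj_generate[OF S U_sub y_closed _ that[unfolded U_def]])
    fix s assume "s \<in> ?S"
    moreover have "y \<otimes> w \<otimes> inv y = w" by (simp add: comm m_assoc)
    ultimately show "y \<otimes> s \<otimes> inv y \<in> U" using e1 e3 gens B_U U_closed by auto
  qed
  have conj_iy: "inv y \<otimes> u \<otimes> y \<in> U" if "u \<in> U" for u
  proof -
    have "inv y \<otimes> u \<otimes> inv (inv y) \<in> U"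
    proof (rule conj_generate[OF S U_sub inv_closed[OF y_closed] _ that[unfolded U_def]])
      fix s assume "s \<in> ?S"
      moreover have "inv y \<otimes> w \<otimes> y = w" by (simp add: comm m_assoc)
      ultimately show "inv y \<otimes> s \<otimes> inv (inv y) \<in> U" using e2 e4 gens B_U U_closed by auto
    qed
    then show ?thesis by simp
  qed
  have U_form: "\<exists>(m :: int) (n :: int). u = x [^] m \<otimes> y [^] n" if "u \<in> U" for u
  proof -
    have W_car: "t \<in> carrier G" if "t \<in> generate G {w}" for t
      using that generate_in_carrier[of "{w}" t] by simp
    \<comment> \<open>A member of the normal subgroup generated by \<open>w\<close> passes
      \<open>x^m\<close> at the price of a conjugation, so products of generators of
      \<open>U\<close> collect into the form \<open>x^m t\<close>.\<close>
    have step: "\<exists>m :: int. \<exists>t \<in> generate G {w}. h \<otimes> g = x [^] m \<otimes> t"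
      if h: "(\<exists>k :: int. h = x [^] k) \<or> h \<in> generate G {w}"
        and g: "\<exists>m :: int. \<exists>t \<in> generate G {w}. g = x [^] m \<otimes> t" for h g
    proof -
      obtain m t where t: "t \<in> generate G {w}" "g = x [^] (m :: int) \<otimes> t" using g by blast
      from h show ?thesis
      proof
        assume "\<exists>k :: int. h = x [^] k"
        then obtain k :: int where "h = x [^] k" ..
        then have "h \<otimes> g = x [^] (k + m) \<otimes> t" using t W_car by (simp add: int_pow_mult m_assoc)
        then show ?thesis using t by blast
      next
        assume h: "h \<in> generate G {w}"
        let ?t = "inv (x [^] m) \<otimes> h \<otimes> x [^] m"
        have "?t \<in> generate G {w}" using normal.inv_op_closed1[OF W_normal _ h, of "x [^] m"]
          by simp
        then have "?t \<otimes> t \<in> generate G {w}" using t by (blast intro: generate.eng)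
        moreover have "h \<otimes> g = x [^] m \<otimes> (?t \<otimes> t)"
          using t h W_car by (simp add: m_assoc inv_cancel_left)
        ultimately show ?thesis by blast
      qed
    qed
    have "x \<otimes> x = x [^] (2 :: int)" using int_pow_mult[OF x_closed, of 1 1] by simp
    moreover have "C = x [^] (i - 1)" by (simp add: C_def A_def int_pow_diff)
    ultimately have S_form: "(\<exists>k :: int. h = x [^] k) \<or> h \<in> generate G {w}" if "h \<in> ?S" for h
      using that generate.incl[of w "{w}" G] by blast
    have S_form': "(\<exists>k :: int. inv h = x [^] k) \<or> inv h \<in> generate G {w}" if "h \<in> ?S" for h
      using S_form[OF that] int_pow_neg[OF x_closed] generate_m_inv_closed[of "{w}" h] cl(1)
      by (metis empty_subsetI insert_subset)
    have "\<exists>m :: int. \<exists>t \<in> generate G {w}. u = x [^] m \<otimes> t"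
      using that[unfolded U_def] S
    proof (induction rule: generate_left_induct)
      case one
      show ?case using generate.one[of G "{w}"] by (intro exI[of _ 0] bexI[of _ \<one>]) auto
    qed (use step S_form S_form' in blast)+
    then obtain m t where "t \<in> generate G {w}" "u = x [^] (m :: int) \<otimes> t" by blast
    moreover from this(1) obtain k :: int where "t = w [^] k" using generate_pow[OF cl(1)] by auto
    ultimately have "u = x [^] m \<otimes> y [^] (l * k)" by (simp add: w_def int_pow_pow)
    then show ?thesis by blast
  qed
  have yp: "y [^] (n + 1) = y \<otimes> y [^] n" "y [^] (n - 1) = inv y \<otimes> y [^] n" for n :: int
    using int_pow_mult[OF y_closed, of 1 n] int_pow_mult[OF y_closed, of "- 1" n]
    by (simp_all add: add.commute int_pow_neg)
  \<comment> \<open>The form is stable because \<open>x^2\<close> lies in \<open>U\<close> and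
    \<open>y x = x^-1 y^-1 = x x^-2 y^-1\<close>; the power of \<open>y\<close> is then carried
    through \<open>u\<close> by conjugation.\<close>
  have "\<exists>u \<in> U. \<exists>n :: int. g = u \<otimes> y [^] n \<or> g = x \<otimes> u \<otimes> y [^] n"
    using g
  proof (induction rule: carrier_induct)
    case one
    show ?case using subgroup.one_closed[OF U_sub] by (intro bexI[of _ \<one>] exI[of _ 0]) auto
  next
    case (x g)
    then obtain u n where u: "u \<in> U" "g = u \<otimes> y [^] n \<or> g = x \<otimes> u \<otimes> y [^] (n :: int)" by blast
    have c: "u \<in> carrier G" using U_car u by blast
    from u(2) show ?case
    proof
      assume "g = u \<otimes> y [^] n"
      then have "x \<otimes> g = x \<otimes> u \<otimes> y [^] n" using c by (simp add: m_assoc)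
      then show ?thesis using u(1) by blast
    next
      assume "g = x \<otimes> u \<otimes> y [^] n"
      then have "x \<otimes> g = (x \<otimes> x \<otimes> u) \<otimes> y [^] n" using c by (simp add: m_assoc)
      then show ?thesis using U_closed(1)[OF gens(1) u(1)] by blast
    qed
  next
    case (y g)
    then obtain u n where u: "u \<in> U" "g = u \<otimes> y [^] n \<or> g = x \<otimes> u \<otimes> y [^] (n :: int)" by blast
    have c: "u \<in> carrier G" using U_car u by blast
    from u(2) show ?case
    proof
      assume "g = u \<otimes> y [^] n"
      then have "y \<otimes> g = (y \<otimes> u \<otimes> inv y) \<otimes> y [^] (n + 1)" using c
        by (simp add: yp m_assoc inv_cancel_left)
      then show ?thesis using conj_y[OF u(1)] by blast
    next
      assume "g = x \<otimes> u \<otimes> y [^] n"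
      then have "y \<otimes> g = x \<otimes> (inv (x \<otimes> x) \<otimes> (inv y \<otimes> u \<otimes> y)) \<otimes> y [^] (n - 1)" using c
        by (simp add: yp rels)
      then show ?thesis using U_closed(1)[OF U_closed(2)[OF gens(1)] conj_iy[OF u(1)]] by blast
    qed
  next
    case (inv_x g)
    then obtain u n where u: "u \<in> U" "g = u \<otimes> y [^] n \<or> g = x \<otimes> u \<otimes> y [^] (n :: int)" by blast
    have c: "u \<in> carrier G" using U_car u by blast
    from u(2) show ?case
    proof
      assume "g = u \<otimes> y [^] n"
      then have "inv x \<otimes> g = x \<otimes> (inv (x \<otimes> x) \<otimes> u) \<otimes> y [^] n" using c
        by (simp add: m_assoc inv_mult_group inv_cancel_left)
      then show ?thesis using U_closed(1)[OF U_closed(2)[OF gens(1)] u(1)] by blast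
    next
      assume "g = x \<otimes> u \<otimes> y [^] n"
      then have "inv x \<otimes> g = u \<otimes> y [^] n" using c by (simp add: m_assoc inv_cancel_left)
      then show ?thesis using u(1) by blast
    qed
  next
    case (inv_y g)
    then obtain u n where u: "u \<in> U" "g = u \<otimes> y [^] n \<or> g = x \<otimes> u \<otimes> y [^] (n :: int)" by blast
    have c: "u \<in> carrier G" using U_car u by blast
    from u(2) show ?case
    proof
      assume "g = u \<otimes> y [^] n"
      then have "inv y \<otimes> g = (inv y \<otimes> u \<otimes> y) \<otimes> y [^] (n - 1)" using c
        by (simp add: yp m_assoc inv_cancel_left)
      then show ?thesis using conj_iy[OF u(1)] by blast
    next
      assume "g = x \<otimes> u \<otimes> y [^] n"
      then have "inv y \<otimes> g = x \<otimes> (y \<otimes> (x \<otimes> x \<otimes> u) \<otimes> inv y) \<otimes> y [^] (n + 1)" using c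
        by (simp add: yp rels)
      then show ?thesis using conj_y[OF U_closed(1)[OF gens(1) u(1)]] by blast
    qed
  qed
  then obtain u n where u: "u \<in> U" "g = u \<otimes> y [^] (n :: int) \<or> g = x \<otimes> u \<otimes> y [^] n" by blast
  obtain k j :: int where kj: "u = x [^] k \<otimes> y [^] j" using U_form[OF u(1)] by blast
  have "x [^] (k + 1) = x \<otimes> x [^] k" using int_pow_mult[OF x_closed, of 1 k]
    by (simp add: add.commute)
  then have "g = x [^] k \<otimes> y [^] (j + n) \<or> g = x [^] (k + 1) \<otimes> y [^] (j + n)"
    using u(2) by (auto simp: kj int_pow_mult m_assoc)
  then show ?thesis by blast
qed

end

section \<open>The presentation of the rotation group\<close>

context group
begin

lemma Gamma_hom:
  assumes uv: "u \<in> carrier G" "v \<in> carrier G"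
    and rels: "u [^] p = \<one>" "v [^] q = \<one>" "u \<otimes> v \<otimes> (u \<otimes> v) = \<one>"
      "inv v \<otimes> u = u [^] i1 \<otimes> v [^] j1" "v \<otimes> inv u = u [^] i2 \<otimes> v [^] j2"
  obtains h where "h \<in> hom (Gamma_pq p q i1 j1 i2 j2) G"
    "h (Gamma_gen p q i1 j1 i2 j2 S1) = u" "h (Gamma_gen p q i1 j1 i2 j2 S2) = v"
proof -
  let ?R = "Gamma_rels p q i1 j1 i2 j2"
  define f where "f g = (case g of S1 \<Rightarrow> u | S2 \<Rightarrow> v)" for g
  have f: "range f \<subseteq> carrier G" using uv by (auto simp: f_def split: gen.split)
  have s: "f S1 = u" "f S2 = v" by (simp_all add: f_def)
  have e: "eval_word G f [] = \<one>" by (simp add: eval_word_def)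
  have "eval_word G f a = eval_word G f b" if "(a, b) \<in> ?R" for a b
    using that uv rels unfolding Gamma_rels_def
    by (auto simp: eval_word_append[OF f] eval_word_gpow[OF f] s e int_pow_neg m_assoc)
  then obtain h where h: "h \<in> hom (presented_group ?R) G" "\<And>w. h (word_class ?R w) = eval_word G f w"
    using presented_group_hom[OF f] by blast
  show ?thesis
    by (rule that[of h]) (use h uv in \<open>simp_all add: Gamma_pq_def Gamma_gen_def eval_word_gpow[OF f] s\<close>)
qed

end

lemma Gamma_relations:
  fixes p q i1 j1 i2 j2
  defines "K \<equiv> Gamma_pq p q i1 j1 i2 j2" and "u \<equiv> Gamma_gen p q i1 j1 i2 j2 S1"
    and "v \<equiv> Gamma_gen p q i1 j1 i2 j2 S2"
  shows "rotation_pair K u v" "u [^]\<^bsub>K\<^esub> p = \<one>\<^bsub>K\<^esub>" "v [^]\<^bsub>K\<^esub> q = \<one>\<^bsub>K\<^esub>"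
    "inv\<^bsub>K\<^esub> v \<otimes>\<^bsub>K\<^esub> u = u [^]\<^bsub>K\<^esub> i1 \<otimes>\<^bsub>K\<^esub> v [^]\<^bsub>K\<^esub> j1"
    "v \<otimes>\<^bsub>K\<^esub> inv\<^bsub>K\<^esub> u = u [^]\<^bsub>K\<^esub> i2 \<otimes>\<^bsub>K\<^esub> v [^]\<^bsub>K\<^esub> j2"
proof -
  let ?R = "Gamma_rels p q i1 j1 i2 j2"
  have K: "K = presented_group ?R" by (simp add: K_def Gamma_pq_def)
  interpret group K unfolding K by (rule group_presented_group)
  let ?f = "\<lambda>g. word_class ?R (gpow g 1)"
  have uv: "?f S1 = u" "?f S2 = v" by (simp_all add: u_def v_def Gamma_gen_def)
  have f: "range ?f \<subseteq> carrier K" by (auto simp: K presented_group_def)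
  have c: "u \<in> carrier K" "v \<in> carrier K" using f uv by auto
  have rel: "eval_word K ?f a = eval_word K ?f b" if "(a, b) \<in> ?R" for a b
    using word_class_eval[of ?R a] word_class_eval[of ?R b] pres_eq.rel[OF that] word_class_eq_iff[of ?R a b]
    unfolding K by metis
  have R: "(gpow S1 p, []) \<in> ?R" "(gpow S2 q, []) \<in> ?R"
     "(gpow S1 1 @ gpow S2 1 @ gpow S1 1 @ gpow S2 1, []) \<in> ?R"
     "(gpow S2 (-1) @ gpow S1 1, gpow S1 i1 @ gpow S2 j1) \<in> ?R"
     "(gpow S2 1 @ gpow S1 (-1), gpow S1 i2 @ gpow S2 j2) \<in> ?R"
    by (simp_all add: Gamma_rels_def)
  have ev: "eval_word K ?f [] = \<one>\<^bsub>K\<^esub>" "eval_word K ?f (gpow S1 n) = u [^]\<^bsub>K\<^esub> n"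
    "eval_word K ?f (gpow S2 n) = v [^]\<^bsub>K\<^esub> n" for n
    using eval_word_gpow[OF f] uv by (simp_all add: eval_word_def)
  note rels = R[THEN rel, unfolded eval_word_append[OF f] ev]
  show "u [^]\<^bsub>K\<^esub> p = \<one>\<^bsub>K\<^esub>" "v [^]\<^bsub>K\<^esub> q = \<one>\<^bsub>K\<^esub>" using rels(1,2) .
  show "inv\<^bsub>K\<^esub> v \<otimes>\<^bsub>K\<^esub> u = u [^]\<^bsub>K\<^esub> i1 \<otimes>\<^bsub>K\<^esub> v [^]\<^bsub>K\<^esub> j1"
    "v \<otimes>\<^bsub>K\<^esub> inv\<^bsub>K\<^esub> u = u [^]\<^bsub>K\<^esub> i2 \<otimes>\<^bsub>K\<^esub> v [^]\<^bsub>K\<^esub> j2"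
    using rels(4,5) c by (simp_all add: int_pow_neg)
  have xyxy: "u \<otimes>\<^bsub>K\<^esub> v \<otimes>\<^bsub>K\<^esub> (u \<otimes>\<^bsub>K\<^esub> v) = \<one>\<^bsub>K\<^esub>"
    using rels(3) c by (simp add: m_assoc)
  have "UNIV = {S1, S2}" using gen.exhaust by auto
  then have "range ?f = ?f ` {S1, S2}" by (rule arg_cong)
  then have "range ?f = {?f S1, ?f S2}" unfolding image_insert image_empty .
  then have "range ?f = {u, v}" unfolding uv .
  then have "generate K {u, v} = carrier K" using presented_group_generate[of ?R] unfolding K
    by simp
  then show "rotation_pair K u v" using c xyxy by unfold_locales
qed

context rotation_pair
begin

text \<open>Every element of the presented group is \<open>u^m v^n\<close>. If its image is trivial,
  then \<open>x^m\<close> and \<open>y^n\<close> lie in \<open>X \<inter> Y = 1\<close>, so the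
  orders of \<open>x\<close> and \<open>y\<close> divide m and n, and the power relations make
  \<open>u^m\<close> and \<open>v^n\<close> trivial.\<close>

lemma Gamma_iso:
  fixes i l a :: int
  assumes rel1: "inv y \<otimes> x = x [^] i \<otimes> y [^] (1 + l)"
    and rel2: "y \<otimes> inv x = x [^] (- i) \<otimes> y [^] (- 1 - a * l)"
    and inter: "generate G {x} \<inter> generate G {y} = {\<one>}"
  obtains h where "h \<in> iso (Gamma_pq (int (ord x)) (int (ord y)) i (1 + l) (- i) (- 1 - a * l)) G"
    "h (Gamma_gen (int (ord x)) (int (ord y)) i (1 + l) (- i) (- 1 - a * l) S1) = x"
    "h (Gamma_gen (int (ord x)) (int (ord y)) i (1 + l) (- i) (- 1 - a * l) S2) = y"
proof -
  define K where "K = Gamma_pq (int (ord x)) (int (ord y)) i (1 + l) (- i) (- 1 - a * l)"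
  define u where "u = Gamma_gen (int (ord x)) (int (ord y)) i (1 + l) (- i) (- 1 - a * l) S1"
  define v where "v = Gamma_gen (int (ord x)) (int (ord y)) i (1 + l) (- i) (- 1 - a * l) S2"
  note R = Gamma_relations[of "int (ord x)" "int (ord y)" i "1 + l" "- i" "- 1 - a * l",
      folded K_def u_def v_def]
  interpret K: rotation_pair K u v by (rule R(1))
  have "x [^] int (ord x) = \<one>" "y [^] int (ord y) = \<one>" by (simp_all add: int_pow_int)
  then obtain h where h: "h \<in> hom K G" "h u = x" "h v = y"
    using Gamma_hom[OF x_closed y_closed _ _ xyxy rel1 rel2] unfolding K_def u_def v_def by metis
  interpret h: group_hom K G h using h K.is_group is_group
    by (simp add: group_hom_def group_hom_axioms_def)
  have "kernel K G h = {\<one>\<^bsub>K\<^esub>}"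
  proof
    show "{\<one>\<^bsub>K\<^esub>} \<subseteq> kernel K G h" by (simp add: kernel_def)
    show "kernel K G h \<subseteq> {\<one>\<^bsub>K\<^esub>}"
    proof
      fix c assume "c \<in> kernel K G h"
      then have c: "c \<in> carrier K" "h c = \<one>" by (auto simp: kernel_def)
      obtain m n :: int where mn: "c = u [^]\<^bsub>K\<^esub> m \<otimes>\<^bsub>K\<^esub> v [^]\<^bsub>K\<^esub> n"
        using K.cyclic_factorisation[OF R(4,5) c(1)] by blast
      then have "x [^] m \<otimes> y [^] n = \<one>"
        using c(2) h by (simp add: h.hom_int_pow)
      then have eq: "x [^] m = y [^] (- n)"
        by (simp add: int_pow_neg inv_equality[symmetric])
      have "x [^] m \<in> generate G {x}" "y [^] (- n) \<in> generate G {y}"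
        unfolding generate_pow[OF x_closed] generate_pow[OF y_closed] by blast+
      then have "x [^] m = \<one>" "y [^] (- n) = \<one>" using inter eq by auto
      then have "int (ord x) dvd m" "int (ord y) dvd n" by (simp_all add: int_pow_eq_id)
      then obtain r s where "m = int (ord x) * r" "n = int (ord y) * s" unfolding dvd_def by blast
      then have "u [^]\<^bsub>K\<^esub> m = (u [^]\<^bsub>K\<^esub> int (ord x)) [^]\<^bsub>K\<^esub> r"
        "v [^]\<^bsub>K\<^esub> n = (v [^]\<^bsub>K\<^esub> int (ord y)) [^]\<^bsub>K\<^esub> s"
        by (simp_all only: K.int_pow_pow K.x_closed K.y_closed)
      then have "u [^]\<^bsub>K\<^esub> m = \<one>\<^bsub>K\<^esub>" "v [^]\<^bsub>K\<^esub> n = \<one>\<^bsub>K\<^esub>"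
        unfolding R(2,3) by simp_all
      then show "c \<in> {\<one>\<^bsub>K\<^esub>}" using mn by simp
    qed
  qed
  then have inj: "inj_on h (carrier K)" using h.inj_on_one_iff h.trivial_ker_imp_inj by blast
  have "{x, y} \<subseteq> h ` carrier K" using h
    by (metis K.x_closed K.y_closed empty_subsetI image_eqI insert_subset)
  then have "carrier G \<subseteq> h ` carrier K"
    using generate_subgroup_incl[OF _ h.img_is_subgroup] generate_xy by metis
  then have "h \<in> iso K G" using inj h(1) hom_carrier[OF h(1)] by (auto simp: iso_def bij_betw_def)
  then show ?thesis using that h unfolding K_def u_def v_def by blast
qed

text \<open>Inverting both generators exchanges the two relations, so the presented group has a
  second homomorphism to G, with values \<open>x^-1\<close> and \<open>y^-1\<close> on the
  generators. Precomposing it with the inverse of the isomorphism gives an endomorphism of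
  G.\<close>

lemma reflexibleI:
  fixes i l :: int
  assumes rel1: "inv y \<otimes> x = x [^] i \<otimes> y [^] (1 + l)"
    and rel2: "y \<otimes> inv x = x [^] (- i) \<otimes> y [^] (- 1 - l)"
    and inter: "generate G {x} \<inter> generate G {y} = {\<one>}"
  shows reflexible
proof -
  \<comment> \<open>The factor \<open>1 * l\<close> keeps the syntactic form of
    \<open>Gamma_iso\<close> at \<open>a = 1\<close>.\<close>
  let ?K = "Gamma_pq (int (ord x)) (int (ord y)) i (1 + l) (- i) (- 1 - 1 * l)"
  obtain h where h: "h \<in> iso ?K G"
    "h (Gamma_gen (int (ord x)) (int (ord y)) i (1 + l) (- i) (- 1 - 1 * l) S1) = x"
    "h (Gamma_gen (int (ord x)) (int (ord y)) i (1 + l) (- i) (- 1 - 1 * l) S2) = y"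
    using Gamma_iso[OF rel1 _ inter, of 1] rel2 by auto
  have ix: "(inv x) [^] n = x [^] (- n)" "(inv y) [^] n = y [^] (- n)" for n :: int
    by (simp_all add: int_pow_inv int_pow_neg)
  have one: "(inv x) [^] int (ord x) = \<one>" "(inv y) [^] int (ord y) = \<one>"
    unfolding int_pow_inv[OF x_closed] int_pow_inv[OF y_closed] by (simp_all add: int_pow_int)
  have neg_eq: "- (1 + l) = - 1 - l" "- (- 1 - 1 * l) = 1 + l" by simp_all
  have xyxy': "inv x \<otimes> inv y \<otimes> (inv x \<otimes> inv y) = \<one>" by (simp add: rels)
  have "inv (inv y) \<otimes> inv x = (inv x) [^] i \<otimes> (inv y) [^] (1 + l)"
    unfolding ix using rel2 by (simp only: inv_inv[OF y_closed] neg_eq)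
  moreover have "inv y \<otimes> inv (inv x) = (inv x) [^] (- i) \<otimes> (inv y) [^] (- 1 - 1 * l)"
    unfolding ix using rel1 by (simp only: inv_inv[OF x_closed] neg_eq minus_minus)
  ultimately obtain k where k: "k \<in> hom ?K G"
    "k (Gamma_gen (int (ord x)) (int (ord y)) i (1 + l) (- i) (- 1 - 1 * l) S1) = inv x"
    "k (Gamma_gen (int (ord x)) (int (ord y)) i (1 + l) (- i) (- 1 - 1 * l) S2) = inv y"
    using Gamma_hom[OF inv_closed[OF x_closed] inv_closed[OF y_closed] one xyxy'] by metis
  interpret K: rotation_pair ?K "Gamma_gen (int (ord x)) (int (ord y)) i (1 + l) (- i) (- 1 - 1 * l) S1"
    "Gamma_gen (int (ord x)) (int (ord y)) i (1 + l) (- i) (- 1 - 1 * l) S2"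
    by (rule Gamma_relations(1))
  let ?h' = "inv_into (carrier ?K) h"
  have h': "?h' \<in> hom G ?K" using K.iso_set_sym[OF h(1)] by (simp add: iso_def)
  have inj: "inj_on h (carrier ?K)" using h(1) by (simp add: iso_def bij_betw_def)
  have "compose (carrier G) k ?h' \<in> hom G G" using hom_compose[OF h' k(1)]
    by (simp add: compose_def hom_def)
  moreover have "compose (carrier G) k ?h' x = inv x" "compose (carrier G) k ?h' y = inv y"
    using inv_into_f_f[OF inj K.x_closed] inv_into_f_f[OF inj K.y_closed] h(2,3) k(2,3)
    by (simp_all add: compose_eq)
  ultimately show ?thesis unfolding reflexible_def by blast
qed

end

section \<open>The core of a cyclic vertex stabiliser\<close>

context group
begin

text \<open>The products \<open>h k\<close> are pairwise distinct because the intersection is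
  trivial, and there are as many of them as elements of G.\<close>

lemma factor_of_card:
  assumes fin: "finite (carrier G)" and H: "subgroup H G" and K: "subgroup K G"
    and inter: "H \<inter> K = {\<one>}" and card: "card H * card K = card (carrier G)" and g: "g \<in> carrier G"
  obtains h k where "h \<in> H" "k \<in> K" "g = h \<otimes> k"
proof -
  let ?m = "\<lambda>(h, k). h \<otimes> k"
  have Hc: "h \<in> H \<Longrightarrow> h \<in> carrier G" and Kc: "k \<in> K \<Longrightarrow> k \<in> carrier G" for h k
    using subgroup.subset[OF H] subgroup.subset[OF K] by auto
  have "inj_on ?m (H \<times> K)"
  proof (rule inj_onI, clarify)
    fix h k h' k' assume a: "h \<in> H" "k \<in> K" "h' \<in> H" "k' \<in> K" "h \<otimes> k = h' \<otimes> k'"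
    note c = Hc[OF a(1)] Kc[OF a(2)] Hc[OF a(3)] Kc[OF a(4)]
    have "inv h' \<otimes> h = inv h' \<otimes> (h \<otimes> k) \<otimes> inv k" using c by (simp add: m_assoc)
    also have "\<dots> = k' \<otimes> inv k" unfolding a(5) using c by (simp add: m_assoc inv_cancel_left)
    finally have eq: "inv h' \<otimes> h = k' \<otimes> inv k" .
    have "inv h' \<otimes> h \<in> H" "k' \<otimes> inv k \<in> K"
      using a subgroup.m_closed[OF H] subgroup.m_inv_closed[OF H] subgroup.m_closed[OF K] subgroup.m_inv_closed[OF K]
      by auto
    then have "inv h' \<otimes> h = \<one>" "k' \<otimes> inv k = \<one>" using inter eq by auto
    then show "h = h' \<and> k = k'"
      using c by (metis inv_closed inv_equality inv_inv)
  qed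
  then have "card (?m ` (H \<times> K)) = card (carrier G)"
    using card by (simp add: card_image card_cartesian_product)
  moreover have "?m ` (H \<times> K) \<subseteq> carrier G" using Hc Kc by auto
  ultimately have "?m ` (H \<times> K) = carrier G" using fin by (simp add: card_subset_eq)
  then have "g \<in> ?m ` (H \<times> K)" using g by (simp only:)
  then show ?thesis using that by auto
qed

lemma conj_pow:
  assumes "a \<in> carrier G" "g \<in> carrier G"
  shows "(g \<otimes> a \<otimes> inv g) [^] (n :: nat) = g \<otimes> a [^] n \<otimes> inv g"
proof (induction n)
  case (Suc n)
  then show ?case using assms by (simp add: m_assoc inv_cancel_left)
qed (use assms in simp)

lemma conj_int_pow:
  assumes "a \<in> carrier G" "g \<in> carrier G"
  shows "(g \<otimes> a \<otimes> inv g) [^] (n :: int) = g \<otimes> a [^] n \<otimes> inv g"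
proof (cases n rule: int_cases2)
  case (nonneg k)
  then show ?thesis using conj_pow[OF assms] by (simp add: int_pow_int)
next
  case (nonpos k)
  have "inv (g \<otimes> a [^] k \<otimes> inv g) = g \<otimes> inv (a [^] k) \<otimes> inv g"
    using assms by (simp add: inv_mult_group m_assoc)
  then show ?thesis using conj_pow[OF assms] assms nonpos by (simp add: int_pow_neg_int)
qed

lemma ord_conj:
  assumes "a \<in> carrier G" "g \<in> carrier G"
  shows "ord (g \<otimes> a \<otimes> inv g) = ord a"
proof -
  have "g \<otimes> a [^] n \<otimes> inv g = \<one> \<longleftrightarrow> a [^] n = \<one>" for n :: nat
    using assms
    by (metis inv_closed inv_solve_right' l_one m_closed nat_pow_closed one_closed r_one l_cancel)
  then have "(g \<otimes> a \<otimes> inv g) [^] n = \<one> \<longleftrightarrow> a [^] n = \<one>" for n :: nat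
    by (simp only: conj_pow[OF assms])
  then have "ord (g \<otimes> a \<otimes> inv g) dvd n \<longleftrightarrow> ord a dvd n" for n
    using assms by (simp add: pow_eq_id)
  then show ?thesis by (meson dvd_antisym dvd_refl)
qed

text \<open>The order of \<open>a^m\<close> determines the gcd of m and the order of
  \<open>a\<close>, and by Bezout's identity \<open>a\<close> to this gcd is a power of
  \<open>a^m\<close>. So elements of equal order generate the same subgroup.\<close>

lemma cyclic_same_ord:
  assumes a: "a \<in> carrier G" "ord a > 0" and c: "c \<in> generate G {a}" and d: "d \<in> generate G {a}"
    and eq: "ord c = ord d"
  shows "d \<in> generate G {c}"
proof -
  have nat_form: "\<exists>m :: nat. g = a [^] m" if g: "g \<in> generate G {a}" for g
  proof -
    obtain k :: int where k: "g = a [^] k" using g unfolding generate_pow[OF a(1)] by blast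
    have "int (ord a) dvd k mod int (ord a) - k"
      using mod_eq_dvd_iff[of "k mod int (ord a)" "int (ord a)" k] by simp
    then have "a [^] k = a [^] (k mod int (ord a))" using int_pow_eq[OF a(1)] by blast
    also have "k mod int (ord a) = int (nat (k mod int (ord a)))" using a(2) by simp
    also have "a [^] int (nat (k mod int (ord a))) = a [^] nat (k mod int (ord a))"
      by (rule int_pow_int)
    finally show ?thesis using k by blast
  qed
  obtain m n :: nat where mn: "c = a [^] m" "d = a [^] n" using nat_form c d by metis
  have ord: "ord (a [^] k) = ord a div gcd (ord a) k" for k
    using ord_pow_gen[OF a(1), of k] a(2) by simp
  have "ord a div gcd (ord a) m = ord a div gcd (ord a) n" using eq ord mn by simp
  then have "gcd (ord a) m = gcd (ord a) n"
    using a(2) by (metis dvd_div_eq_0_iff dvd_div_mult_self gcd_dvd1 mult_left_cancel neq0_conv)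
  then have "int (gcd (ord a) m) dvd int n" by (metis gcd_dvd2 int_dvd_int_iff)
  then obtain r where r: "int n = int (gcd (ord a) m) * r" by (elim dvdE)
  obtain s t where st: "s * int (ord a) + t * int m = int (gcd (ord a) m)"
    using bezout_int[of "int (ord a)" "int m"] by auto
  have "int (ord a) dvd int m * (t * r) - int n"
    unfolding r st[symmetric] by (simp add: algebra_simps)
  then have "d = a [^] (int m * (t * r))"
    using mn a int_pow_eq[OF a(1), of "int n"] by (simp add: int_pow_int)
  also have "\<dots> = c [^] (t * r)" using mn a int_pow_pow[OF a(1), of "int m" "t * r"]
    by (simp add: int_pow_int)
  finally have "d = c [^] (t * r)" .
  moreover have "c \<in> carrier G" using mn a by simp
  ultimately show ?thesis using generate_pow by blast
qed

end

context rotation_pair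
begin

text \<open>The injection of \<open>Y \<times> Y\<close> into G compares the square of
  \<open>ord y\<close> with \<open>ord x * ord y\<close>.\<close>

lemma trivial_core_order_le:
  assumes fin: "finite (carrier G)" and card: "card (carrier G) = ord x * ord y"
    and core: "\<And>N. N \<lhd> G \<Longrightarrow> N \<subseteq> generate G {y} \<Longrightarrow> N \<subseteq> {\<one>}"
  shows "ord y \<le> ord x"
proof -
  let ?Y = "generate G {y}"
  have ys: "{y} \<subseteq> carrier G" by simp
  have Yc: "u \<in> carrier G" if "u \<in> ?Y" for u using generate_in_carrier[OF ys that] .
  note Y = generate_is_subgroup[OF ys]
  have pos: "ord y > 0" using ord_ge_1[OF fin y_closed] by simp
  have comm: "y \<otimes> u = u \<otimes> y" if "u \<in> ?Y" for u
  proof -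
    obtain k :: int where "u = y [^] k" using \<open>u \<in> ?Y\<close> unfolding generate_pow[OF y_closed] by blast
    then show ?thesis using int_pow_mult[OF y_closed, of 1 k] int_pow_mult[OF y_closed, of k 1]
      by (simp add: add.commute)
  qed
  \<comment> \<open>An equation \<open>a x b = a' x b'\<close> says that \<open>x^-1\<close>
    conjugates \<open>a'^-1 a\<close> into Y, so injectivity reduces to this claim.\<close>
  have key: "c = \<one>" if c: "c \<in> ?Y" and d: "inv x \<otimes> c \<otimes> x \<in> ?Y" for c
  proof -
    define d where "d = inv x \<otimes> c \<otimes> x"
    have cc: "c \<in> carrier G" "d \<in> carrier G" "{c} \<subseteq> carrier G" "{d} \<subseteq> carrier G" using Yc c
      by (auto simp: d_def)
    have "ord d = ord c" using ord_conj[of c "inv x"] cc by (simp add: d_def)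
    then have dc: "d \<in> generate G {c}" and cd: "c \<in> generate G {d}"
      using cyclic_same_ord[OF y_closed pos] c d by (auto simp: d_def)
    have xd: "x \<otimes> d \<otimes> inv x = c" using cc(1) by (simp add: d_def m_assoc inv_cancel_left)
    have "generate G {c} \<lhd> G"
    proof (rule normal_generateI_gens[OF cc(3)])
      fix a s assume a: "a \<in> {x, y, inv x, inv y}" and "s \<in> {c}"
      then have s: "s = c" by simp
      \<comment> \<open>\<open>c\<close> is a power of \<open>d\<close> and
        \<open>x d x^-1 = c\<close>, hence \<open>x c x^-1\<close> is a power of
        \<open>c\<close>.\<close>
      have "x \<otimes> c \<otimes> inv x \<in> generate G {c}"
        by (rule conj_generate[OF cc(4) generate_is_subgroup[OF cc(3)] x_closed _ cd])
          (use xd generate.incl[of c "{c}" G] in auto)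
      moreover have "y \<otimes> c \<otimes> inv y = c" "inv y \<otimes> c \<otimes> y = c"
        using comm[OF c] cc by (simp_all add: m_assoc) (simp flip: comm[OF c] add: inv_cancel_left)
      ultimately show "a \<otimes> s \<otimes> inv a \<in> generate G {c}"
        using a dc generate.incl[of c "{c}" G] unfolding s by (auto simp: d_def)
    qed
    moreover have "generate G {c} \<subseteq> ?Y" using generate_subgroup_incl[OF _ Y, of "{c}"] c by simp
    ultimately have "generate G {c} \<subseteq> {\<one>}" by (rule core)
    then show ?thesis using generate.incl[of c "{c}" G] by blast
  qed
  have "inj_on (\<lambda>(a, b). a \<otimes> x \<otimes> b) (?Y \<times> ?Y)"
  proof (rule inj_onI, clarify)
    fix a b a' b' assume a: "a \<in> ?Y" "b \<in> ?Y" "a' \<in> ?Y" "b' \<in> ?Y" "a \<otimes> x \<otimes> b = a' \<otimes> x \<otimes> b'"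
    note c = Yc[OF a(1)] Yc[OF a(2)] Yc[OF a(3)] Yc[OF a(4)]
    have "inv x \<otimes> (inv a' \<otimes> a) \<otimes> x = inv x \<otimes> inv a' \<otimes> (a \<otimes> x \<otimes> b) \<otimes> inv b"
      using c by (simp add: m_assoc)
    also have "\<dots> = b' \<otimes> inv b" unfolding a(5) using c by (simp add: m_assoc inv_cancel_left)
    finally have eq: "inv x \<otimes> (inv a' \<otimes> a) \<otimes> x = b' \<otimes> inv b" .
    have m: "inv a' \<otimes> a \<in> ?Y" "b' \<otimes> inv b \<in> ?Y"
      using a subgroup.m_closed[OF Y] subgroup.m_inv_closed[OF Y] by auto
    then have one: "inv a' \<otimes> a = \<one>" using key[of "inv a' \<otimes> a"] eq by simp
    then have "b' \<otimes> inv b = \<one>" using eq by simp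
    then show "a = a' \<and> b = b'" using one c by (metis inv_closed inv_equality inv_inv)
  qed
  moreover have "(\<lambda>(a, b). a \<otimes> x \<otimes> b) ` (?Y \<times> ?Y) \<subseteq> carrier G" using Yc by auto
  ultimately have "card (?Y \<times> ?Y) \<le> card (carrier G)" using fin card_inj_on_le by blast
  then have "ord y * ord y \<le> ord x * ord y"
    by (simp add: card card_cartesian_product generate_pow_card)
  then show ?thesis using pos by simp
qed

text \<open>Stated for a reflexible group because it will be applied to the quotient by the core,
  not to G.\<close>

lemma remainder_central:
  fixes i n :: int
  assumes reflexible and z: "z = y [^] n" and rel: "inv y \<otimes> x \<otimes> inv y = x [^] i \<otimes> z"
  shows "z \<otimes> x = x \<otimes> z"
proof -
  obtain \<theta> where \<theta>: "\<theta> \<in> hom G G" "\<theta> x = inv x" "\<theta> y = inv y"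
    using assms by (auto simp: reflexible_def)
  interpret \<theta>: group_hom G G \<theta> using \<theta> is_group by (simp add: group_hom_def group_hom_axioms_def)
  define A where "A = x [^] i"
  define w where "w = inv y \<otimes> x \<otimes> inv y"
  have c [simp]: "A \<in> carrier G" "z \<in> carrier G" "w \<in> carrier G" by (simp_all add: A_def z w_def)
  have yz: "y \<otimes> z = z \<otimes> y"
    using int_pow_mult[OF y_closed, of 1 n] int_pow_mult[OF y_closed, of n 1]
    by (simp add: z add.commute)
  have w: "w = A \<otimes> z" using rel by (simp add: A_def w_def)
  have "\<theta> A = inv A" "\<theta> z = inv z" by (simp_all add: A_def z \<theta>.hom_int_pow \<theta> int_pow_inv)
  then have "\<theta> w = inv A \<otimes> inv z" unfolding w by simp
  \<comment> \<open>\<open>w\<close> is a palindrome in \<open>x\<close> and \<open>y^-1\<close>, so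
    inverting the generators inverts it.\<close>
  moreover have "\<theta> w = inv w" by (simp add: w_def \<theta> inv_mult_group m_assoc)
  ultimately have "inv w = inv (z \<otimes> A)" by (simp add: inv_mult_group)
  then have w': "w = z \<otimes> A" by (metis c inv_inv m_closed)
  \<comment> \<open>\<open>w\<close> equals both \<open>A z\<close> and \<open>z A\<close>. Hence
    \<open>z\<close> commutes with \<open>w\<close>, and then with \<open>x = y w y\<close>.\<close>
  have wz: "z \<otimes> w = w \<otimes> z" using w w' by (metis c m_assoc)
  have x: "x = y \<otimes> w \<otimes> y" by (simp add: w_def m_assoc inv_cancel_left)
  have "z \<otimes> (y \<otimes> w \<otimes> y) = z \<otimes> y \<otimes> w \<otimes> y" by (simp add: m_assoc)
  also have "\<dots> = y \<otimes> (z \<otimes> w) \<otimes> y" unfolding yz[symmetric] by (simp add: m_assoc)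
  also have "\<dots> = y \<otimes> w \<otimes> (z \<otimes> y)" unfolding wz by (simp add: m_assoc)
  also have "\<dots> = (y \<otimes> w \<otimes> y) \<otimes> z" unfolding yz[symmetric] by (simp add: m_assoc)
  finally show ?thesis unfolding x[symmetric] .
qed

end

context group
begin

lemma rcoset_eq_iff:
  assumes "subgroup H G" "g \<in> carrier G" "h \<in> carrier G"
  shows "H #> g = H #> h \<longleftrightarrow> g \<otimes> inv h \<in> H"
  using subgroup.rcos_module[OF assms(1) is_group assms(3,2)] repr_independence[OF _ assms(3,1)]
    rcos_self[OF assms(2,1)] by blast

end

section \<open>The exponents, and realisation of finite groups as coset geometries\<close>

context rotation_pair
begin

lemma parameters:
  fixes i :: int
  assumes q': "q' dvd ord y" "0 < q'"
    and normal: "generate G {y [^] q'} \<lhd> G"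
    and inter: "generate G {x} \<inter> generate G {y} = {\<one>}"
    and "\<not> reflexible"
    and rel: "inv y \<otimes> x \<otimes> inv y = x [^] i \<otimes> z" and z: "z \<in> generate G {y [^] q'}"
  shows "(\<exists>k a :: int. [a\<^sup>2 = 1] (mod int (ord y div q')) \<and> \<not> [a = 1] (mod int (ord y div q')) \<and>
      inv y \<otimes> x = x [^] i \<otimes> y [^] (1 + k * int q') \<and>
      y \<otimes> inv x = x [^] (- i) \<otimes> y [^] (- 1 - a * (k * int q'))) \<and> even (ord x)"
proof -
  define w where "w = y [^] q'"
  have w_int: "w = y [^] int q'" by (simp add: w_def int_pow_int)
  have w_car [simp]: "w \<in> carrier G" by (simp add: w_def)
  have ord_w: "ord w = ord y div q'" using ord_pow[OF y_closed q'(1)] q'(2) by (simp add: w_def)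
  have yw: "y \<otimes> w = w \<otimes> y"
    using int_pow_mult[OF y_closed, of 1 "int q'"] int_pow_mult[OF y_closed, of "int q'" 1]
    by (simp add: w_int add.commute)
  have W: "generate G {w} = {w [^] (k :: int) | k. k \<in> UNIV}" by (rule generate_pow) simp
  obtain k :: int where k: "z = w [^] k" using z W unfolding w_def by auto
  have "x \<otimes> w \<otimes> inv x \<in> generate G {w}"
    using normal.inv_op_closed2[OF normal x_closed] generate.incl[of w "{w}" G] unfolding w_def
    by blast
  then obtain a :: int where a: "x \<otimes> w \<otimes> inv x = w [^] a" using W by auto
  have xw: "x \<otimes> w = w [^] a \<otimes> x"
  proof -
    have "x \<otimes> w = x \<otimes> w \<otimes> inv x \<otimes> x" by (simp add: m_assoc)
    then show ?thesis unfolding a .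
  qed
  have ya: "y \<otimes> w [^] n = w [^] n \<otimes> y" for n :: int
    using int_pow_mult[OF y_closed, of 1 "int q' * n"] int_pow_mult[OF y_closed, of "int q' * n" 1]
    by (simp add: w_int int_pow_pow add.commute)
  \<comment> \<open>As \<open>x^-1 = y x y\<close> and \<open>y\<close> centralises
    \<open>w\<close>, both \<open>x\<close> and \<open>x^-1\<close> act on \<open>w\<close> with the
    same exponent; conjugating by one and then the other gives \<open>a^2 = 1\<close> modulo the
    order of \<open>w\<close>.\<close>
  have ixw: "inv x \<otimes> w \<otimes> x = w [^] a"
  proof -
    have "inv x \<otimes> w \<otimes> x = y \<otimes> (x \<otimes> (y \<otimes> w)) \<otimes> x" by (simp add: rels)
    also have "\<dots> = y \<otimes> (x \<otimes> w) \<otimes> (y \<otimes> x)" unfolding yw by (simp add: m_assoc)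
    also have "\<dots> = y \<otimes> w [^] a \<otimes> (x \<otimes> (y \<otimes> x))" unfolding xw by (simp add: m_assoc)
    also have "\<dots> = w [^] a \<otimes> (y \<otimes> (x \<otimes> (y \<otimes> x)))" unfolding ya by (simp add: m_assoc)
    also have "y \<otimes> (x \<otimes> (y \<otimes> x)) = \<one>" by (simp add: rels)
    finally show ?thesis by simp
  qed
  have "w = x \<otimes> (inv x \<otimes> w \<otimes> x) \<otimes> inv x" by (simp add: m_assoc inv_cancel_left)
  also have "\<dots> = (x \<otimes> w \<otimes> inv x) [^] a" unfolding ixw by (rule conj_int_pow[symmetric]) simp_all
  also have "\<dots> = w [^] (a * a)" unfolding a by (simp add: int_pow_pow)
  finally have "w [^] (1 :: int) = w [^] (a * a)" by simp
  then have "int (ord w) dvd a * a - 1" using int_pow_eq[OF w_car] by blast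
  then have a2: "[a\<^sup>2 = 1] (mod int (ord y div q'))"
    by (simp add: cong_iff_dvd_diff power2_eq_square ord_w)
  have yk: "y [^] (k * int q') = w [^] k" "y [^] (a * (k * int q')) = w [^] (a * k)"
    unfolding w_int by (simp_all add: int_pow_pow mult_ac)
  have "inv y \<otimes> x = inv y \<otimes> x \<otimes> inv y \<otimes> y" by (simp add: m_assoc)
  also have "\<dots> = x [^] i \<otimes> (w [^] k \<otimes> y)" unfolding rel k by (simp add: m_assoc)
  also have "\<dots> = x [^] i \<otimes> y [^] (1 + k * int q')" unfolding ya[symmetric]
    by (simp add: int_pow_mult yk)
  finally have rel1: "inv y \<otimes> x = x [^] i \<otimes> y [^] (1 + k * int q')" .
  have xk: "x \<otimes> w [^] k \<otimes> inv x = w [^] (a * k)"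
    using conj_int_pow[of w x k] unfolding a by (simp add: int_pow_pow)
  \<comment> \<open>Inverting \<open>rel\<close> leads to the second relation: moving
    \<open>w^k\<close> past \<open>x^-1\<close> turns the exponent k into
    \<open>a k\<close>.\<close>
  have "y \<otimes> inv x \<otimes> y = inv (inv y \<otimes> x \<otimes> inv y)" by (simp add: inv_mult_group m_assoc)
  also have "\<dots> = inv (w [^] k) \<otimes> inv (x [^] i)" unfolding rel k by (simp add: inv_mult_group)
  finally have i: "inv (x [^] i) = w [^] k \<otimes> (y \<otimes> inv x \<otimes> y)" by (simp add: inv_cancel_left)
  also have "\<dots> = y \<otimes> (w [^] k \<otimes> inv x) \<otimes> y" using ya[of k] by (simp flip: m_assoc)
  also have "w [^] k \<otimes> inv x = inv x \<otimes> (x \<otimes> w [^] k \<otimes> inv x)" by (simp add: m_assoc inv_cancel_left)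
  also have "\<dots> = inv x \<otimes> w [^] (a * k)" unfolding xk ..
  finally have i': "inv (x [^] i) = y \<otimes> inv x \<otimes> (w [^] (a * k) \<otimes> y)" by (simp add: m_assoc)
  have "y [^] (- 1 - a * (k * int q')) = inv y \<otimes> inv (w [^] (a * k))"
    by (simp add: int_pow_diff int_pow_neg yk)
  then have rel2: "y \<otimes> inv x = x [^] (- i) \<otimes> y [^] (- 1 - a * (k * int q'))"
    by (simp add: int_pow_neg i' m_assoc inv_cancel_left)
  have a1: "\<not> [a = 1] (mod int (ord y div q'))"
  proof
    assume "[a = 1] (mod int (ord y div q'))"
    \<comment> \<open>If \<open>a\<close> is 1 modulo the order of \<open>w\<close>, then
      \<open>w^(a k) = w^k\<close>, so \<open>a\<close> disappears from the second relation and
      \<open>reflexibleI\<close> applies.\<close>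
    then have "int (ord w) dvd k - a * k"
      by (metis cong_iff_dvd_diff cong_sym dvd_mult2 left_diff_distrib mult_1 ord_w)
    then have "w [^] (a * k) = w [^] k" by (simp add: int_pow_eq)
    then have "y [^] (- 1 - a * (k * int q')) = y [^] (- 1 - k * int q')"
      by (simp add: int_pow_diff yk)
    then have reflexible using reflexibleI[OF rel1 _ inter] rel2 by simp
    then show False using assms(5) by blast
  qed
  have "even (ord x)"
  proof (rule ccontr)
    assume "odd (ord x)"
    then obtain m where m: "ord x = 2 * m + 1" by (elim oddE)
    \<comment> \<open>\<open>x^2\<close> always centralises \<open>w\<close>. For
      \<open>ord x = 2 m + 1\<close> the element \<open>x\<close> is \<open>(x^2)^(m + 1)\<close>
      and would centralise \<open>w\<close> too, forcing \<open>a\<close> to be 1 modulo the order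
      of \<open>w\<close>.\<close>
    have xx: "x \<otimes> x \<otimes> w = w \<otimes> (x \<otimes> x)"
    proof -
      have "w \<otimes> x = x \<otimes> (inv x \<otimes> w \<otimes> x)" by (simp add: m_assoc inv_cancel_left)
      also have "\<dots> = x \<otimes> w [^] a" unfolding ixw ..
      finally have "w \<otimes> (x \<otimes> x) = x \<otimes> (w [^] a \<otimes> x)" by (simp flip: m_assoc)
      then show ?thesis unfolding xw[symmetric] by (simp add: m_assoc)
    qed
    have "(x \<otimes> x) [^] n \<otimes> w = w \<otimes> (x \<otimes> x) [^] n" for n :: nat
    proof (induction n)
      case (Suc n)
      have "(x \<otimes> x) [^] Suc n \<otimes> w = (x \<otimes> x) [^] n \<otimes> (x \<otimes> x \<otimes> w)" by (simp add: m_assoc)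
      also have "\<dots> = (x \<otimes> x) [^] n \<otimes> w \<otimes> (x \<otimes> x)" unfolding xx by (simp add: m_assoc)
      finally show ?case unfolding Suc.IH by (simp add: m_assoc)
    qed simp
    moreover have "(x \<otimes> x) [^] (m + 1) = x"
    proof -
      have "(x \<otimes> x) [^] (m + 1) = (x [^] (2 :: nat)) [^] (m + 1)" by (simp add: numeral_2_eq_2)
      also have "\<dots> = x [^] (ord x + 1)" unfolding nat_pow_pow[OF x_closed] m
        by (simp add: algebra_simps)
      finally show ?thesis by simp
    qed
    ultimately have "x \<otimes> w = w \<otimes> x" by metis
    then have "w [^] a = w [^] (1 :: int)" using a by (simp add: m_assoc)
    then have "int (ord w) dvd 1 - a" using int_pow_eq[OF w_car] by blast
    then have "[a = 1] (mod int (ord y div q'))" by (metis cong_iff_dvd_diff cong_sym ord_w)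
    then show False using a1 by blast
  qed
  then show ?thesis using a2 a1 rel1 rel2 by blast
qed

text \<open>Atomicity mentions only polyhedra on natural numbers, so the cosets are coded
  injectively by numbers. Multiplying by 3 and adding 0, 1 or 2 keeps vertices, edges and faces
  apart and makes the rank a remainder.\<close>

lemma ex_coset_geometry_nat:
  assumes fin: "finite (carrier G)" and "x \<noteq> \<one>" "y \<noteq> \<one>"
    and inter: "generate G {x} \<inter> generate G {y} = {\<one>}"
  obtains Q :: "nat ranked_poset" and V E F where "coset_geometry G x y Q V E F"
proof -
  have "countable (Pow (carrier G))" using fin by (simp add: countable_finite)
  then obtain c :: "'a set \<Rightarrow> nat" where c: "inj_on c (Pow (carrier G))" by (rule countableE)
  define V where "V g = 3 * c (generate G {y} #> g)" for g
  define E where "E g = 3 * c {g, x \<otimes> (y \<otimes> g)} + 1" for g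
  define F where "F g = 3 * c (generate G {x} #> g) + 2" for g
  define el where "el = V ` carrier G \<union> E ` carrier G \<union> F ` carrier G"
  define Q where "Q = \<lparr>elts = el,
      leq_rel = Id_on el \<union> (\<lambda>g. (V g, E g)) ` carrier G
      \<union> (\<lambda>g. (E g, F g)) ` carrier G \<union> (\<lambda>g. (V g, F g)) ` carrier G,
      rk = (\<lambda>n. n mod 3)\<rparr>"
  have sub: "subgroup (generate G {x}) G" "subgroup (generate G {y}) G"
    by (rule generate_is_subgroup; simp)+
  have in_Pow: "generate G {y} #> g \<in> Pow (carrier G)" "generate G {x} #> g \<in> Pow (carrier G)"
    "{g, x \<otimes> (y \<otimes> g)} \<in> Pow (carrier G)" if "g \<in> carrier G" for g
    using r_coset_subset_G[OF subgroup.subset[OF sub(1)] that] r_coset_subset_G[OF subgroup.subset[OF sub(2)] that]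
      that by auto
  have "coset_geometry G x y Q V E F"
  proof unfold_locales
    fix g h assume g: "g \<in> carrier G" and h: "h \<in> carrier G"
    show "V g = V h \<longleftrightarrow> g \<otimes> inv h \<in> generate G {y}"
      using inj_on_eq_iff[OF c in_Pow(1)[OF g] in_Pow(1)[OF h]] rcoset_eq_iff[OF sub(2) g h]
      by (simp add: V_def)
    show "F g = F h \<longleftrightarrow> g \<otimes> inv h \<in> generate G {x}"
      using inj_on_eq_iff[OF c in_Pow(2)[OF g] in_Pow(2)[OF h]] rcoset_eq_iff[OF sub(1) g h]
      by (simp add: F_def)
    have "x \<otimes> (y \<otimes> (x \<otimes> (y \<otimes> h))) = h" using h by (simp add: rels)
    then show "E g = E h \<longleftrightarrow> g = h \<or> g = x \<otimes> (y \<otimes> h)"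
      using inj_on_eq_iff[OF c in_Pow(3)[OF g] in_Pow(3)[OF h]]
      by (auto simp: E_def doubleton_eq_iff)
    have "3 * n mod 3 = 0" "(3 * n + 1) mod 3 = 1" "(3 * n + 2) mod 3 = 2" for n :: nat
      by presburger+
    then show "rk Q (V g) = 0" "rk Q (E g) = 1" "rk Q (F g) = 2"
      by (simp_all only: Q_def V_def E_def F_def ranked_poset.simps)
  qed (use assms in \<open>simp_all add: Q_def el_def\<close>)
  then show ?thesis by (rule that)
qed

section \<open>Quotients by normal subgroups\<close>

lemma quotient_rotation_pair:
  assumes N: "N \<lhd> G"
  shows "rotation_pair (G Mod N) (N #> x) (N #> y)" "group_hom G (G Mod N) (\<lambda>g. N #> g)"
proof -
  show hom: "group_hom G (G Mod N) (\<lambda>g. N #> g)"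
    using normal.r_coset_hom_Mod[OF N] normal.factorgroup_is_group[OF N] is_group
    by (simp add: group_hom_def group_hom_axioms_def)
  interpret \<pi>: group_hom G "G Mod N" "\<lambda>g. N #> g" by (rule hom)
  have carrier: "carrier (G Mod N) = (\<lambda>g. N #> g) ` carrier G"
    by (auto simp: FactGroup_def RCOSETS_def)
  have gen: "N #> g \<in> generate (G Mod N) {N #> x, N #> y}" if "g \<in> carrier G" for g
    using that
  proof (induction rule: carrier_induct)
    case one
    then show ?case using \<pi>.hom_one generate.one by metis
  next
    case (x g)
    then show ?case using \<pi>.hom_mult[OF x_closed x(1)] generate.eng[OF generate.incl x(2)] by simp
  next
    case (y g)
    then show ?case using \<pi>.hom_mult[OF y_closed y(1)] generate.eng[OF generate.incl y(2)] by simp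
  next
    case (inv_x g)
    then show ?case
      using \<pi>.hom_mult[OF inv_closed[OF x_closed] inv_x(1)] generate.eng[OF generate.inv inv_x(2)] \<pi>.hom_inv[OF x_closed]
      by simp
  next
    case (inv_y g)
    then show ?case
      using \<pi>.hom_mult[OF inv_closed[OF y_closed] inv_y(1)] generate.eng[OF generate.inv inv_y(2)] \<pi>.hom_inv[OF y_closed]
      by simp
  qed
  show "rotation_pair (G Mod N) (N #> x) (N #> y)"
  proof
    show "N #> x \<in> carrier (G Mod N)" "N #> y \<in> carrier (G Mod N)" unfolding carrier by simp_all
    then have "generate (G Mod N) {N #> x, N #> y} \<subseteq> carrier (G Mod N)"
      by (intro \<pi>.H.generate_incl) simp
    then show "generate (G Mod N) {N #> x, N #> y} = carrier (G Mod N)" using gen carrier by auto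
    have "N #> (x \<otimes> y \<otimes> (x \<otimes> y)) = \<one>\<^bsub>G Mod N\<^esub>" unfolding xyxy by (rule \<pi>.hom_one)
    then show "(N #> x) \<otimes>\<^bsub>G Mod N\<^esub> (N #> y) \<otimes>\<^bsub>G Mod N\<^esub> ((N #> x) \<otimes>\<^bsub>G Mod N\<^esub> (N #> y)) = \<one>\<^bsub>G Mod N\<^esub>"
      by (simp only: \<pi>.hom_mult x_closed y_closed m_closed)
  qed
qed

text \<open>N lies in Y and so meets X trivially. Hence \<open>x\<close> keeps its order in the
  quotient while that of \<open>y\<close> drops to \<open>q'\<close>, and Lagrange's theorem shows
  that the quotient satisfies the tightness equation again.\<close>

lemma quotient_orders:
  assumes fin: "finite (carrier G)" and card: "card (carrier G) = ord x * ord y"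
    and inter: "generate G {x} \<inter> generate G {y} = {\<one>}"
    and q': "q' dvd ord y" "0 < q'" and N: "N \<lhd> G" "N = generate G {y [^] q'}"
  shows "group.ord (G Mod N) (N #> x) = ord x" "group.ord (G Mod N) (N #> y) = q'"
    "card (carrier (G Mod N)) = ord x * q'"
    "generate (G Mod N) {N #> x} \<inter> generate (G Mod N) {N #> y} = {\<one>\<^bsub>G Mod N\<^esub>}"
proof -
  interpret H: rotation_pair "G Mod N" "N #> x" "N #> y" by (rule quotient_rotation_pair[OF N(1)])
  interpret \<pi>: group_hom G "G Mod N" "\<lambda>g. N #> g" by (rule quotient_rotation_pair[OF N(1)])
  have subN: "subgroup N G" using N(1) by (rule normal_imp_subgroup)
  have eq_one: "N #> g = \<one>\<^bsub>G Mod N\<^esub> \<longleftrightarrow> g \<in> N" if "g \<in> carrier G" for g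
    using rcoset_eq_iff[OF subN that one_closed] \<pi>.hom_one that by simp
  have N_Y: "N \<subseteq> generate G {y}"
  proof -
    have "y [^] q' \<in> generate G {y}" unfolding generate_pow[OF y_closed] int_pow_int[symmetric]
      by blast
    then show ?thesis unfolding N(2) by (intro generate_subgroup_incl generate_is_subgroup) auto
  qed
  have x_N: "x [^] n \<in> generate G {y} \<longleftrightarrow> x [^] n = \<one>" for n :: int
  proof
    assume "x [^] n \<in> generate G {y}"
    moreover have "x [^] n \<in> generate G {x}" unfolding generate_pow[OF x_closed] by blast
    ultimately show "x [^] n = \<one>" using inter by blast
  qed (simp add: generate.one)
  have y_N: "y [^] n \<in> N \<longleftrightarrow> int q' dvd n" for n :: int
  proof
    assume "y [^] n \<in> N"
    then obtain k :: int where "y [^] n = (y [^] q') [^] k"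
      unfolding N(2) generate_pow[OF nat_pow_closed[OF y_closed]] by blast
    then have "y [^] n = y [^] (int q' * k)" by (simp add: int_pow_pow flip: int_pow_int)
    then have "int (ord y) dvd int q' * k - n" by (simp add: int_pow_eq)
    then have "int q' dvd int q' * k - n" using q'(1) by (meson dvd_trans int_dvd_int_iff)
    then show "int q' dvd n"
      by (metis dvd_diffD1 dvd_triv_left dvd_diff_commute dvd_add_right_iff diff_add_cancel)
  next
    assume "int q' dvd n"
    then obtain k where "n = int q' * k" by (elim dvdE)
    then have "y [^] n = (y [^] q') [^] k" by (simp add: int_pow_pow flip: int_pow_int)
    then show "y [^] n \<in> N" unfolding N(2) generate_pow[OF nat_pow_closed[OF y_closed]] by blast
  qed
  have "H.ord (N #> x) dvd n \<longleftrightarrow> ord x dvd n" for n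
  proof -
    have "H.ord (N #> x) dvd n \<longleftrightarrow> N #> (x [^] n) = \<one>\<^bsub>G Mod N\<^esub>"
      using H.pow_eq_id[OF H.x_closed] \<pi>.hom_nat_pow[OF x_closed] by metis
    also have "\<dots> \<longleftrightarrow> x [^] n \<in> N" by (rule eq_one) simp
    also have "\<dots> \<longleftrightarrow> x [^] n = \<one>" using x_N[of "int n"] N_Y subgroup.one_closed[OF subN]
      by (auto simp: int_pow_int)
    finally show ?thesis by (simp add: pow_eq_id)
  qed
  then show "H.ord (N #> x) = ord x" by (meson dvd_antisym dvd_refl)
  have "H.ord (N #> y) dvd n \<longleftrightarrow> q' dvd n" for n
  proof -
    have "H.ord (N #> y) dvd n \<longleftrightarrow> N #> (y [^] n) = \<one>\<^bsub>G Mod N\<^esub>"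
      using H.pow_eq_id[OF H.y_closed] \<pi>.hom_nat_pow[OF y_closed] by metis
    also have "\<dots> \<longleftrightarrow> y [^] n \<in> N" by (rule eq_one) simp
    finally show ?thesis using y_N[of "int n"] by (simp add: int_pow_int)
  qed
  then show "H.ord (N #> y) = q'" by (meson dvd_antisym dvd_refl)
  have "card N = ord (y [^] q')" unfolding N(2) by (simp add: generate_pow_card)
  then have "card N = ord y div q'" using ord_pow[OF y_closed q'(1)] q'(2) by simp
  moreover have "card (carrier (G Mod N)) * card N = ord x * ord y"
    using lagrange[OF subN] card by (simp add: FactGroup_def order_def)
  ultimately have "card (carrier (G Mod N)) * (ord y div q') = (ord x * q') * (ord y div q')"
    using q'(1) by simp
  moreover have "ord y div q' > 0" using q' ord_ge_1[OF fin y_closed]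
    by (metis div_greater_zero_iff dvd_imp_le less_le_trans zero_less_one)
  ultimately show "card (carrier (G Mod N)) = ord x * q'" by simp
  show "generate (G Mod N) {N #> x} \<inter> generate (G Mod N) {N #> y} = {\<one>\<^bsub>G Mod N\<^esub>}"
  proof
    show "{\<one>\<^bsub>G Mod N\<^esub>} \<subseteq> generate (G Mod N) {N #> x} \<inter> generate (G Mod N) {N #> y}"
      using generate.one by blast
    show "generate (G Mod N) {N #> x} \<inter> generate (G Mod N) {N #> y} \<subseteq> {\<one>\<^bsub>G Mod N\<^esub>}"
    proof
      fix c assume c: "c \<in> generate (G Mod N) {N #> x} \<inter> generate (G Mod N) {N #> y}"
      then obtain m n :: int where mn: "c = (N #> x) [^]\<^bsub>G Mod N\<^esub> m" "c = (N #> y) [^]\<^bsub>G Mod N\<^esub> n"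
        unfolding H.generate_pow[OF H.x_closed] H.generate_pow[OF H.y_closed] by blast
      then have cx: "c = N #> (x [^] m)" and "c = N #> (y [^] n)"
        using \<pi>.hom_int_pow x_closed y_closed by simp_all
      \<comment> \<open>Equality modulo N puts \<open>x^m y^-n\<close> into N, hence into Y, and so
        \<open>x^m\<close> itself lies in Y.\<close>
      then have "x [^] m \<otimes> inv (y [^] n) \<in> generate G {y}"
        using rcoset_eq_iff[OF subN, of "x [^] m" "y [^] n"] N_Y by auto
      moreover have "y [^] n \<in> generate G {y}" unfolding generate_pow[OF y_closed] by blast
      ultimately have "x [^] m \<otimes> inv (y [^] n) \<otimes> y [^] n \<in> generate G {y}" by (rule generate.eng)
      then have "x [^] m = \<one>" using x_N by (simp add: m_assoc)
      then show "c \<in> {\<one>\<^bsub>G Mod N\<^esub>}" unfolding cx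
        using eq_one[OF one_closed] subgroup.one_closed[OF subN] by simp
    qed
  qed
qed

text \<open>Centrality is known only in the quotient. Lifted to G it says that the commutators of
  \<open>z\<close> with \<open>x\<close> and \<open>x^-1\<close> lie in N, which suffices for
  \<open>w\<close> and \<open>z\<close> to generate a normal subgroup. It lies in Y and is therefore
  absorbed by the core.\<close>

lemma remainder_in_core:
  fixes i n :: int
  assumes N: "N \<lhd> G" "N = generate G {w}" and w: "w \<in> generate G {y}"
    and core: "\<And>M. M \<lhd> G \<Longrightarrow> M \<subseteq> generate G {y} \<Longrightarrow> M \<subseteq> N"
    and refl: "rotation_pair.reflexible (G Mod N) (N #> x) (N #> y)"
    and z: "z = y [^] n" and rel: "inv y \<otimes> x \<otimes> inv y = x [^] i \<otimes> z"
  shows "z \<in> N"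
proof -
  interpret H: rotation_pair "G Mod N" "N #> x" "N #> y" by (rule quotient_rotation_pair[OF N(1)])
  interpret \<pi>: group_hom G "G Mod N" "\<lambda>g. N #> g" by (rule quotient_rotation_pair[OF N(1)])
  have subN: "subgroup N G" using N(1) by (rule normal_imp_subgroup)
  have zc [simp]: "z \<in> carrier G" by (simp add: z)
  have "N #> (inv y \<otimes> x \<otimes> inv y) = N #> (x [^] i \<otimes> z)" by (simp only: rel)
  then have rel': "inv\<^bsub>G Mod N\<^esub> (N #> y) \<otimes>\<^bsub>G Mod N\<^esub> (N #> x) \<otimes>\<^bsub>G Mod N\<^esub> inv\<^bsub>G Mod N\<^esub> (N #> y)
      = (N #> x) [^]\<^bsub>G Mod N\<^esub> i \<otimes>\<^bsub>G Mod N\<^esub> (N #> z)"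
    by (simp only: \<pi>.hom_mult \<pi>.hom_inv \<pi>.hom_int_pow x_closed y_closed inv_closed m_closed int_pow_closed zc)
  have "N #> z = (N #> y) [^]\<^bsub>G Mod N\<^esub> n" unfolding z by (rule \<pi>.hom_int_pow[OF y_closed])
  from H.remainder_central[OF refl this rel']
  have comm: "N #> (z \<otimes> x) = N #> (x \<otimes> z)" by (simp only: \<pi>.hom_mult x_closed zc)
  then have comm1: "x \<otimes> z \<otimes> inv x \<otimes> inv z \<in> N"
    using rcoset_eq_iff[OF subN, of "x \<otimes> z" "z \<otimes> x"] by (simp add: inv_mult_group m_assoc)
  from normal.inv_op_closed1[OF N(1) x_closed subgroup.m_inv_closed[OF subN this]]
  have comm2: "inv x \<otimes> z \<otimes> x \<otimes> inv z \<in> N" by (simp add: inv_mult_group m_assoc inv_cancel_left)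
  let ?S = "{w, z}"
  have wc: "w \<in> carrier G" using generate_in_carrier[OF _ w] by simp
  have S: "?S \<subseteq> carrier G" using wc by simp
  have N_S: "N \<subseteq> generate G ?S" unfolding N(2) by (rule mono_generate) blast
  have zS: "z \<in> generate G ?S" and wN: "w \<in> N" unfolding N(2) by (auto intro: generate.incl)
  have yz: "y \<otimes> z = z \<otimes> y"
    using int_pow_mult[OF y_closed, of 1 n] int_pow_mult[OF y_closed, of n 1]
    by (simp add: z add.commute)
  have "generate G ?S \<lhd> G"
  proof (rule normal_generateI_gens[OF S])
    fix a s assume a: "a \<in> {x, y, inv x, inv y}" and "s \<in> ?S"
    then consider "s = w" | "s = z" by blast
    then show "a \<otimes> s \<otimes> inv a \<in> generate G ?S"
    proof cases
      case 1
      have "a \<in> carrier G" using a by auto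
      then show ?thesis using normal.inv_op_closed2[OF N(1) _ wN] N_S 1 by blast
    next
      case 2
      have "x \<otimes> z \<otimes> inv x = x \<otimes> z \<otimes> inv x \<otimes> inv z \<otimes> z" "inv x \<otimes> z \<otimes> x = inv x \<otimes> z \<otimes> x \<otimes> inv z \<otimes> z"
        by (simp_all add: m_assoc)
      then have "x \<otimes> z \<otimes> inv x \<in> generate G ?S" "inv x \<otimes> z \<otimes> x \<in> generate G ?S"
        using generate.eng[OF subsetD[OF N_S comm1] zS] generate.eng[OF subsetD[OF N_S comm2] zS]
        by metis+
      moreover have "y \<otimes> z \<otimes> inv y = z" unfolding yz by (simp add: m_assoc)
      moreover have "inv y \<otimes> z \<otimes> y = z" by (simp add: m_assoc inv_cancel_left flip: yz)
      ultimately show ?thesis using a 2 zS by auto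
    qed
  qed
  moreover have "z \<in> generate G {y}" unfolding generate_pow[OF y_closed] z by blast
  then have "generate G ?S \<subseteq> generate G {y}"
    using w by (intro generate_subgroup_incl generate_is_subgroup) auto
  ultimately show ?thesis using core zS by blast
qed

end

section \<open>Atomic chiral polyhedra\<close>

context chiral_flagged_polyhedron
begin

text \<open>Otherwise the quotient is the rotation group of a tight chiral polyhedron of type
  \<open>{p, q'}\<close> covered by P. The condition on \<open>y\<close> keeps its image nontrivial,
  as a coset geometry requires.\<close>

lemma atomic_quotient_reflexible:
  assumes atomic: "atomic_chiral P \<Phi> p q" and q': "q' dvd q" "0 < q'" "q' < q"
    and N: "N \<lhd> G" "N = generate G {y [^]\<^bsub>G\<^esub> q'}" and y: "y \<notin> N"
  shows "rotation_pair.reflexible (G Mod N) (N #>\<^bsub>G\<^esub> x) (N #>\<^bsub>G\<^esub> y)"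
proof (rule ccontr)
  assume not_refl: "\<not> ?thesis"
  have tight: "tight_polyhedron P p q" using atomic by (simp add: atomic_chiral_def)
  note ords = tight_orders[OF tight]
  have card: "card (carrier G) = G.ord x * G.ord y" using ords by simp
  have q'y: "q' dvd G.ord y" using q' ords by simp
  note Q_ords = G.quotient_orders[OF ords(1) card geometry.inter_trivial q'y q'(2) N]
  interpret H: rotation_pair "G Mod N" "N #>\<^bsub>G\<^esub> x" "N #>\<^bsub>G\<^esub> y"
    by (rule G.quotient_rotation_pair[OF N(1)])
  interpret \<pi>: group_hom G "G Mod N" "\<lambda>g. N #>\<^bsub>G\<^esub> g"
    by (rule G.quotient_rotation_pair[OF N(1)])
  have pos: "0 < p" using G.ord_ge_1[OF ords(1) rot_in(1)] ords(3) by linarith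
  have fin: "finite (carrier (G Mod N))"
    using Q_ords(3) ords(3) pos q'(2) by (intro card_ge_0_finite) simp
  have x1: "N #>\<^bsub>G\<^esub> x \<noteq> \<one>\<^bsub>G Mod N\<^esub>"
  proof
    assume "N #>\<^bsub>G\<^esub> x = \<one>\<^bsub>G Mod N\<^esub>"
    then have "G.ord x = 1" using Q_ords(1) H.ord_eq_1[OF H.x_closed] by simp
    then show False using G.ord_eq_1[OF rot_in(1)] geometry.x_neq_one by blast
  qed
  have subN: "subgroup N G" using N(1) by (rule normal_imp_subgroup)
  have y1: "N #>\<^bsub>G\<^esub> y \<noteq> \<one>\<^bsub>G Mod N\<^esub>"
  proof
    assume "N #>\<^bsub>G\<^esub> y = \<one>\<^bsub>G Mod N\<^esub>"
    then have "N #>\<^bsub>G\<^esub> y = N" by (simp add: FactGroup_def)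
    then show False using G.rcos_self[OF rot_in(2) subN] y by blast
  qed
  obtain Q :: "nat ranked_poset" and V E F
    where geom: "coset_geometry (G Mod N) (N #>\<^bsub>G\<^esub> x) (N #>\<^bsub>G\<^esub> y) Q V E F"
    using H.ex_coset_geometry_nat[OF fin x1 y1 Q_ords(4)] by blast
  interpret Q: coset_geometry "G Mod N" "N #>\<^bsub>G\<^esub> x" "N #>\<^bsub>G\<^esub> y" Q V E F by (rule geom)
  let ?\<Psi> = "Q.even_flag \<one>\<^bsub>G Mod N\<^esub>"
  have "chiral_polyhedron Q" using Q.is_chiral not_refl by blast
  moreover have "tight_polyhedron Q p q'"
    using Q.is_tight[OF fin] Q_ords(1-3) ords(3) by simp
  moreover have "?\<Psi> \<in> flags Q" using Q.flag_in(1) H.one_closed by blast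
  moreover have "covers P \<Phi> Q ?\<Psi>"
    unfolding covers_def
  proof (intro bexI conjI)
    \<comment> \<open>The covering map reduces modulo N and then lets the coset act by right
      translation.\<close>
    let ?h = "\<lambda>g. Q.translation (N #>\<^bsub>G\<^esub> g)"
    show "?h x = rot1 Q ?\<Psi>" "?h y = rot2 Q ?\<Psi>" by (simp_all only: Q.rot_translation)
    show "?h \<in> hom G (rot_group Q ?\<Psi>)"
    proof (rule homI)
      fix g h assume gh: "g \<in> carrier G" "h \<in> carrier G"
      show "?h g \<in> carrier (rot_group Q ?\<Psi>)"
        using Q.translation_hom_rot_group \<pi>.hom_closed[OF gh(1)] by (rule hom_in_carrier)
      show "?h (g \<otimes>\<^bsub>G\<^esub> h) = ?h g \<otimes>\<^bsub>rot_group Q ?\<Psi>\<^esub> ?h h"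
        unfolding \<pi>.hom_mult[OF gh]
        using hom_mult[OF Q.translation_hom_rot_group \<pi>.hom_closed[OF gh(1)] \<pi>.hom_closed[OF gh(2)]] .
    qed
  qed
  ultimately show False using atomic q'(3) unfolding atomic_chiral_def by blast
qed

end

theorem theorem4p7:
  fixes P :: "'a ranked_poset" and \<Phi> :: "'a flag" and p q q' :: nat
  assumes "\<Phi> \<in> flags P"
    and "atomic_chiral P \<Phi> p q"
    and "p < q"
    and "q' dvd q"
    and "is_core (rot_group P \<Phi>)
           (generate (rot_group P \<Phi>) {rot2 P \<Phi>})
           (generate (rot_group P \<Phi>) {rot2 P \<Phi> [^]\<^bsub>rot_group P \<Phi>\<^esub> q'})"
  shows "(\<exists>i k a :: int.
            [a\<^sup>2 = 1] (mod int (q div q')) \<and>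
            \<not> [a = 1] (mod int (q div q')) \<and>
            rot_group_is_Gamma P \<Phi> (int p) (int q)
              i (1 + k * int q') (- i) (- 1 - a * k * int q'))
         \<and> even p"
proof -
  have chiral: "chiral_polyhedron P" and tight: "tight_polyhedron P p q"
    using assms(2) by (simp_all add: atomic_chiral_def)
  interpret chiral_flagged_polyhedron P \<Phi>
    using chiral assms(1) by unfold_locales (simp_all add: chiral_polyhedron_def)
  note ords = tight_orders[OF tight]
  define N where "N = generate G {y [^]\<^bsub>G\<^esub> q'}"
  have N: "N \<lhd> G" "N \<subseteq> generate G {y}" and core: "\<And>M. M \<lhd> G \<Longrightarrow> M \<subseteq> generate G {y} \<Longrightarrow> M \<subseteq> N"
    using assms(5) unfolding is_core_def N_def by blast+
  have card: "card (carrier G) = G.ord x * G.ord y" using ords by simp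
  have q'y: "q' dvd G.ord y" using assms(4) ords by simp
  have pos: "0 < q'" using assms(3,4) by (intro Nat.gr0I) auto
  have "q' \<noteq> q"
  proof
    assume "q' = q"
    then have "y [^]\<^bsub>G\<^esub> q' = \<one>\<^bsub>G\<^esub>" using G.pow_ord_eq_1[OF rot_in(2)] ords(4) by blast
    then have "N = {\<one>\<^bsub>G\<^esub>}" unfolding N_def using G.generate_one by (simp only:)
    then have "q \<le> p" using G.trivial_core_order_le[OF ords(1) card] core ords(3,4) by simp
    then show False using assms(3) by simp
  qed
  then have "q' < q" using assms(3,4) dvd_imp_le[of q' q] by simp
  have W: "y [^]\<^bsub>G\<^esub> q' \<in> generate G {y}"
    using N(2) generate.incl[of "y [^]\<^bsub>G\<^esub> q'" "{y [^]\<^bsub>G\<^esub> q'}" G]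
    unfolding N_def by blast
  have mem: "inv\<^bsub>G\<^esub> y \<otimes>\<^bsub>G\<^esub> x \<otimes>\<^bsub>G\<^esub> inv\<^bsub>G\<^esub> y \<in> carrier G"
    by (intro G.m_closed G.inv_closed rot_in)
  have card_XY: "card (generate G {x}) * card (generate G {y}) = card (carrier G)"
    using card G.generate_pow_card[OF rot_in(1)] G.generate_pow_card[OF rot_in(2)] by simp
  obtain u z where u: "u \<in> generate G {x}" "z \<in> generate G {y}"
    "inv\<^bsub>G\<^esub> y \<otimes>\<^bsub>G\<^esub> x \<otimes>\<^bsub>G\<^esub> inv\<^bsub>G\<^esub> y = u \<otimes>\<^bsub>G\<^esub> z"
    by (rule G.factor_of_card[OF ords(1) generate_subgroup geometry.inter_trivial card_XY mem])
  obtain i n :: int where i: "u = x [^]\<^bsub>G\<^esub> i" and n: "z = y [^]\<^bsub>G\<^esub> n"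
    using u(1,2) unfolding G.generate_pow[OF rot_in(1)] G.generate_pow[OF rot_in(2)] by blast
  have rel: "inv\<^bsub>G\<^esub> y \<otimes>\<^bsub>G\<^esub> x \<otimes>\<^bsub>G\<^esub> inv\<^bsub>G\<^esub> y = x [^]\<^bsub>G\<^esub> i \<otimes>\<^bsub>G\<^esub> z" using u(3) unfolding i .
  have "z \<in> N"
  \<comment> \<open>If the core is all of Y, the quotient kills \<open>y\<close> and carries no
    polyhedron, but then \<open>z\<close> lies in N anyway.\<close>
  proof (cases "y \<in> N")
    case True
    then have "generate G {y} \<subseteq> N"
      using G.generate_subgroup_incl[OF _ normal_imp_subgroup[OF N(1)], of "{y}"] by blast
    then show ?thesis using u(2) by blast
  next
    case False
    note refl = atomic_quotient_reflexible[OF assms(2,4) pos \<open>q' < q\<close> N(1) N_def False]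
    show ?thesis by (rule G.remainder_in_core[OF N(1) N_def W core refl n rel])
  qed
  from G.parameters[OF q'y pos N(1)[unfolded N_def] geometry.inter_trivial not_reflexible rel this[unfolded N_def]]
  obtain k a :: int where ka: "[a\<^sup>2 = 1] (mod int (q div q'))" "\<not> [a = 1] (mod int (q div q'))"
    and rel1: "inv\<^bsub>G\<^esub> y \<otimes>\<^bsub>G\<^esub> x = x [^]\<^bsub>G\<^esub> i \<otimes>\<^bsub>G\<^esub> y [^]\<^bsub>G\<^esub> (1 + k * int q')"
    and rel2: "y \<otimes>\<^bsub>G\<^esub> inv\<^bsub>G\<^esub> x = x [^]\<^bsub>G\<^esub> (- i) \<otimes>\<^bsub>G\<^esub> y [^]\<^bsub>G\<^esub> (- 1 - a * (k * int q'))"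
    and even: "even p"
    unfolding ords(3,4) by blast
  have "rot_group_is_Gamma P \<Phi> (int p) (int q) i (1 + k * int q') (- i) (- 1 - a * (k * int q'))"
    unfolding rot_group_is_Gamma_def
    using G.Gamma_iso[OF rel1 rel2 geometry.inter_trivial] unfolding ords(3,4) by blast
  then have "rot_group_is_Gamma P \<Phi> (int p) (int q) i (1 + k * int q') (- i) (- 1 - a * k * int q')"
    by (simp only: mult.assoc)
  then show ?thesis using ka even by blast
qed

end
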